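(* Assume that the algebro-geometric Brascamp--Lieb conjecture (stated in full in the context) is true. Then for every integer $n\ge1$ and every field $k$ with $\operatorname{char}(k)\ne 2$ there is a constant $C_{n,k}>0$, depending only on $n$ and $k$, such that the following holds. Let $V=k^n$, let $B$ be a non-degenerate symmetric bilinear form on $V$, and let $G$ be one of the groups $\mathrm{O}(V,B)$ or $\mathrm{SO}(V,B)$. Let $E\subset V$ be a finite subset, and let $u=(u_1,\dots,u_n)$ be an ordered basis of $V$. Then $$|T_{E,u}^G|\le C_{n,k}\,|E|^{n/2},$$ where $T_{E,u}^{G}=\{g\in G(k) : g u_i\in E\text{ for each } i=1,\dots,n\}$.
   Context: A variety over a field $k$ is a scheme of finite type over $k$. $\mathrm{O}(V,B)(k)$ is the group of $k$-linear automorphisms of $V$ preserving $B$, and $\mathrm{SO}(V,B)(k)$ is its subgroup of elements of determinant $1$. The algebro-geometric Brascamp--Lieb conjecture is the following statement. Let $k$ be a field, let $X,Y_1,\dots,Y_m$ be affine varieties over $k$, and let $\pi_j:X\to Y_j$ be morphisms ($j=1,\dots,m$). Let $p_1,\dots,p_m\in(0,1]$. Suppose that $$\dim Z\le \sum_{j=1}^m p_j\dim\overline{(\pi_j)_{\overline{k}}(Z)}\quad\text{for every irreducible subvariety } Z\subset X_{\overline{k}},$$ where $\overline{k}$ is an algebraic closure of $k$, $(\pi_j)_{\overline k}$ denotes the base change of $\pi_j$ to $\overline{k}$, and the bar denotes the closure of the image. Then there exists a $C>0$ such that for all finite subsets $A_j\subset Y_j(k)$ ($j=1,\dots,m$), $$\#\{x\in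 X(k) : \pi_j(x)\in A_j\text{ for all } j\}\le C\prod_{j=1}^m|A_j|^{p_j}.$$ *)

theory Defs
  imports
    "HOL-Analysis.Analysis"
    "HOL-Library.Poly_Mapping"
    "HOL-Algebra.Algebraic_Closure_Type"
begin

section \<open>Irreducibility and dimension of topological spaces\<close>

definition irreducible_space :: "'a topology \<Rightarrow> bool" where
  "irreducible_space T \<longleftrightarrow> topspace T \<noteq> {} \<and>
     (\<forall>A B. closedin T A \<and> closedin T B \<and> A \<union> B = topspace T \<longrightarrow>
            A = topspace T \<or> B = topspace T)"

text \<open>The supremum of the lengths of strictly increasing chains of irreducible closed subsets.
  The empty space gets the value 0 because the supremum is taken in \<^typ>\<open>enat\<close>;
  below the dimension is only taken of nonempty spaces.\<close>

definition krull_dim :: "'a topology \<Rightarrow> enat" where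
  "krull_dim T = Sup {enat l | l. \<exists>W :: nat \<Rightarrow> 'a set.
     (\<forall>i\<le>l. closedin T (W i) \<and> irreducible_space (subtopology T (W i))) \<and>
     (\<forall>i<l. W i \<subset> W (Suc i))}"


section \<open>The prime spectrum\<close>

definition zariski_open :: "('a, 'b) ring_scheme \<Rightarrow> 'a set set \<Rightarrow> bool" where
  "zariski_open R U \<longleftrightarrow> (\<exists>S \<subseteq> carrier R. U = {P. primeideal P R \<and> \<not> S \<subseteq> P})"

lemma istopology_zariski: "istopology (zariski_open R)"
  unfolding istopology_def
proof (intro conjI allI impI)
  fix U V assume "zariski_open R U" "zariski_open R V"
  then obtain S T where S: "S \<subseteq> carrier R" "U = {P. primeideal P R \<and> \<not> S \<subseteq> P}"
    and T: "T \<subseteq> carrier R" "V = {P. primeideal P R \<and> \<not> T \<subseteq> P}"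
    unfolding zariski_open_def by auto
  define ST where "ST = {s \<otimes>\<^bsub>R\<^esub> t | s t. s \<in> S \<and> t \<in> T}"
  have iff: "\<not> ST \<subseteq> P \<longleftrightarrow> \<not> S \<subseteq> P \<and> \<not> T \<subseteq> P" if P: "primeideal P R" for P
  proof -
    interpret primeideal P R by (rule P)
    show ?thesis
    proof
      assume "\<not> ST \<subseteq> P"
      then obtain s t where st: "s \<in> S" "t \<in> T" "s \<otimes>\<^bsub>R\<^esub> t \<notin> P"
        unfolding ST_def by auto
      then have "s \<notin> P" "t \<notin> P"
        using I_r_closed[of s t] I_l_closed[of t s] S(1) T(1) by auto
      with st show "\<not> S \<subseteq> P \<and> \<not> T \<subseteq> P" by auto
    next
      assume "\<not> S \<subseteq> P \<and> \<not> T \<subseteq> P"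
      then obtain s t where st: "s \<in> S" "t \<in> T" "s \<notin> P" "t \<notin> P" by auto
      then have "s \<otimes>\<^bsub>R\<^esub> t \<notin> P" using I_prime[of s t] S(1) T(1) by auto
      with st show "\<not> ST \<subseteq> P" unfolding ST_def by auto
    qed
  qed
  have sub: "ST \<subseteq> carrier R" if "primeideal P R" for P
  proof -
    interpret primeideal P R by (rule that)
    show ?thesis using S(1) T(1) by (auto simp: ST_def)
  qed
  show "zariski_open R (U \<inter> V)"
  proof (cases "\<exists>P. primeideal P R")
    case True
    then have "ST \<subseteq> carrier R" using sub by auto
    moreover have "U \<inter> V = {P. primeideal P R \<and> \<not> ST \<subseteq> P}"
      unfolding S(2) T(2) using iff by auto
    ultimately show ?thesis unfolding zariski_open_def by (intro exI[of _ ST]) simp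
  next
    case False
    then have "U \<inter> V = {P. primeideal P R \<and> \<not> {} \<subseteq> P}" unfolding S(2) by auto
    then show ?thesis unfolding zariski_open_def by (intro exI[of _ "{}"]) simp
  qed
next
  fix \<K> assume K: "\<forall>U\<in>\<K>. zariski_open R U"
  then have "\<forall>U\<in>\<K>. \<exists>S. S \<subseteq> carrier R \<and> U = {P. primeideal P R \<and> \<not> S \<subseteq> P}"
    unfolding zariski_open_def by simp
  from bchoice[OF this] obtain S
    where S: "\<forall>U\<in>\<K>. S U \<subseteq> carrier R \<and> U = {P. primeideal P R \<and> \<not> S U \<subseteq> P}" ..
  have "P \<in> \<Union>\<K> \<longleftrightarrow> primeideal P R \<and> \<not> (\<Union>U\<in>\<K>. S U) \<subseteq> P" for P
  proof -
    have "P \<in> U \<longleftrightarrow> primeideal P R \<and> \<not> S U \<subseteq> P" if "U \<in> \<K>" for U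
    proof -
      have "U = {P. primeideal P R \<and> \<not> S U \<subseteq> P}" using S that by simp
      then have "P \<in> U \<longleftrightarrow> P \<in> {P. primeideal P R \<and> \<not> S U \<subseteq> P}" by (rule arg_cong)
      then show ?thesis by simp
    qed
    then show ?thesis by (simp add: UN_subset_iff)
  qed
  then have "\<Union>\<K> = {P. primeideal P R \<and> \<not> (\<Union>U\<in>\<K>. S U) \<subseteq> P}"
    by (simp add: set_eq_iff)
  moreover have "(\<Union>U\<in>\<K>. S U) \<subseteq> carrier R" using S by (simp add: UN_subset_iff)
  ultimately show "zariski_open R (\<Union>\<K>)"
    unfolding zariski_open_def by (intro exI[of _ "\<Union>U\<in>\<K>. S U"]) simp
qed

definition Spec :: "('a, 'b) ring_scheme \<Rightarrow> 'a set topology" where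
  "Spec R = topology (zariski_open R)"

lemma openin_Spec: "openin (Spec R) U \<longleftrightarrow> zariski_open R U"
  by (simp add: Spec_def topology_inverse'[OF istopology_zariski])


section \<open>Polynomial rings in finitely many variables\<close>

type_synonym 'a mpoly = "(nat \<Rightarrow>\<^sub>0 nat) \<Rightarrow>\<^sub>0 'a"

definition mpoly_ring :: "nat \<Rightarrow> 'a::comm_ring_1 mpoly ring" where
  "mpoly_ring N =
     \<lparr>carrier = {p. \<forall>m \<in> Poly_Mapping.keys p. Poly_Mapping.keys m \<subseteq> {..<N}},
      monoid.mult = (*), one = 1, ring.zero = 0, add = (+)\<rparr>"

lemma cring_mpoly_ring: "cring (mpoly_ring N :: 'a::comm_ring_1 mpoly ring)"
proof -
  let ?C = "{p :: 'a mpoly. \<forall>m \<in> Poly_Mapping.keys p. Poly_Mapping.keys m \<subseteq> {..<N}}"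
  have add: "p + q \<in> ?C" if "p \<in> ?C" "q \<in> ?C" for p q
    using that Poly_Mapping.keys_add[of p q] by blast
  have mult: "p * q \<in> ?C" if "p \<in> ?C" "q \<in> ?C" for p q
  proof -
    have "Poly_Mapping.keys m \<subseteq> {..<N}" if m: "m \<in> Poly_Mapping.keys (p * q)" for m
    proof -
      obtain a b where ab: "m = a + b" "a \<in> Poly_Mapping.keys p" "b \<in> Poly_Mapping.keys q"
        using m keys_mult[of p q] by blast
      show ?thesis
        using Poly_Mapping.keys_add[of a b] ab \<open>p \<in> ?C\<close> \<open>q \<in> ?C\<close> by blast
    qed
    then show ?thesis by blast
  qed
  have zero: "0 \<in> ?C" and one: "1 \<in> ?C" by (auto simp flip: single_one)
  have neg: "\<exists>q\<in>?C. q + p = 0" if "p \<in> ?C" for p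
    using that by (intro bexI[of _ "-p"]) auto
  let ?R = "mpoly_ring N :: 'a mpoly ring"
  have R: "carrier ?R = ?C" "\<And>x y. x \<otimes>\<^bsub>?R\<^esub> y = x * y" "\<one>\<^bsub>?R\<^esub> = 1"
    "\<zero>\<^bsub>?R\<^esub> = 0" "\<And>x y. x \<oplus>\<^bsub>?R\<^esub> y = x + y"
    by (simp_all add: mpoly_ring_def)
  have "abelian_group ?R"
    by (rule abelian_groupI; (unfold R)?)
       (rule add, assumption+, rule zero, rule add.assoc, rule add.commute, rule add_0_left, rule neg)
  moreover have "comm_monoid ?R"
    by (rule comm_monoidI; (unfold R)?)
       (rule mult, assumption+, rule one, rule mult.assoc, rule mult_1_left, rule mult.commute)
  moreover have "(x \<oplus>\<^bsub>?R\<^esub> y) \<otimes>\<^bsub>?R\<^esub> z = x \<otimes>\<^bsub>?R\<^esub> z \<oplus>\<^bsub>?R\<^esub> y \<otimes>\<^bsub>?R\<^esub> z" for x y z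
    unfolding R by (rule distrib_right)
  ultimately show ?thesis by (rule cringI)
qed

text \<open>Evaluation at \<open>x\<close> along a ring homomorphism \<open>\<phi>\<close> on the coefficients.\<close>

definition mpoly_eval ::
    "('a::zero \<Rightarrow> 'b::comm_semiring_1) \<Rightarrow> (nat \<Rightarrow> 'b) \<Rightarrow> 'a mpoly \<Rightarrow> 'b" where
  "mpoly_eval \<phi> x p = (\<Sum>m \<in> Poly_Mapping.keys p. \<phi> (Poly_Mapping.lookup p m) *
     (\<Prod>i \<in> Poly_Mapping.keys m. x i ^ Poly_Mapping.lookup m i))"

definition mpoly_subst :: "(nat \<Rightarrow> 'a mpoly) \<Rightarrow> 'a::comm_ring_1 mpoly \<Rightarrow> 'a mpoly" where
  "mpoly_subst f = mpoly_eval (Poly_Mapping.single 0) f"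


section \<open>Affine varieties\<close>

text \<open>An affine scheme of finite type over \<open>k\<close> is given by a presentation
  \<open>k[x\<^sub>0, \<dots>, x\<^sub>N\<^sub>-\<^sub>1] / I\<close> of its coordinate ring; \<open>I\<close> need not be radical.\<close>

record (overloaded) 'a affine_scheme =
  nvars :: nat
  defideal :: "'a mpoly set"

definition affine_variety :: "'k::field affine_scheme \<Rightarrow> bool" where
  "affine_variety \<X> \<longleftrightarrow> ideal (defideal \<X>) (mpoly_ring (nvars \<X>))"

text \<open>The underlying space of \<open>\<X>\<close>, realised as the closed subset of primes of the polynomial ring
  that contain \<open>I\<close>.\<close>

definition space_of :: "'k::field affine_scheme \<Rightarrow> 'k mpoly set topology" where
  "space_of \<X> = subtopology (Spec (mpoly_ring (nvars \<X>))) {P. defideal \<X> \<subseteq> P}"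

definition rational_points :: "'k::field affine_scheme \<Rightarrow> (nat \<Rightarrow> 'k) set" where
  "rational_points \<X> =
     {x \<in> {..<nvars \<X>} \<rightarrow>\<^sub>E UNIV. \<forall>p \<in> defideal \<X>. mpoly_eval (\<lambda>c. c) x p = 0}"

text \<open>A morphism from \<open>\<X>\<close> to \<open>\<Y>\<close> is given by polynomials \<open>f 0, \<dots>, f (nvars \<Y> - 1)\<close> representing
  the images of the coordinate functions of \<open>\<Y>\<close> under the homomorphism of coordinate rings. Every
  \<open>k\<close>-algebra homomorphism between the coordinate rings arises in this way.\<close>

definition affine_morphism ::
    "'k::field affine_scheme \<Rightarrow> 'k affine_scheme \<Rightarrow> (nat \<Rightarrow> 'k mpoly) \<Rightarrow> bool" where
  "affine_morphism \<X> \<Y> f \<longleftrightarrow>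
     (\<forall>i<nvars \<Y>. f i \<in> carrier (mpoly_ring (nvars \<X>))) \<and>
     (\<forall>q \<in> defideal \<Y>. mpoly_subst f q \<in> defideal \<X>)"

definition map_points ::
    "'k::field affine_scheme \<Rightarrow> (nat \<Rightarrow> 'k mpoly) \<Rightarrow> (nat \<Rightarrow> 'k) \<Rightarrow> nat \<Rightarrow> 'k" where
  "map_points \<Y> f x = (\<lambda>i\<in>{..<nvars \<Y>}. mpoly_eval (\<lambda>c. c) x (f i))"

text \<open>On underlying spaces a morphism is contraction of primes along \<open>q \<mapsto> q(f)\<close>.\<close>

definition map_space ::
    "'k::field affine_scheme \<Rightarrow> (nat \<Rightarrow> 'k mpoly) \<Rightarrow> 'k mpoly set \<Rightarrow> 'k mpoly set" where
  "map_space \<Y> f P = {q \<in> carrier (mpoly_ring (nvars \<Y>)). mpoly_subst f q \<in> P}"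

definition base_change :: "'k::field affine_scheme \<Rightarrow> 'k alg_closure affine_scheme" where
  "base_change \<X> = \<lparr>nvars = nvars \<X>,
     defideal = genideal (mpoly_ring (nvars \<X>)) (Poly_Mapping.map to_ac ` defideal \<X>)\<rparr>"

definition base_change_morphism ::
    "(nat \<Rightarrow> 'k::field mpoly) \<Rightarrow> nat \<Rightarrow> 'k alg_closure mpoly" where
  "base_change_morphism f i = Poly_Mapping.map to_ac (f i)"


section \<open>The algebro-geometric Brascamp--Lieb conjecture over a field\<close>

text \<open>\<open>Z\<close> ranges over the irreducible closed subsets of the base change to the algebraic closure.\<close>

definition brascamp_lieb_condition ::
    "'k::field affine_scheme \<Rightarrow> nat \<Rightarrow> (nat \<Rightarrow> 'k affine_scheme) \<Rightarrow>
     (nat \<Rightarrow> nat \<Rightarrow> 'k mpoly) \<Rightarrow> (nat \<Rightarrow> real) \<Rightarrow> bool" where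
  "brascamp_lieb_condition \<X> m \<Y> \<pi> p \<longleftrightarrow>
     (\<forall>Z. closedin (space_of (base_change \<X>)) Z \<and>
          irreducible_space (subtopology (space_of (base_change \<X>)) Z) \<longrightarrow>
        ereal_of_enat (krull_dim (subtopology (space_of (base_change \<X>)) Z)) \<le>
        (\<Sum>j<m. ereal (p j) * ereal_of_enat (krull_dim (subtopology (space_of (base_change (\<Y> j)))
           (space_of (base_change (\<Y> j)) closure_of
              (map_space (base_change (\<Y> j)) (base_change_morphism (\<pi> j)) ` Z))))))"

text \<open>The conjecture for one field \<open>k\<close>, since types cannot be quantified inside a formula.\<close>

definition brascamp_lieb_conjecture :: "'k::field itself \<Rightarrow> bool" where
  "brascamp_lieb_conjecture (_ :: 'k itself) \<longleftrightarrow>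
     (\<forall>(\<X> :: 'k affine_scheme) m \<Y> \<pi> (p :: nat \<Rightarrow> real).
        affine_variety \<X> \<longrightarrow>
        (\<forall>j<m. affine_variety (\<Y> j) \<and> affine_morphism \<X> (\<Y> j) (\<pi> j) \<and> 0 < p j \<and> p j \<le> 1) \<longrightarrow>
        brascamp_lieb_condition \<X> m \<Y> \<pi> p \<longrightarrow>
        (\<exists>C>0. \<forall>A. (\<forall>j<m. finite (A j) \<and> A j \<subseteq> rational_points (\<Y> j)) \<longrightarrow>
           finite {x \<in> rational_points \<X>. \<forall>j<m. map_points (\<Y> j) (\<pi> j) x \<in> A j} \<and>
           real (card {x \<in> rational_points \<X>. \<forall>j<m. map_points (\<Y> j) (\<pi> j) x \<in> A j})
             \<le> C * (\<Prod>j<m. real (card (A j)) powr p j)))"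


section \<open>Bilinear forms and orthogonal groups\<close>

definition bilinear_form :: "('k::field ^ 'n \<Rightarrow> 'k ^ 'n \<Rightarrow> 'k) \<Rightarrow> bool" where
  "bilinear_form B \<longleftrightarrow>
     (\<forall>x. Vector_Spaces.linear (*s) (*) (\<lambda>y. B x y)) \<and>
     (\<forall>y. Vector_Spaces.linear (*s) (*) (\<lambda>x. B x y))"

definition symmetric_form :: "('k::field ^ 'n \<Rightarrow> 'k ^ 'n \<Rightarrow> 'k) \<Rightarrow> bool" where
  "symmetric_form B \<longleftrightarrow> (\<forall>x y. B x y = B y x)"

definition nondegenerate_form :: "('k::field ^ 'n \<Rightarrow> 'k ^ 'n \<Rightarrow> 'k) \<Rightarrow> bool" where
  "nondegenerate_form B \<longleftrightarrow> (\<forall>x. (\<forall>y. B x y = 0) \<longrightarrow> x = 0)"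

definition orthogonal_group ::
    "('k::field ^ 'n \<Rightarrow> 'k ^ 'n \<Rightarrow> 'k) \<Rightarrow> ('k ^ 'n \<Rightarrow> 'k ^ 'n) set" where
  "orthogonal_group B =
     {g. Vector_Spaces.linear (*s) (*s) g \<and> bij g \<and> (\<forall>x y. B (g x) (g y) = B x y)}"

definition special_orthogonal_group ::
    "('k::field ^ 'n \<Rightarrow> 'k ^ 'n \<Rightarrow> 'k) \<Rightarrow> ('k ^ 'n \<Rightarrow> 'k ^ 'n) set" where
  "special_orthogonal_group B = {g \<in> orthogonal_group B. det (matrix g) = 1}"

text \<open>The basis vectors are indexed by the same \<open>n\<close>-element type as the coordinates.\<close>

definition ordered_basis :: "('n \<Rightarrow> 'k::field ^ 'n) \<Rightarrow> bool" where
  "ordered_basis u \<longleftrightarrow> inj u \<and> vec.independent (range u) \<and> vec.span (range u) = UNIV"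

definition transporter ::
    "('k::field ^ 'n \<Rightarrow> 'k ^ 'n) set \<Rightarrow> ('k ^ 'n) set \<Rightarrow> ('n \<Rightarrow> 'k ^ 'n) \<Rightarrow>
     ('k ^ 'n \<Rightarrow> 'k ^ 'n) set" where
  "transporter G E u = {g \<in> G. \<forall>i. g (u i) \<in> E}"

end

theory Submission
  imports Defs "HOL-Library.Function_Algebras"
begin

text \<open>
The conjecture is applied to one variety, which depends on \<open>n\<close> only. Its points are tuples \<open>(v\<^sub>1, \<dots>, v\<^sub>n, S, G, R)\<close> of
\<open>n\<close> vectors and three \<open>n\<times>n\<close> matrices, such that \<open>S\<close> is symmetric, \<open>v\<^sub>i\<^sup>T S v\<^sub>j = G\<^sub>i\<^sub>j\<close>, and \<open>V R V\<^sup>T S = 1\<close> for the matrix \<open>V\<close> with columns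
\<open>v\<^sub>i\<close>. An isometry \<open>g\<close> of \<open>B\<close> gives the point with \<open>v\<^sub>i = g u\<^sub>i\<close>, where \<open>S\<close> is the matrix of \<open>B\<close>, \<open>G\<close> the Gram matrix of \<open>u\<close> and \<open>R\<close> its
inverse. The maps are the projection to the parameters \<open>(S, G, R)\<close> with weight \<open>1\<close>, and the projections to the vectors
\<open>v\<^sub>i\<close> with weight \<open>1/2\<close>. For fixed \<open>B\<close> and \<open>u\<close> the parameters take a single value, so the first map contributes the factor \<open>1\<close> to the
bound, and the others contribute \<open>|E|\<^bsup>n/2\<^esup>\<close>. Since \<open>B\<close> and \<open>u\<close> enter only through a point of the parameter space, the constant does not depend on
them. A transporter for the special orthogonal group is contained in that for the orthogonal group.

What has to be proved is the dimension condition. Let \<open>P\<close> be the prime of an irreducible closed subset, over the algebraic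
closure. Its dimension is the maximal number of coordinates that are algebraically independent modulo \<open>P\<close>: a chain of primes
above \<open>P\<close> has at most this length (\<open>indep_of_chain\<close>), and independent coordinates give a chain
of this length (\<open>ex_prime_chain\<close>). Algebraic independence is then compared with linear independence at a general point
(\<open>cotangent_ranks\<close>): the differentials of all coordinates span a space of at least the dimension of the variety, and
linearly independent differentials belong to algebraically independent coordinates. Both are valid in every characteristic, because over a
perfect field dependent elements satisfy a relation with a nonzero partial derivative (\<open>separable_relation\<close>). The
general point exists by the Nullstellensatz, which is proved together with the lifting of points along projections (\<open>lift_point\<close>).

This reduces the condition to linear algebra in the cotangent space (\<open>rank_bound\<close>). The vectors \<open>\<theta>\<^sub>i\<^sub>j = (dv\<^sub>i)\<^sup>T S v\<^sub>j\<close> satisfy \<open>\<theta>\<^sub>i\<^sub>j + \<theta>\<^sub>j\<^sub>i = 0\<close>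
modulo the differentials of the parameters, and \<open>\<theta>\<^sub>i\<^sub>i = 0\<close> since the characteristic is not \<open>2\<close>. Row \<open>i\<close> spans the same space as the
differentials of the entries of \<open>v\<^sub>i\<close>. Every entry of a skew-symmetric matrix occurs in two rows, so twice the dimension of the span of
all entries is at most the sum of the dimensions of the spans of the rows, by submodularity (\<open>skew_rank_bound\<close>). This is
where the exponent \<open>1/2\<close> comes from.
\<close>

hide_const (open) up_ring.monom up_ring.coeff module.smult Divisibility.prime
  Polynomials.degree Polynomials.lead_coeff Poly_Mapping.degree
alias lookup = Poly_Mapping.lookup
alias keys = Poly_Mapping.keys
alias single = Poly_Mapping.single
no_notation fps_nth (infixl "$" 75)

section \<open>Prime ideals and algebraic elements\<close>

locale prime_ideal =
  fixes P :: "'r::comm_ring_1 set"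
  assumes zero [simp, intro]: "0 \<in> P"
    and add [intro]: "x \<in> P \<Longrightarrow> y \<in> P \<Longrightarrow> x + y \<in> P"
    and absorb [intro]: "x \<in> P \<Longrightarrow> r * x \<in> P"
    and one [simp]: "1 \<notin> P"
    and prime: "x * y \<in> P \<Longrightarrow> x \<in> P \<or> y \<in> P"
begin

lemma absorb' [intro]: "x \<in> P \<Longrightarrow> x * r \<in> P"
  by (metis absorb mult.commute)

lemma uminus [intro]: "x \<in> P \<Longrightarrow> - x \<in> P"
  using absorb[of x "-1"] by simp

lemma diff [intro]: "x \<in> P \<Longrightarrow> y \<in> P \<Longrightarrow> x - y \<in> P"
  by (metis add uminus uminus_add_conv_diff add.commute)

lemma sum [intro]: "(\<And>i. i \<in> I \<Longrightarrow> f i \<in> P) \<Longrightarrow> sum f I \<in> P"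
  by (induction I rule: infinite_finite_induct) auto

lemma mult_notin: "x \<notin> P \<Longrightarrow> y \<notin> P \<Longrightarrow> x * y \<notin> P"
  using prime by blast

lemma power_notin: "x \<notin> P \<Longrightarrow> x ^ k \<notin> P"
  by (induction k) (auto dest: prime)

lemma prod_notin: "(\<And>i. i \<in> I \<Longrightarrow> f i \<notin> P) \<Longrightarrow> prod f I \<notin> P"
  by (induction I rule: infinite_finite_induct) (auto dest: prime)

lemma cong: "x - y \<in> P \<Longrightarrow> x \<in> P \<longleftrightarrow> y \<in> P"
  using diff[of x "x - y"] add[of "x - y" y] by auto

end

definition polys :: "'r::comm_ring_1 set \<Rightarrow> 'r poly set" where
  "polys A = {p. \<forall>i. coeff p i \<in> A}"

lemma polysI: "(\<And>i. coeff p i \<in> A) \<Longrightarrow> p \<in> polys A"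
  and polysD: "p \<in> polys A \<Longrightarrow> coeff p i \<in> A"
  by (auto simp: polys_def)

locale ring_set =
  fixes A :: "'r::comm_ring_1 set"
  assumes one [simp]: "1 \<in> A"
    and diff [intro]: "x \<in> A \<Longrightarrow> y \<in> A \<Longrightarrow> x - y \<in> A"
    and mult [intro]: "x \<in> A \<Longrightarrow> y \<in> A \<Longrightarrow> x * y \<in> A"
begin

lemma zero [simp]: "0 \<in> A"
  using diff[of 1 1] by simp

lemma uminus [intro]: "x \<in> A \<Longrightarrow> - x \<in> A"
  using diff[of 0 x] by simp

lemma add [intro]: "x \<in> A \<Longrightarrow> y \<in> A \<Longrightarrow> x + y \<in> A"
  using diff[of x "- y"] by auto

lemma sum [intro]: "(\<And>i. i \<in> I \<Longrightarrow> f i \<in> A) \<Longrightarrow> sum f I \<in> A"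
  by (induction I rule: infinite_finite_induct) auto

lemma prod [intro]: "(\<And>i. i \<in> I \<Longrightarrow> f i \<in> A) \<Longrightarrow> prod f I \<in> A"
  by (induction I rule: infinite_finite_induct) auto

lemma power [intro]: "x \<in> A \<Longrightarrow> x ^ k \<in> A"
  by (induction k) auto

lemma of_nat [simp]: "of_nat k \<in> A"
  by (induction k) auto

lemma poly: "p \<in> polys A \<Longrightarrow> x \<in> A \<Longrightarrow> poly p x \<in> A"
  unfolding poly_altdef by (auto intro: polysD)

lemma ring_set_polys: "ring_set (polys A)"
proof
  show "1 \<in> polys A" by (rule polysI) (auto simp: coeff_1)
  show "x - y \<in> polys A" if "x \<in> polys A" "y \<in> polys A" for x y
    by (rule polysI) (use that in \<open>auto intro: polysD\<close>)
  show "x * y \<in> polys A" if "x \<in> polys A" "y \<in> polys A" for x y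
    by (rule polysI) (use that in \<open>auto  simp: coeff_mult intro: polysD\<close>)
qed

lemma smult_polys: "c \<in> A \<Longrightarrow> p \<in> polys A \<Longrightarrow> smult c p \<in> polys A"
  by (rule polysI) (auto intro: polysD)

lemma monom_polys: "c \<in> A \<Longrightarrow> monom c k \<in> polys A"
  by (rule polysI) (auto simp: coeff_monom)

lemma const_polys: "c \<in> A \<Longrightarrow> [:c:] \<in> polys A"
  using monom_polys[of c 0] by (simp add: monom_0)

text \<open>Division without inverses: the dividend is multiplied by a power of the leading coefficient, so that
quotient and remainder keep their coefficients in \<open>A\<close>.\<close>

lemma pseudo_division:
  assumes "h \<in> polys A" "g \<in> polys A" "degree g > 0"
  shows "\<exists>k. \<exists>q\<in>polys A. \<exists>r\<in>polys A.
    smult (lead_coeff g ^ k) h = q * g + r \<and> degree r < degree g \<and>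
    degree q \<le> degree h - degree g"
  using assms(1)
proof (induction "degree h" arbitrary: h rule: less_induct)
  case less
  interpret pA: ring_set "polys A" by (rule ring_set_polys)
  let ?c = "lead_coeff g" and ?d = "degree h - degree g"
  have c: "?c \<in> A" using assms(2) by (rule polysD)
  show ?case
  proof (cases "degree h < degree g")
    case True
    then show ?thesis using less.prems by (intro exI[of _ 0] bexI[of _ 0] bexI[of _ h]) auto
  next
    case False
    define m where "m = monom (lead_coeff h) ?d"
    define h' where "h' = smult ?c h - m * g"
    have m: "m \<in> polys A" unfolding m_def by (rule monom_polys) (rule polysD[OF less.prems])
    have h': "h' \<in> polys A"
      unfolding h'_def using m less.prems assms(2) c by (auto intro: smult_polys)
    have "degree (m * g) \<le> degree h"
      using False degree_mult_le[of m g] degree_monom_le[of "lead_coeff h" ?d]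
      unfolding m_def by linarith
    then have "degree h' \<le> degree h"
      unfolding h'_def by (intro degree_diff_le) (auto intro: order_trans[OF degree_smult_le])
    moreover have "coeff h' (degree h) = 0"
      using False by (simp add: h'_def m_def coeff_monom_mult mult.commute[of "lead_coeff h" "lead_coeff g"])
    ultimately have deg: "degree h' < degree h"
      using False assms(3) by (metis eq_zero_or_degree_less degree_0 gr_zeroI le_less_trans not_le)
    from less.hyps[OF this h'] obtain k q r where IH: "q \<in> polys A" "r \<in> polys A"
      "smult (?c ^ k) h' = q * g + r" "degree r < degree g"
      "degree q \<le> degree h' - degree g" by blast
    have "smult (?c ^ Suc k) h = smult (?c ^ k) (h' + m * g)"
      by (simp add: h'_def mult.commute)
    also have "\<dots> = (q + smult (?c ^ k) m) * g + r"
      using IH(3) by (simp add: smult_add_right algebra_simps)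
    finally have "smult (?c ^ Suc k) h = (q + smult (?c ^ k) m) * g + r" .
    moreover have "degree (q + smult (?c ^ k) m) \<le> ?d"
      using IH(5) deg degree_monom_le[of "lead_coeff h" ?d] unfolding m_def[symmetric]
      by (intro degree_add_le order_trans[OF degree_smult_le]) auto
    moreover have "q + smult (?c ^ k) m \<in> polys A"
      using IH(1) m c by (auto intro: smult_polys)
    ultimately show ?thesis using IH(2,4) by blast
  qed
qed

end

lemma pderiv_polys:
  fixes p :: "'r::idom poly"
  assumes "ring_set A" "p \<in> polys A"
  shows "pderiv p \<in> polys A"
proof -
  interpret ring_set A by fact
  show ?thesis
    by (rule polysI) (use assms(2) in \<open>auto simp del: of_nat_Suc simp: coeff_pderiv intro: polysD\<close>)
qed

context prime_ideal
begin

lemma polys_add: "p \<in> polys P \<Longrightarrow> q \<in> polys P \<Longrightarrow> p + q \<in> polys P"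
  by (rule polysI) (auto intro: polysD)

lemma polys_diff: "p \<in> polys P \<Longrightarrow> q \<in> polys P \<Longrightarrow> p - q \<in> polys P"
  by (rule polysI) (auto intro: polysD)

lemma poly_polys: "p \<in> polys P \<Longrightarrow> poly p x \<in> P"
  unfolding poly_altdef by (auto intro: polysD)

text \<open>Leading coefficients that vanish modulo \<open>P\<close> can be dropped. After this the degree and the leading
coefficient behave modulo \<open>P\<close> as they do over a domain.\<close>

lemma trim:
  assumes A: "ring_set A" and h: "h \<in> polys A" "h \<notin> polys P"
  shows "\<exists>h'\<in>polys A. lead_coeff h' \<notin> P \<and> h - h' \<in> polys P \<and>
    degree h' \<le> degree h"
  using h
proof (induction "degree h" arbitrary: h rule: less_induct)
  case less
  interpret A: ring_set A by fact
  interpret pA: ring_set "polys A" by (rule A.ring_set_polys)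
  let ?d = "degree h"
  show ?case
  proof (cases "lead_coeff h \<in> P")
    case False
    then show ?thesis using less.prems by (intro bexI[of _ h]) (auto intro: polysI)
  next
    case True
    define h1 where "h1 = h - monom (lead_coeff h) ?d"
    have h1A: "h1 \<in> polys A"
      unfolding h1_def using less.prems(1) by (auto intro!: A.monom_polys intro: polysD)
    have hh1: "h - h1 \<in> polys P" by (rule polysI) (use True in \<open>auto simp: h1_def coeff_monom\<close>)
    have h1P: "h1 \<notin> polys P"
    proof
      assume "h1 \<in> polys P"
      then have "(h - h1) + h1 \<in> polys P" using hh1 by (rule polys_add[rotated])
      then show False using less.prems by simp
    qed
    have "coeff h1 ?d = 0" by (simp add: h1_def)
    moreover have "degree h1 \<le> ?d"
      unfolding h1_def by (intro degree_diff_le) (auto simp: degree_monom_le)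
    moreover have "h1 \<noteq> 0" using h1P by (auto intro: polysI)
    ultimately have deg: "degree h1 < ?d"
      by (metis leading_coeff_0_iff nless_le)
    from less.hyps[OF this h1A h1P] obtain h' where h': "h' \<in> polys A"
      "lead_coeff h' \<notin> P" "h1 - h' \<in> polys P"
      "degree h' \<le> degree h1" by blast
    have "h - h' = (h - h1) + (h1 - h')" by simp
    then have "h - h' \<in> polys P" using polys_add[OF hh1 h'(3)] by simp
    then show ?thesis using h' deg by (intro bexI[of _ h']) auto
  qed
qed

lemma prime_ideal_polys: "prime_ideal (polys P)"
proof
  show "0 \<in> polys P" by (auto intro: polysI)
  show "x + y \<in> polys P" if "x \<in> polys P" "y \<in> polys P" for x y
    by (rule polysI) (use that in \<open>auto intro: polysD\<close>)
  show absb: "r * x \<in> polys P" if "x \<in> polys P" for r x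
    by (rule polysI) (use that in \<open>auto simp: coeff_mult intro: polysD\<close>)
  show "1 \<notin> polys P" by (auto simp: polys_def intro!: exI[of _ 0])
  fix x y assume xy: "x * y \<in> polys P"
  show "x \<in> polys P \<or> y \<in> polys P"
  proof (rule ccontr)
    assume neg: "\<not> (x \<in> polys P \<or> y \<in> polys P)"
    have U: "ring_set (UNIV :: 'r set)" by standard auto
    obtain x' where x': "lead_coeff x' \<notin> P" "x - x' \<in> polys P"
      using trim[OF U, of x] neg by (auto simp: polys_def)
    obtain y' where y': "lead_coeff y' \<notin> P" "y - y' \<in> polys P"
      using trim[OF U, of y] neg by (auto simp: polys_def)
    have "x' * y' = x * y - (y * (x - x') + x' * (y - y'))" by (simp add: algebra_simps)
    moreover have "y * (x - x') \<in> polys P" "x' * (y - y') \<in> polys P"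
      using absb x' y' by blast+
    ultimately have "x' * y' \<in> polys P" using xy polys_add polys_diff by metis
    then have "coeff (x' * y') (degree x' + degree y') \<in> P"
      by (rule polysD)
    then show False using mult_notin[OF x'(1) y'(1)] by (simp add: coeff_mult_degree_sum)
  qed
qed

end

text \<open>The residue class of \<open>x\<close> is algebraic over the fraction field of the image of \<open>A\<close> in the domain \<open>R/P\<close>.
Fraction fields are avoided throughout by clearing denominators.\<close>

definition algebraic_mod :: "'r::comm_ring_1 set \<Rightarrow> 'r set \<Rightarrow> 'r \<Rightarrow> bool" where
  "algebraic_mod P A x \<longleftrightarrow> (\<exists>f\<in>polys A. f \<notin> polys P \<and> poly f x \<in> P)"

definition minpoly_mod :: "'r::comm_ring_1 set \<Rightarrow> 'r set \<Rightarrow> 'r \<Rightarrow> 'r poly \<Rightarrow> bool" where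
  "minpoly_mod P A x f \<longleftrightarrow> f \<in> polys A \<and> lead_coeff f \<notin> P \<and> poly f x \<in> P \<and>
     (\<forall>h\<in>polys A. poly h x \<in> P \<and> degree h < degree f \<longrightarrow> h \<in> polys P)"

context prime_ideal
begin

lemma minpoly_degree: "minpoly_mod P A x f \<Longrightarrow> degree f > 0"
  unfolding minpoly_mod_def by (cases f) (auto split: if_splits)

lemma ex_minpoly:
  assumes A: "ring_set A" and x: "algebraic_mod P A x"
  shows "\<exists>f. minpoly_mod P A x f"
proof -
  let ?Q = "\<lambda>f. f \<in> polys A \<and> f \<notin> polys P \<and> poly f x \<in> P"
  obtain f where f: "?Q f" "\<And>h. ?Q h \<Longrightarrow> degree f \<le> degree h"
    using x ex_has_least_nat[of ?Q _ degree] unfolding algebraic_mod_def by blast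
  obtain f' where f': "f' \<in> polys A" "lead_coeff f' \<notin> P" "f - f' \<in> polys P"
    "degree f' \<le> degree f" using trim[OF A] f(1) by blast
  have "poly f x - poly f' x \<in> P" using poly_polys[OF f'(3), of x] by simp
  then have "poly f' x \<in> P" using cong f(1) by blast
  then have "minpoly_mod P A x f'"
    using f' f(2) unfolding minpoly_mod_def by (meson leD le_less_trans order_less_le_trans)
  then show ?thesis ..
qed

lemma minpoly_division:
  assumes A: "ring_set A" and f: "minpoly_mod P A x f" and h: "h \<in> polys A" "poly h x \<in> P"
  shows "\<exists>k. \<exists>q\<in>polys A. \<exists>r\<in>polys A.
    smult (lead_coeff f ^ k) h = q * f + r \<and> r \<in> polys P"
proof -
  interpret A: ring_set A by fact
  obtain k q r where qr: "q \<in> polys A" "r \<in> polys A"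
    "smult (lead_coeff f ^ k) h = q * f + r" "degree r < degree f"
    using A.pseudo_division[OF h(1) _ minpoly_degree[OF f]] f unfolding minpoly_mod_def by blast
  have "poly r x = lead_coeff f ^ k * poly h x - poly q x * poly f x"
    using arg_cong[OF qr(3), of "\<lambda>p. poly p x"] by (simp add: algebra_simps)
  then have "poly r x \<in> P" using h(2) f unfolding minpoly_mod_def by auto
  then have "r \<in> polys P" using f qr unfolding minpoly_mod_def by blast
  then show ?thesis using qr by blast
qed

text \<open>If \<open>x\<close> is algebraic over \<open>A\<close> modulo \<open>P\<close>, then \<open>A[x]/P\<close> becomes a field once the nonzero elements of \<open>A\<close>
are inverted. So every element outside \<open>P\<close> divides, modulo \<open>P\<close>, an element of \<open>A\<close> outside \<open>P\<close>.
The proof is Euclid's algorithm on a minimal polynomial \<open>f\<close> of \<open>x\<close>: among the multiples of the given element, one of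
least degree in \<open>x\<close> must have degree \<open>0\<close>, since otherwise it would split off a proper factor of \<open>f\<close>.\<close>

lemma eliminate:
  assumes A: "ring_set A" and x: "algebraic_mod P A x" and G: "G \<in> polys A" "poly G x \<notin> P"
  shows "\<exists>g'\<in>A. g' \<notin> P \<and> (\<exists>V\<in>polys A. g' - poly V x * poly G x \<in> P)"
proof -
  interpret A: ring_set A by fact
  interpret pA: ring_set "polys A" by (rule A.ring_set_polys)
  obtain f where f: "minpoly_mod P A x f" using ex_minpoly[OF A x] ..
  then have fA: "f \<in> polys A" and lf: "lead_coeff f \<notin> P" and fx: "poly f x \<in> P"
    unfolding minpoly_mod_def by auto
  let ?g = "poly G x"
  define W where "W = (\<lambda>H. H \<in> polys A \<and> poly H x \<notin> P \<and> (\<exists>V\<in>polys A. poly H x - poly V x * ?g \<in> P))"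
  define Q where "Q = (\<lambda>H. W H \<and> lead_coeff H \<notin> P)"
  have trimW: "\<exists>H'. Q H' \<and> degree H' \<le> degree H" if H: "W H" for H
  proof -
    have "H \<notin> polys P" using poly_polys H unfolding W_def by blast
    then obtain H' where H': "H' \<in> polys A" "lead_coeff H' \<notin> P" "H - H' \<in> polys P"
      "degree H' \<le> degree H" using trim[OF A] H unfolding W_def by blast
    have d: "poly H x - poly H' x \<in> P" using poly_polys[OF H'(3), of x] by simp
    obtain V where V: "V \<in> polys A" "poly H x - poly V x * ?g \<in> P" using H unfolding Q_def W_def by blast
    have "poly H' x - poly V x * ?g \<in> P"
      using diff[OF V(2) d] by (simp add: algebra_simps)
    then show ?thesis using H' V cong[OF d] H unfolding W_def Q_def by blast
  qed
  \<comment> \<open>Division by \<open>f\<close> gives such a multiple of smaller degree than \<open>f\<close>.\<close>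
  have "\<exists>H. W H \<and> degree H < degree f"
  proof -
    obtain k q r where qr: "q \<in> polys A" "r \<in> polys A"
      "smult (lead_coeff f ^ k) G = q * f + r" "degree r < degree f"
      using A.pseudo_division[OF G(1) fA minpoly_degree[OF f]] by blast
    let ?c = "lead_coeff f ^ k"
    have e: "poly r x - ?c * ?g = - (poly q x * poly f x)"
      using arg_cong[OF qr(3), of "\<lambda>p. poly p x"] by (simp add: algebra_simps)
    have e': "poly r x - ?c * ?g \<in> P" unfolding e using fx by auto
    have "poly r x \<notin> P" using cong[OF e'] mult_notin[OF power_notin[OF lf] G(2)] by blast
    moreover have "[:?c:] \<in> polys A" using polysD[OF fA] by (intro A.const_polys) auto
    ultimately have "W r" using e' qr(2) unfolding W_def by (auto intro!: bexI[of _ "[:?c:]"])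
    then show ?thesis using qr(4) by blast
  qed
  then have "\<exists>H. Q H \<and> degree H < degree f"
    using trimW by (meson le_less_trans)
  then obtain H where H: "Q H" "degree H < degree f"
    and min: "\<And>K. Q K \<and> degree K < degree f \<Longrightarrow> degree H \<le> degree K"
    using ex_has_least_nat[of "\<lambda>H. Q H \<and> degree H < degree f" _ degree]
    by (metis (mono_tags, lifting))
  from H(1) have HA: "H \<in> polys A" and lH: "lead_coeff H \<notin> P" and Hx: "poly H x \<notin> P"
    unfolding Q_def W_def by blast+
  obtain V where V: "V \<in> polys A" "poly H x - poly V x * ?g \<in> P" using H unfolding Q_def W_def by blast
  have "degree H = 0"
  proof (rule ccontr)
    assume "degree H \<noteq> 0"
    then have dH: "degree H > 0" by simp
    let ?c = "lead_coeff H"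
    obtain k q r where qr: "q \<in> polys A" "r \<in> polys A"
      "smult (?c ^ k) f = q * H + r" "degree r < degree H"
      "degree q \<le> degree f - degree H"
      using A.pseudo_division[OF fA HA dH] by blast
    have e: "poly r x = ?c ^ k * poly f x - poly q x * poly H x"
      using arg_cong[OF qr(3), of "\<lambda>p. poly p x"] by (simp add: algebra_simps)
    have "poly r x \<in> P"
    proof (rule ccontr)
      assume r: "poly r x \<notin> P"
      have "poly r x - poly (- (q * V)) x * ?g =
          ?c ^ k * poly f x - poly q x * (poly H x - poly V x * ?g)"
        unfolding e by (simp add: algebra_simps)
      also have "\<dots> \<in> P" using fx V(2) by auto
      finally have "W r" using r qr(1,2) V(1) unfolding W_def by (intro conjI bexI[of _ "- (q * V)"]) auto
      then obtain r' where r': "Q r'" "degree r' \<le> degree r" using trimW by blast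
      have "degree r' < degree f" using r'(2) qr(4) H(2) by linarith
      with min[of r'] r'(1) have "degree H \<le> degree r'" by blast
      then show False using r'(2) qr(4) by linarith
    qed
    then have "?c ^ k * poly f x - poly r x \<in> P" using fx by auto
    then have "poly q x * poly H x \<in> P" unfolding e by simp
    then have qx: "poly q x \<in> P" using prime Hx by blast
    have "degree q < degree f" using qr(5) dH H(2) by linarith
    then have qP: "q \<in> polys P" using f qr(1) qx unfolding minpoly_mod_def by blast
    have "coeff (smult (?c ^ k) f) (degree f)
        = coeff (q * H) (degree f)"
      using qr(4) H(2) unfolding qr(3) by (simp add: coeff_eq_0)
    moreover have "coeff (q * H) (degree f) \<in> P"
      unfolding coeff_mult using qP by (auto intro: polysD)
    ultimately have "?c ^ k * lead_coeff f \<in> P" by simp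
    then show False using mult_notin[OF power_notin[of ?c k] lf] lH by blast
  qed
  then obtain c where c: "H = [:c:]" by (rule degree_eq_zeroE)
  then have "c \<in> A" using polysD[OF HA, of 0] by simp
  moreover have "c \<notin> P" using Hx c by simp
  moreover have "c - poly V x * ?g \<in> P" using V(2) c by simp
  ultimately show ?thesis using V(1) by blast
qed

end

section \<open>Polynomials in a given set of variables\<close>

abbreviation mconst :: "'a::zero \<Rightarrow> 'a mpoly" where
  "mconst \<equiv> single 0"

definition mvar :: "nat \<Rightarrow> 'a::comm_ring_1 mpoly" where
  "mvar i = single (single i 1) 1"

definition mpolys :: "nat set \<Rightarrow> 'a::comm_ring_1 mpoly set" where
  "mpolys J = {p. \<forall>m\<in>keys p. keys m \<subseteq> J}"

lemma carrier_mpoly_ring: "carrier (mpoly_ring N) = mpolys {..<N}"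
  by (simp add: mpoly_ring_def mpolys_def)

lemma mpolys_mono: "p \<in> mpolys J \<Longrightarrow> J \<subseteq> J' \<Longrightarrow> p \<in> mpolys J'"
  by (auto simp: mpolys_def)

lemma mconst_mpolys [simp]: "mconst c \<in> mpolys J"
  by (auto simp: mpolys_def)

lemma mvar_mpolys [simp]: "mvar i \<in> mpolys J \<longleftrightarrow> i \<in> J"
  by (auto simp: mpolys_def mvar_def)

interpretation mpolys: ring_set "mpolys J :: 'a::comm_ring_1 mpoly set" for J
proof
  show "1 \<in> mpolys J" by (auto simp: mpolys_def simp flip: single_one)
  show "p - q \<in> mpolys J" if "p \<in> mpolys J" "q \<in> mpolys J" for p q :: "'a mpoly"
    using that keys_diff[of p q] unfolding mpolys_def by blast
  show "p * q \<in> mpolys J" if "p \<in> mpolys J" "q \<in> mpolys J" for p q :: "'a mpoly"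
  proof -
    have "keys m \<subseteq> J" if m: "m \<in> keys (p * q)" for m
    proof -
      obtain a b where ab: "m = a + b" "a \<in> keys p" "b \<in> keys q"
        using m keys_mult[of p q] by blast
      show ?thesis
        using keys_add[of a b] ab \<open>p \<in> _\<close> \<open>q \<in> _\<close> unfolding mpolys_def by blast
    qed
    then show ?thesis unfolding mpolys_def by blast
  qed
qed

lemma mvar_power: "mvar i ^ k = single (single i k) 1"
proof (induction k)
  case (Suc k)
  have "single i (Suc k) = single i 1 + single i k"
    using single_add[of i 1 k] by simp
  then show ?case unfolding power_Suc Suc.IH by (simp add: mvar_def mult_single)
qed simp

lemma mpoly_sum_monomials: "p = (\<Sum>m\<in>keys p. single m (lookup p m))"
  by (rule poly_mapping_eqI) (simp add: lookup_sum lookup_single when_def in_keys_iff)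

lemma single_eq_prod:
  "single m c = mconst c * (\<Prod>i\<in>keys m. mvar i ^ lookup m i)"
  for c :: "'a::comm_ring_1"
proof -
  have "(\<Prod>i\<in>I. mvar i ^ f i) = single (\<Sum>i\<in>I. single i (f i)) (1::'a)"
    if "finite I" for I f
    using that by (induction I) (simp_all add: mvar_power mult_single)
  moreover have "(\<Sum>i\<in>keys m. single i (lookup m i)) = m"
    by (rule poly_mapping_eqI) (simp add: lookup_sum lookup_single when_def in_keys_iff)
  ultimately show ?thesis by (simp add: mult_single)
qed

lemma mpolys_induct [consumes 1, case_names const var add mult]:
  fixes Q :: "'a::comm_ring_1 mpoly \<Rightarrow> bool"
  assumes p: "p \<in> mpolys J"
    and const: "\<And>c. Q (mconst c)" and var: "\<And>i. i \<in> J \<Longrightarrow> Q (mvar i)"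
    and add: "\<And>p q. p \<in> mpolys J \<Longrightarrow> q \<in> mpolys J \<Longrightarrow> Q p \<Longrightarrow> Q q \<Longrightarrow> Q (p + q)"
    and mult: "\<And>p q. p \<in> mpolys J \<Longrightarrow> q \<in> mpolys J \<Longrightarrow> Q p \<Longrightarrow> Q q \<Longrightarrow> Q (p * q)"
  shows "Q p"
proof -
  have one: "Q 1" using const[of 1] by simp
  have pow: "(mvar i ^ k :: 'a mpoly) \<in> mpolys J \<and> Q (mvar i ^ k)" if "i \<in> J" for i k
    using that by (induction k) (auto intro!: mult var one)
  have prd: "(\<Prod>i\<in>I. mvar i ^ f i :: 'a mpoly) \<in> mpolys J \<and> Q (\<Prod>i\<in>I. mvar i ^ f i)" if "finite I" "I \<subseteq> J" for I f
    using that by (induction I) (use pow in \<open>auto intro!: mult one mpolys.mult\<close>)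
  have mon: "(single m c :: 'a mpoly) \<in> mpolys J \<and> Q (single m c)"
    if "keys m \<subseteq> J" for m c
    unfolding single_eq_prod[of m] using prd[OF _ that] by (auto intro!: mult const)
  have "(\<Sum>m\<in>M. single m (f m) :: 'a mpoly) \<in> mpolys J \<and> Q (\<Sum>m\<in>M. single m (f m))"
    if "finite M" "\<forall>m\<in>M. keys m \<subseteq> J" for M f
    using that
  proof (induction M)
    case empty
    then show ?case using const[of 0] by simp
  next
    case (insert m M)
    then show ?case using mon[of m "f m"] by (auto intro: add)
  qed
  from this[of "keys p" "lookup p"] p show ?thesis
    by (simp add: mpolys_def flip: mpoly_sum_monomials)
qed

lemma mpolys_UNIV: "p \<in> mpolys UNIV"
  by (simp add: mpolys_def)

locale coeff_hom =
  fixes \<phi> :: "'a::comm_ring_1 \<Rightarrow> 'b::comm_ring_1"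
  assumes hom_add: "\<phi> (a + b) = \<phi> a + \<phi> b"
    and hom_mult: "\<phi> (a * b) = \<phi> a * \<phi> b"
    and hom_one: "\<phi> 1 = 1"
begin

lemma hom_zero: "\<phi> 0 = 0"
  using hom_add[of 0 0] by simp

abbreviation eval where "eval \<equiv> mpoly_eval \<phi>"

lemma eval_superset:
  assumes "finite M" "keys p \<subseteq> M"
  shows "eval x p = (\<Sum>m\<in>M. \<phi> (lookup p m) *
    (\<Prod>i\<in>keys m. x i ^ lookup m i))"
  unfolding mpoly_eval_def using assms hom_zero
  by (intro sum.mono_neutral_left) (auto simp: in_keys_iff)

lemma eval_add: "eval x (p + q) = eval x p + eval x q"
proof -
  let ?M = "keys p \<union> keys q"
  have "eval x (p + q) = (\<Sum>m\<in>?M. \<phi> (lookup (p + q) m) *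
    (\<Prod>i\<in>keys m. x i ^ lookup m i))"
    by (rule eval_superset) (use keys_add[of p q] in auto)
  then show ?thesis
    by (simp add: eval_superset[of ?M p] eval_superset[of ?M q] lookup_add hom_add
        algebra_simps sum.distrib)
qed

lemma eval_zero [simp]: "eval x 0 = 0"
  by (simp add: mpoly_eval_def hom_zero)

lemma eval_sum: "eval x (sum f I) = (\<Sum>i\<in>I. eval x (f i))"
  by (induction I rule: infinite_finite_induct) (simp_all add: eval_add)

lemma eval_single: "eval x (single m c) =
    \<phi> c * (\<Prod>i\<in>keys m. x i ^ lookup m i)"
  by (simp add: mpoly_eval_def hom_zero)

lemma eval_const [simp]: "eval x (mconst c) = \<phi> c"
  by (simp add: eval_single)

lemma eval_one [simp]: "eval x 1 = 1"
  using eval_const[of x 1] by (simp add: hom_one)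

lemma eval_mult: "eval x (p * q) = eval x p * eval x q"
proof -
  have mon: "(\<Prod>i\<in>keys (m + m'). x i ^ lookup (m + m') i) =
    (\<Prod>i\<in>keys m. x i ^ lookup m i) *
    (\<Prod>i\<in>keys m'. x i ^ lookup m' i)" for m m' :: "nat \<Rightarrow>\<^sub>0 nat"
  proof -
    let ?I = "keys m \<union> keys m'"
    have *: "(\<Prod>i\<in>keys m'. x i ^ lookup m' i) =
      (\<Prod>i\<in>?I. x i ^ lookup m' i)"
      "(\<Prod>i\<in>keys m. x i ^ lookup m i) =
      (\<Prod>i\<in>?I. x i ^ lookup m i)"
      by (intro prod.mono_neutral_left; auto simp: in_keys_iff)+
    have "(\<Prod>i\<in>keys (m + m'). x i ^ lookup (m + m') i) =
      (\<Prod>i\<in>?I. x i ^ lookup (m + m') i)"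
      by (intro prod.mono_neutral_left) (auto simp: in_keys_iff lookup_add)
    then show ?thesis unfolding * by (simp add: lookup_add power_add prod.distrib)
  qed
  have sng: "eval x (single m c * single m' c') =
    eval x (single m c) * eval x (single m' c')" for m m' c c'
    by (simp add: mult_single eval_single mon hom_mult mult_ac)
  let ?s = "\<lambda>p m. single m (lookup p m)"
  have "eval x ((\<Sum>m\<in>keys p. ?s p m) * (\<Sum>m\<in>keys q. ?s q m)) =
    eval x (\<Sum>m\<in>keys p. ?s p m) * eval x (\<Sum>m\<in>keys q. ?s q m)"
    by (simp add: sum_product eval_sum sng)
  then show ?thesis by (simp flip: mpoly_sum_monomials)
qed

lemma eval_var [simp]: "eval x (mvar i) = x i"
  by (simp add: mvar_def eval_single hom_one)

lemma eval_diff: "eval x (p - q) = eval x p - eval x q"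
  by (metis add_diff_cancel_right' diff_add_cancel eval_add)

lemma eval_power: "eval x (p ^ k) = eval x p ^ k"
  by (induction k) (simp_all add: eval_mult)

lemma eval_poly: "eval x (poly q r) = poly (map_poly (eval x) q) (eval x r)"
  by (induction q) (simp_all add: eval_add eval_mult map_poly_pCons)

lemma eval_cong:
  assumes "p \<in> mpolys J" "\<And>i. i \<in> J \<Longrightarrow> x i = y i"
  shows "eval x p = eval y p"
  using assms(1) by (induction rule: mpolys_induct) (simp_all add: assms(2) eval_add eval_mult)

lemma eval_ring_set:
  assumes "p \<in> mpolys J" "ring_set A" "\<And>c. \<phi> c \<in> A" "\<And>i. i \<in> J \<Longrightarrow> x i \<in> A"
  shows "eval x p \<in> A"
proof -
  interpret A: ring_set A by fact
  show ?thesis using assms(1)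
    by (induction rule: mpolys_induct) (use assms(3,4) in \<open>auto simp: eval_add eval_mult\<close>)
qed

end

interpretation ev: coeff_hom "\<lambda>c::'a::comm_ring_1. c"
  by standard simp_all

abbreviation ev :: "(nat \<Rightarrow> 'a::comm_ring_1) \<Rightarrow> 'a mpoly \<Rightarrow> 'a" where
  "ev \<equiv> mpoly_eval (\<lambda>c. c)"

lemma coeff_hom_mconst: "coeff_hom (mconst :: 'a::comm_ring_1 \<Rightarrow> _)"
  by standard (simp_all add: single_add mult_single)

interpretation msubst: coeff_hom "mconst :: 'a::comm_ring_1 \<Rightarrow> 'a mpoly"
  by (rule coeff_hom_mconst)

lemma mpoly_subst_eq: "mpoly_subst = mpoly_eval mconst"
  by (simp add: fun_eq_iff mpoly_subst_def)

lemma coeff_hom_const_mconst: "coeff_hom (\<lambda>c::'a::comm_ring_1. [:mconst c:])"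
proof (rule coeff_hom.intro)
  fix a b :: 'a
  have "mconst (a + b) = mconst a + mconst b" by (rule single_add)
  moreover have "[:x:] + [:y:] = [:x + y:]" for x y :: "'a mpoly" by (simp only: add_pCons add_0_left)
  ultimately show "[:mconst (a + b):] = [:mconst a:] + [:mconst b:]" by metis
  have "[:x:] * [:y:] = [:x * y:]" for x y :: "'a mpoly" by (simp add: mult.commute)
  moreover have "mconst (a * b) = mconst a * mconst b" by (simp add: mult_single)
  ultimately show "[:mconst (a * b):] = [:mconst a:] * [:mconst b:]" by simp
  show "[:mconst (1 :: 'a):] = 1" by simp
qed

interpretation mexp: coeff_hom "\<lambda>c::'a::comm_ring_1. [:mconst c:]"
  by (rule coeff_hom_const_mconst)

text \<open>The polynomial read as a polynomial in the single variable \<open>l\<close>, with coefficients in the other variables.\<close>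

definition expand :: "nat \<Rightarrow> 'a::comm_ring_1 mpoly \<Rightarrow> 'a mpoly poly" where
  "expand l = mpoly_eval (\<lambda>c. [:mconst c:]) (\<lambda>j. if j = l then [:0, 1:] else [:mvar j:])"

lemma expand_add: "expand l (p + q) = expand l p + expand l q"
  and expand_mult: "expand l (p * q) = expand l p * expand l q"
  and expand_const [simp]: "expand l (mconst c) = [:mconst c:]"
  and expand_var: "expand l (mvar i) = (if i = l then [:0, 1:] else [:mvar i:])"
  by (simp_all add: expand_def mexp.eval_add mexp.eval_mult)

lemma expand_zero [simp]: "expand l 0 = 0" and expand_one [simp]: "expand l 1 = 1"
  by (simp_all add: expand_def)

lemma expand_polys:
  fixes p :: "'a::comm_ring_1 mpoly"
  assumes "p \<in> mpolys (insert l S)" "l \<notin> S"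
  shows "expand l p \<in> polys (mpolys S)"
  unfolding expand_def
proof (rule mexp.eval_ring_set[OF assms(1) mpolys.ring_set_polys])
  show "[:mconst c:] \<in> polys (mpolys S)" for c :: 'a by (rule mpolys.const_polys) simp
  have "[:0, 1:] \<in> polys (mpolys S :: 'a mpoly set)"
    by (rule polysI) (simp add: coeff_pCons split: nat.split)
  then show "(if i = l then [:0, 1:] else [:mvar i:] :: 'a mpoly poly) \<in> polys (mpolys S)" if "i \<in> insert l S" for i
    using that mpolys.const_polys[of "mvar i" S] by auto
qed

lemma poly_expand [simp]: "poly (expand l p) (mvar l) = p"
  using mpolys_UNIV[of p]
  by (induction rule: mpolys_induct) (simp_all add: expand_add expand_mult expand_var)

lemma expand_free:
  assumes "p \<in> mpolys S" "l \<notin> S" shows "expand l p = [:p:]"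
  using assms(1)
  by (induction rule: mpolys_induct) (use assms(2) in \<open>auto simp: expand_add expand_mult expand_var\<close>)

lemma poly_mpolys:
  assumes "q \<in> polys (mpolys S)" shows "poly q (mvar l) \<in> mpolys (insert l S)"
  by (rule mpolys.poly) (use assms in \<open>auto simp: polys_def intro: mpolys_mono\<close>)

definition partial :: "nat \<Rightarrow> 'a::idom mpoly \<Rightarrow> 'a mpoly" where
  "partial l p = poly (pderiv (expand l p)) (mvar l)"

lemma partial_add: "partial l (p + q) = partial l p + partial l q"
  and partial_mult: "partial l (p * q) = p * partial l q + q * partial l p"
  and partial_const [simp]: "partial l (mconst c) = 0"
  and partial_var: "partial l (mvar i) = (if i = l then 1 else 0)"
  by (simp_all add: partial_def expand_add expand_mult expand_var pderiv_add pderiv_mult pderiv_pCons)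

lemma partial_zero [simp]: "partial l 0 = 0"
  by (simp add: partial_def)

lemma partial_free: "p \<in> mpolys S \<Longrightarrow> l \<notin> S \<Longrightarrow> partial l p = 0"
  by (simp add: partial_def expand_free pderiv_pCons)

lemma partial_mpolys: "p \<in> mpolys S \<Longrightarrow> partial l p \<in> mpolys S"
  by (induction rule: mpolys_induct) (auto simp: partial_add partial_mult partial_var)

section \<open>Algebraic independence modulo a prime\<close>

text \<open>For a prime \<open>P\<close> this says that the coordinates in \<open>J\<close> are algebraically independent in the function field of
the variety of \<open>P\<close>.\<close>

definition indep_mod :: "'a::comm_ring_1 mpoly set \<Rightarrow> nat set \<Rightarrow> bool" where
  "indep_mod P J \<longleftrightarrow> (\<forall>p\<in>mpolys J. p \<in> P \<longrightarrow> p = 0)"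

lemma indep_mod_mono: "indep_mod P J \<Longrightarrow> J' \<subseteq> J \<Longrightarrow> indep_mod P J'"
  unfolding indep_mod_def using mpolys_mono by blast

lemma polys_mono: "A \<subseteq> B \<Longrightarrow> polys A \<subseteq> polys B"
  by (auto simp: polys_def)

lemma algebraic_mod_mono: "algebraic_mod P A x \<Longrightarrow> A \<subseteq> B \<Longrightarrow> algebraic_mod P B x"
  unfolding algebraic_mod_def using polys_mono by blast

lemma mpolys_subset: "J \<subseteq> J' \<Longrightarrow> mpolys J \<subseteq> mpolys J'"
  using mpolys_mono by blast

lemma const_notin: 
  fixes c :: "'b::field"
  assumes "prime_ideal (Q :: 'b mpoly set)" "c \<noteq> 0" shows "mconst c \<notin> Q"
proof
  interpret Q: prime_ideal Q by fact
  assume "mconst c \<in> Q"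
  then have "mconst (inverse c) * mconst c \<in> Q" by blast
  then show False using assms(2) by (simp add: mult_single)
qed

lemma mpolys_empty: "p \<in> mpolys {} \<Longrightarrow> \<exists>c. p = mconst c" for p :: "'b::comm_ring_1 mpoly"
  by (induction rule: mpolys_induct) (auto simp: mult_single single_add[symmetric])

lemma indep_mod_empty:
  fixes P :: "'b::field mpoly set"
  assumes "prime_ideal P" shows "indep_mod P {}"
  unfolding indep_mod_def
proof (intro ballI impI)
  fix p assume "p \<in> mpolys {}" "p \<in> P"
  moreover then obtain c where "p = mconst c" using mpolys_empty by blast
  ultimately show "p = 0" using const_notin[OF assms, of c] by (cases "c = 0") auto
qed

locale mprime = prime_ideal P for P :: "'a::idom mpoly set"
begin

lemma expand_polys_imp: "expand l p \<in> polys P \<Longrightarrow> p \<in> P"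
  using poly_polys[of "expand l p" "mvar l"] by simp

lemma pderiv_polys_P: "q \<in> polys P \<Longrightarrow> pderiv q \<in> polys P"
  by (rule polysI) (auto simp: coeff_pderiv simp del: of_nat_Suc intro: polysD)

lemma partial_polys: "expand l p \<in> polys P \<Longrightarrow> partial l p \<in> P"
  unfolding partial_def by (intro poly_polys pderiv_polys_P)

lemma algebraic_of_dependent:
  assumes "indep_mod P J" "l \<notin> J" "\<not> indep_mod P (insert l J)"
  shows "algebraic_mod P (mpolys J) (mvar l)"
proof -
  obtain h where h: "h \<in> mpolys (insert l J)" "h \<in> P" "h \<noteq> 0"
    using assms(3) unfolding indep_mod_def by blast
  have H: "expand l h \<in> polys (mpolys J)" using h(1) assms(2) by (rule expand_polys)
  have "expand l h \<notin> polys P"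
  proof
    assume P: "expand l h \<in> polys P"
    have "coeff (expand l h) i = 0" for i
      using assms(1) polysD[OF H, of i] polysD[OF P, of i] unfolding indep_mod_def by blast
    then have "expand l h = 0" by (simp add: poly_eq_iff)
    then show False using poly_expand[of l h] h(3) by simp
  qed
  then show ?thesis using H h(2) unfolding algebraic_mod_def by (intro bexI[of _ "expand l h"]) auto
qed

text \<open>The step from one algebraic variable to several. It replaces the statement that algebraic dependence is
transitive.\<close>

lemma eliminate_many:
  assumes "finite T" "\<And>m. m \<in> T \<Longrightarrow> m \<in> J \<or> algebraic_mod P (mpolys J) (mvar m)"
    "g \<in> mpolys (J \<union> T)" "g \<notin> P"
  shows "\<exists>g'\<in>mpolys J. g' \<notin> P \<and> (\<exists>v. g' - v * g \<in> P)"
  using assms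
proof (induction T arbitrary: g)
  case empty
  then show ?case by (intro bexI[of _ g]) (auto intro!: exI[of _ 1])
next
  case (insert m T)
  show ?case
  proof (cases "m \<in> J \<union> T")
    case True
    then have "J \<union> insert m T = J \<union> T" by auto
    then show ?thesis using insert by auto
  next
    case False
    let ?A = "mpolys (J \<union> T)"
    have "algebraic_mod P (mpolys J) (mvar m)" using insert.prems(1)[of m] False by auto
    then have alg: "algebraic_mod P ?A (mvar m)"
      by (rule algebraic_mod_mono) (rule mpolys_subset, auto)
    have "g \<in> mpolys (insert m (J \<union> T))" using insert.prems(2) by simp
    then have "expand m g \<in> polys ?A" using False by (rule expand_polys)
    moreover have "poly (expand m g) (mvar m) \<notin> P" using insert.prems(3) by simp
    ultimately obtain h V where h: "h \<in> ?A" "h \<notin> P" "h - poly V (mvar m) * g \<in> P"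
      using eliminate[OF mpolys.ring_set_axioms alg, of "expand m g"] by auto
    obtain g' v where g': "g' \<in> mpolys J" "g' \<notin> P" "g' - v * h \<in> P"
      using insert.IH[OF _ h(1,2)] insert.prems(1) by blast
    have "g' - (v * poly V (mvar m)) * g = (g' - v * h) + v * (h - poly V (mvar m) * g)"
      by (simp add: algebra_simps)
    also have "\<dots> \<in> P" using g'(3) h(3) by blast
    finally show ?thesis using g'(1,2) by blast
  qed
qed

lemma const_polys_iff: "[:c:] \<in> polys P \<longleftrightarrow> c \<in> P"
proof
  show "[:c:] \<in> polys P \<Longrightarrow> c \<in> P" using polysD[of "[:c:]" P 0] by simp
  show "c \<in> P \<Longrightarrow> [:c:] \<in> polys P"
    by (rule polysI) (simp add: coeff_pCons split: nat.split)
qed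

text \<open>These are the polynomials whose coefficients with respect to the variable \<open>l\<close> all lie in \<open>P\<close>. Modulo this
prime the variable \<open>l\<close> is transcendental over the others, while the relations between the others are those of \<open>P\<close>.\<close>

lemma prime_ideal_free: "prime_ideal {h. expand l h \<in> polys P}"
proof -
  interpret X: prime_ideal "polys P" by (rule prime_ideal_polys)
  show ?thesis
    by standard (auto simp: expand_add expand_mult dest: X.prime)
qed

text \<open>An instance of Steinitz exchange: if \<open>l\<close> is algebraic over the variables in \<open>T\<close>, and these are algebraic over those in
\<open>J\<close>, then \<open>l\<close> is algebraic over \<open>J\<close>. The relation \<open>f\<close> lies outside the prime in which \<open>l\<close> is free, hence
elimination modulo that prime turns it into a nonzero relation between \<open>l\<close> and \<open>J\<close> alone.\<close>

lemma exchange_separable: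
  assumes ind: "indep_mod P (insert l J)" "l \<notin> J" and T: "finite T" "l \<notin> T" "J \<subseteq> T"
    and dep: "\<And>m. m \<in> T - J \<Longrightarrow> \<not> indep_mod P (insert m J)"
    and f: "f \<in> mpolys (insert l T)" "f \<in> P" "partial l f \<notin> P"
  shows False
proof -
  let ?P = "{h. expand l h \<in> polys P}"
  interpret X: mprime ?P by (simp add: mprime_def prime_ideal_free)
  have indJ: "indep_mod P J" using ind(1) by (rule indep_mod_mono) auto
  have free: "h \<in> ?P \<longleftrightarrow> h \<in> P" if "h \<in> mpolys T" for h
    using expand_free[OF that T(2)] const_polys_iff[of h] by simp
  have alg: "m \<in> insert l J \<or> algebraic_mod ?P (mpolys (insert l J)) (mvar m)" if m: "m \<in> T" for m
  proof (cases "m \<in> J")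
    case False
    then have "algebraic_mod P (mpolys J) (mvar m)"
      using algebraic_of_dependent[OF indJ] dep m by blast
    then obtain q where q: "q \<in> polys (mpolys J)" "q \<notin> polys P" "poly q (mvar m) \<in> P"
      unfolding algebraic_mod_def by blast
    have "poly q (mvar m) \<in> mpolys T"
      using poly_mpolys[OF q(1)] T(3) m by (auto intro: mpolys_mono)
    then have "poly q (mvar m) \<in> ?P" using free q(3) by blast
    moreover obtain i where i: "coeff q i \<notin> P" using q(2) unfolding polys_def by blast
    have "coeff q i \<in> mpolys T" using polysD[OF q(1)] T(3) by (auto intro: mpolys_mono)
    then have "q \<notin> polys ?P" using free i polysD by blast
    moreover have "q \<in> polys (mpolys (insert l J))"
      using q(1) by (auto simp: polys_def intro: mpolys_mono)
    ultimately show ?thesis unfolding algebraic_mod_def by blast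
  qed auto
  have "f \<notin> ?P" using partial_polys f(3) by blast
  moreover have "f \<in> mpolys (insert l J \<union> T)" using f(1) by (rule mpolys_mono) auto
  ultimately obtain g' v where g': "g' \<in> mpolys (insert l J)" "g' \<notin> ?P" "g' - v * f \<in> ?P"
    using X.eliminate_many[OF T(1) alg] by blast
  have "g' - v * f \<in> P" using g'(3) expand_polys_imp by blast
  then have "g' \<in> P" using cong[of g' "v * f"] f(2) by blast
  then have "g' = 0" using ind(1) g'(1) unfolding indep_mod_def by blast
  then show False using g'(2) X.zero by blast
qed

end

section \<open>Lifting points to more coordinates\<close>

text \<open>The coordinates of \<open>a\<close> with index in \<open>S\<close> form a point of the closure of the projection of the variety of \<open>P\<close>
to these coordinates.\<close>

definition vanishes :: "'a::comm_ring_1 mpoly set \<Rightarrow> nat set \<Rightarrow> (nat \<Rightarrow> 'a) \<Rightarrow> bool" where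
  "vanishes P S a \<longleftrightarrow> (\<forall>h\<in>mpolys S. h \<in> P \<longrightarrow> ev a h = 0)"

lemma ev_upd:
  assumes "p \<in> polys (mpolys S)" "l \<notin> S"
  shows "ev (a(l := b)) (poly p (mvar l)) = poly (map_poly (ev a) p) b"
proof -
  have "map_poly (ev (a(l := b))) p = map_poly (ev a) p"
  proof (rule poly_eqI)
    fix i
    have "ev (a(l := b)) (coeff p i) = ev a (coeff p i)"
      by (rule ev.eval_cong[OF polysD[OF assms(1)]]) (use assms(2) in auto)
    then show "coeff (map_poly (ev (a(l := b))) p) i = coeff (map_poly (ev a) p) i"
      by (simp add: coeff_map_poly)
  qed
  then show ?thesis by (simp add: ev.eval_poly)
qed

text \<open>A root of \<open>1 + x q(x)\<close> is not a root of \<open>q\<close>. This replaces the infinitude of an algebraically closed field.\<close>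

lemma alg_closed_nonroot:
  fixes q :: "'a::alg_closed_field poly"
  assumes "q \<noteq> 0" shows "\<exists>b. poly q b \<noteq> 0"
proof -
  have "degree (pCons 1 q) > 0" using assms by simp
  then obtain b where "poly (pCons 1 q) b = 0" using alg_closed_imp_poly_has_root by blast
  then have "poly q b \<noteq> 0" by auto
  then show ?thesis ..
qed

locale ac_prime = mprime P for P :: "'a::alg_closed_field mpoly set"
begin

lemma vanishes_polys:
  assumes "vanishes P S a" "r \<in> polys (mpolys S)" "r \<in> polys P"
  shows "map_poly (ev a) r = 0"
  by (rule poly_eqI)
    (use assms polysD[OF assms(2)] polysD[OF assms(3)] in \<open>auto simp: coeff_map_poly vanishes_def\<close>)

text \<open>If the variable \<open>l\<close> is transcendental, every point lifts with a free choice of the new coordinate, and only the nonroots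
of one polynomial are excluded. If it is algebraic, the new coordinate is a root of the minimal polynomial, which exists
where the leading coefficient does not vanish, and elimination keeps \<open>g\<close> nonzero there.\<close>

lemma lift_point_step:
  assumes l: "l \<notin> S" and g: "g \<in> mpolys (insert l S)" "g \<notin> P"
  shows "\<exists>g'\<in>mpolys S. g' \<notin> P \<and> (\<forall>a. vanishes P S a \<and> ev a g' \<noteq> 0 \<longrightarrow>
    (\<exists>b. vanishes P (insert l S) (a(l := b)) \<and> ev (a(l := b)) g \<noteq> 0))"
proof (cases "algebraic_mod P (mpolys S) (mvar l)")
  case False
  define G where "G = expand l g"
  have G: "G \<in> polys (mpolys S)" "poly G (mvar l) = g"
    unfolding G_def using expand_polys[OF g(1) l] by auto
  obtain k where k: "coeff G k \<notin> P"
    using poly_polys[of G "mvar l"] G(2) g(2) unfolding polys_def by blast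
  have "\<exists>b. vanishes P (insert l S) (a(l := b)) \<and> ev (a(l := b)) g \<noteq> 0"
    if a: "vanishes P S a" "ev a (coeff G k) \<noteq> 0" for a
  proof -
    have "coeff (map_poly (ev a) G) k \<noteq> 0" using a(2) by (simp add: coeff_map_poly)
    then have "map_poly (ev a) G \<noteq> 0" by auto
    then obtain b where "poly (map_poly (ev a) G) b \<noteq> 0" using alg_closed_nonroot by blast
    then have b: "ev (a(l := b)) g \<noteq> 0" using ev_upd[OF G(1) l, of a b] G(2) by simp
    have "ev (a(l := b)) h = 0" if h: "h \<in> mpolys (insert l S)" "h \<in> P" for h
    proof -
      have H: "expand l h \<in> polys (mpolys S)" using h(1) l by (rule expand_polys)
      then have "expand l h \<in> polys P" using False h(2) unfolding algebraic_mod_def by auto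
      then show ?thesis using ev_upd[OF H l, of a b] vanishes_polys[OF a(1) H] by simp
    qed
    then show ?thesis using b unfolding vanishes_def by blast
  qed
  then show ?thesis using k polysD[OF G(1)] by blast
next
  case True
  obtain f where f: "minpoly_mod P (mpolys S) (mvar l) f"
    using ex_minpoly[OF mpolys.ring_set_axioms True] ..
  let ?c = "lead_coeff f"
  have fS: "f \<in> polys (mpolys S)" and c: "?c \<notin> P" "?c \<in> mpolys S"
    using f unfolding minpoly_mod_def by (auto intro: polysD)
  obtain g0 V where g0: "g0 \<in> mpolys S" "g0 \<notin> P" "V \<in> polys (mpolys S)"
    "g0 - poly V (mvar l) * g \<in> P"
    using eliminate[OF mpolys.ring_set_axioms True expand_polys[OF g(1) l]] g(2) by auto
  have "\<exists>b. vanishes P (insert l S) (a(l := b)) \<and> ev (a(l := b)) g \<noteq> 0"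
    if a: "vanishes P S a" "ev a (g0 * ?c) \<noteq> 0" for a
  proof -
    have a': "ev a g0 \<noteq> 0" "ev a ?c \<noteq> 0" using a(2) by (auto simp: ev.eval_mult)
    have "coeff (map_poly (ev a) f) (degree f) \<noteq> 0" using a'(2) by (simp add: coeff_map_poly)
    then have "degree (map_poly (ev a) f) > 0" using le_degree minpoly_degree[OF f] less_le_trans by blast
    then obtain b where b: "poly (map_poly (ev a) f) b = 0" using alg_closed_imp_poly_has_root by blast
    let ?a = "a(l := b)"
    have same: "ev ?a h = ev a h" if "h \<in> mpolys S" for h
      by (rule ev.eval_cong[OF that]) (use l in auto)
    have van: "ev ?a h = 0" if h: "h \<in> mpolys (insert l S)" "h \<in> P" for h
    proof -
      have H: "expand l h \<in> polys (mpolys S)" "poly (expand l h) (mvar l) \<in> P"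
        using expand_polys[OF h(1) l] h(2) by auto
      obtain k q r where qr: "q \<in> polys (mpolys S)" "r \<in> polys (mpolys S)"
        "smult (?c ^ k) (expand l h) = q * f + r" "r \<in> polys P"
        using minpoly_division[OF mpolys.ring_set_axioms f H] by blast
      have "?c ^ k * h = poly q (mvar l) * poly f (mvar l) + poly r (mvar l)"
        using arg_cong[OF qr(3), of "\<lambda>p. poly p (mvar l)"] by simp
      then have "ev ?a (?c ^ k * h) = ev ?a (poly q (mvar l)) * poly (map_poly (ev a) f) b
          + poly (map_poly (ev a) r) b"
        by (simp add: ev.eval_add ev.eval_mult ev_upd[OF _ l] fS qr(2))
      also have "\<dots> = 0" using b vanishes_polys[OF a(1) qr(2,4)] by simp
      finally show ?thesis using a'(2) same[OF c(2)] by (simp add: ev.eval_mult ev.eval_power)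
    qed
    have "g0 - poly V (mvar l) * g \<in> mpolys (insert l S)"
      using g0(1) poly_mpolys[OF g0(3)] g(1) by (auto intro: mpolys_mono)
    then have "ev ?a (g0 - poly V (mvar l) * g) = 0" using van g0(4) by blast
    then have "ev ?a g \<noteq> 0" using a'(1) same[OF g0(1)] by (auto simp: ev.eval_diff ev.eval_mult)
    then show ?thesis using van unfolding vanishes_def by blast
  qed
  then show ?thesis using mult_notin[OF g0(2) c(1)] g0(1) c(2) by blast
qed

text \<open>The projection of the variety to fewer coordinates contains a nonempty open subset of its closure (a case of
Chevalley's theorem). Projecting to no coordinates at all gives the Nullstellensatz below.\<close>

lemma lift_point:
  assumes "finite R" "g \<in> mpolys (S \<union> R)" "g \<notin> P"
  shows "\<exists>g'\<in>mpolys S. g' \<notin> P \<and> (\<forall>a. vanishes P S a \<and> ev a g' \<noteq> 0 \<longrightarrow>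
    (\<exists>b. (\<forall>i\<in>S. b i = a i) \<and> vanishes P (S \<union> R) b \<and> ev b g \<noteq> 0))"
  using assms
proof (induction R arbitrary: g)
  case empty
  then show ?case by auto
next
  case (insert l R)
  show ?case
  proof (cases "l \<in> S \<union> R")
    case True
    then have "S \<union> insert l R = S \<union> R" by auto
    then show ?thesis using insert by auto
  next
    case False
    have "g \<in> mpolys (insert l (S \<union> R))" using insert.prems(1) by simp
    then obtain g1 where g1: "g1 \<in> mpolys (S \<union> R)" "g1 \<notin> P"
      "\<And>a. vanishes P (S \<union> R) a \<Longrightarrow> ev a g1 \<noteq> 0 \<Longrightarrow>
        (\<exists>b. vanishes P (insert l (S \<union> R)) (a(l := b)) \<and> ev (a(l := b)) g \<noteq> 0)"
      using lift_point_step[OF False _ insert.prems(2)] by blast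
    obtain g' where g': "g' \<in> mpolys S" "g' \<notin> P" "\<And>a. vanishes P S a \<Longrightarrow> ev a g' \<noteq> 0 \<Longrightarrow>
        (\<exists>b. (\<forall>i\<in>S. b i = a i) \<and> vanishes P (S \<union> R) b \<and> ev b g1 \<noteq> 0)"
      using insert.IH[OF g1(1,2)] by blast
    have "\<exists>b. (\<forall>i\<in>S. b i = a i) \<and> vanishes P (S \<union> insert l R) b \<and> ev b g \<noteq> 0"
      if a: "vanishes P S a" "ev a g' \<noteq> 0" for a
    proof -
      obtain b where b: "\<forall>i\<in>S. b i = a i" "vanishes P (S \<union> R) b" "ev b g1 \<noteq> 0"
        using g'(3)[OF a] by blast
      obtain b' where b': "vanishes P (insert l (S \<union> R)) (b(l := b'))" "ev (b(l := b')) g \<noteq> 0"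
        using g1(3)[OF b(2,3)] by blast
      have "\<forall>i\<in>S. (b(l := b')) i = a i" using b(1) False by auto
      moreover have "S \<union> insert l R = insert l (S \<union> R)" by simp
      ultimately show ?thesis using b' by metis
    qed
    then show ?thesis using g'(1,2) by blast
  qed
qed

lemma nullstellensatz:
  assumes "finite R" "g \<in> mpolys R" "g \<notin> P"
  shows "\<exists>a. vanishes P R a \<and> ev a g \<noteq> 0"
proof -
  obtain g' where g': "g' \<in> mpolys {}" "g' \<notin> P" "\<And>a. vanishes P {} a \<Longrightarrow> ev a g' \<noteq> 0 \<Longrightarrow>
        (\<exists>b. vanishes P R b \<and> ev b g \<noteq> 0)"
    using lift_point[of R g "{}"] assms by auto
  obtain c where c: "g' = mconst c" using mpolys_empty[OF g'(1)] ..
  then have "ev (\<lambda>_. 0) g' \<noteq> 0" using g'(2) by auto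
  moreover have "vanishes P {} (\<lambda>_. 0)"
    unfolding vanishes_def using mpolys_empty const_notin[OF prime_ideal_axioms] by fastforce
  ultimately show ?thesis using g'(3) by blast
qed

end

section \<open>Separable algebraic relations\<close>

definition mdeg :: "(nat \<Rightarrow>\<^sub>0 nat) \<Rightarrow> nat" where
  "mdeg m = (\<Sum>i\<in>keys m. lookup m i)"

definition tdeg_le :: "nat \<Rightarrow> 'a::zero mpoly \<Rightarrow> bool" where
  "tdeg_le t p \<longleftrightarrow> (\<forall>m\<in>keys p. mdeg m \<le> t)"

lemma mdeg_superset: "finite I \<Longrightarrow> keys m \<subseteq> I \<Longrightarrow> mdeg m = (\<Sum>i\<in>I. lookup m i)"
  unfolding mdeg_def by (rule sum.mono_neutral_left) (auto simp: in_keys_iff)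

lemma partial_mvar_power: "partial l (mvar l ^ j) = of_nat j * mvar l ^ (j - 1)" for l
proof (induction j)
  case 0
  then show ?case using partial_const[of l 1] by simp
next
  case (Suc j)
  then show ?case by (cases j) (simp_all add: partial_mult partial_var algebra_simps)
qed

definition msub :: "(nat \<Rightarrow>\<^sub>0 nat) \<Rightarrow> nat \<Rightarrow> (nat \<Rightarrow>\<^sub>0 nat)" where
  "msub m l = m - single l 1"

lemma lookup_msub: "lookup (msub m l) i = lookup m i - (if i = l then 1 else 0)"
  by (simp add: msub_def lookup_minus lookup_single when_def)

lemma partial_single: "partial l (single m c) =
    single (msub m l) (of_nat (lookup m l) * c)" for c :: "'a::idom"
proof -
  let ?j = "lookup m l"
  define m0 where "m0 = m - single l ?j"
  have m: "m = m0 + single l ?j"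
    by (rule poly_mapping_eqI) (simp add: m0_def lookup_add lookup_minus lookup_single when_def)
  have s: "single m c = single m0 c * mvar l ^ ?j"
    unfolding mvar_power mult_single by (simp flip: m)
  have "lookup m0 l = 0" by (simp add: m0_def lookup_minus)
  then have "single m0 c \<in> mpolys (- {l})"
    by (auto simp: mpolys_def in_keys_iff)
  then have z: "partial l (single m0 c) = 0" by (rule partial_free) simp
  show ?thesis
  proof (cases "?j = 0")
    case True
    then show ?thesis using s z by simp
  next
    case False
    have e: "m0 + single l (?j - 1) = msub m l"
      by (rule poly_mapping_eqI)
        (use False in \<open>simp add: m0_def lookup_add lookup_minus lookup_single when_def lookup_msub\<close>)
    have "partial l (single m c) =
        single m0 c * (mconst (of_nat ?j) * mvar l ^ (?j - 1))"
      unfolding s partial_mult z partial_mvar_power by simp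
    also have "\<dots> = single (m0 + (0 + single l (?j - 1))) (c * (of_nat ?j * 1))"
      unfolding mvar_power mult_single ..
    finally show ?thesis using e by (simp add: mult.commute)
  qed
qed

lemma partial_sum: "partial l (sum f I) = (\<Sum>i\<in>I. partial l (f i))"
  by (induction I rule: infinite_finite_induct) (simp_all add: partial_add)

lemma partial_monomials: "partial l p = (\<Sum>m\<in>keys p. single (msub m l)
    (of_nat (lookup m l) * lookup p m))"
  by (subst (1) mpoly_sum_monomials[of p]) (simp add: partial_sum partial_single)

lemma lookup_partial:
  assumes "lookup m l > 0"
  shows "lookup (partial l p) (msub m l) = of_nat (lookup m l) * lookup p m"
proof -
  have "(of_nat (lookup m' l) * lookup p m' when msub m' l = msub m l) =
      (of_nat (lookup m l) * lookup p m when m' = m)" for m'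
  proof (cases "lookup m' l = 0 \<or> msub m' l \<noteq> msub m l")
    case True
    then show ?thesis using assms by (auto simp: when_def)
  next
    case False
    have "lookup m' i = lookup m i" for i
      using False assms lookup_msub[of m l i] lookup_msub[of m' l i] by (auto split: if_splits)
    then have "m' = m" by (rule poly_mapping_eqI)
    then show ?thesis by simp
  qed
  then have "lookup (partial l p) (msub m l) =
      (\<Sum>m'\<in>keys p. (of_nat (lookup m l) * lookup p m when m' = m))"
    unfolding partial_monomials[of l p] lookup_sum lookup_single by simp
  also have "\<dots> = of_nat (lookup m l) * lookup p m"
    by (simp add: when_def in_keys_iff)
  finally show ?thesis .
qed

lemma tdeg_le_partial:
  assumes "tdeg_le t p" shows "tdeg_le (t - 1) (partial l p)"
  unfolding tdeg_le_def
proof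
  fix m' assume m': "m' \<in> keys (partial l p)"
  obtain m where m: "m \<in> keys p" "m' = msub m l" "lookup m l \<noteq> 0"
  proof (rule ccontr)
    assume neg: "\<not> thesis"
    have "lookup (partial l p) m' = 0"
      unfolding partial_monomials[of l p] lookup_sum lookup_single
    proof (rule sum.neutral, rule ballI)
      fix m assume "m \<in> keys p"
      then have "msub m l \<noteq> m' \<or> lookup m l = 0" using neg that by metis
      then show "(of_nat (lookup m l) * lookup p m when msub m l = m') = 0"
        by (auto simp: when_def)
    qed
    then show False using m' by (simp add: in_keys_iff)
  qed
  let ?K = "keys m"
  have lK: "l \<in> ?K" using m(3) by (simp add: in_keys_iff)
  have "mdeg m' = (\<Sum>i\<in>?K. lookup m' i)"
    by (rule mdeg_superset) (auto simp: m(2) in_keys_iff lookup_msub)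
  also have "\<dots> = lookup m' l + (\<Sum>i\<in>?K - {l}. lookup m' i)"
    using lK by (simp add: sum.remove)
  also have "(\<Sum>i\<in>?K - {l}. lookup m' i) = (\<Sum>i\<in>?K - {l}. lookup m i)"
    by (rule sum.cong) (auto simp: m(2) lookup_msub)
  finally have "mdeg m' < mdeg m"
    using lK m(3) by (simp add: mdeg_def sum.remove[of ?K l] m(2) lookup_msub)
  moreover have "mdeg m \<le> t" using assms m(1) by (simp add: tdeg_le_def)
  ultimately show "mdeg m' \<le> t - 1" by simp
qed

lemma CHAR_mpoly: "CHAR('a::comm_ring_1 mpoly) = CHAR('a)"
proof (rule CHAR_eqI)
  have e: "of_nat n = (0 :: 'a mpoly) \<longleftrightarrow> of_nat n = (0 :: 'a)" for n
  proof -
    have "mconst (of_nat n :: 'a) = 0 \<longleftrightarrow> of_nat n = (0 :: 'a)"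
      by (metis lookup_single_eq Poly_Mapping.lookup_zero single_zero)
    then show ?thesis by simp
  qed
  show "of_nat CHAR('a) = (0 :: 'a mpoly)" by (simp add: e)
  show "CHAR('a) dvd n" if "of_nat n = (0 :: 'a mpoly)" for n
    using that by (simp add: e of_nat_eq_0_iff_char_dvd)
qed

lemma single_power: "single m c ^ k =
    single (Poly_Mapping.map ((*) k) m) (c ^ k)" for c :: "'a::comm_ring_1" and m :: "nat \<Rightarrow>\<^sub>0 nat"
proof (induction k)
  case 0
  have "Poly_Mapping.map ((*) 0) m = 0" by (rule poly_mapping_eqI) (simp add: map.rep_eq when_def)
  then show ?case by (metis power_0 single_one)
next
  case (Suc k)
  have "m + Poly_Mapping.map ((*) k) m = Poly_Mapping.map ((*) (Suc k)) m"
    by (rule poly_mapping_eqI) (simp add: map.rep_eq when_def lookup_add)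
  then show ?case unfolding power_Suc Suc.IH mult_single by (rule arg_cong)
qed

text \<open>Over a perfect field of characteristic \<open>p\<close> a polynomial in the \<open>p\<close>-th powers of the variables is a \<open>p\<close>-th power.\<close>

lemma ex_pth_root:
  fixes f :: "'a::alg_closed_field mpoly"
  assumes q: "prime CHAR('a)" and f: "f \<in> mpolys J" "tdeg_le t f" "t > 0"
    and div: "\<And>m i. m \<in> keys f \<Longrightarrow> CHAR('a) dvd lookup m i"
  shows "\<exists>h\<in>mpolys J. h ^ CHAR('a) = f \<and> tdeg_le (t - 1) h"
proof -
  let ?q = "CHAR('a)"
  have q2: "?q \<ge> 2" using q by (rule prime_ge_2_nat)
  define dv where "dv m = Poly_Mapping.map (\<lambda>n. n div ?q) m" for m :: "nat \<Rightarrow>\<^sub>0 nat"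
  have dv: "lookup (dv m) i = lookup m i div ?q" for m i
    by (simp add: dv_def map.rep_eq when_def)
  have "\<exists>r. r ^ ?q = c" for c :: 'a using q2 by (intro nth_root_exists) simp
  then obtain rt where rt: "\<And>c :: 'a. rt c ^ ?q = c" by metis
  define h where "h = (\<Sum>m\<in>keys f. single (dv m) (rt (lookup f m)))"
  have "h ^ ?q = (\<Sum>m\<in>keys f. single (dv m) (rt (lookup f m)) ^ ?q)"
    unfolding h_def by (rule freshmans_dream_sum) (use q in \<open>simp_all add: CHAR_mpoly\<close>)
  also have "\<dots> = (\<Sum>m\<in>keys f. single m (lookup f m))"
  proof (rule sum.cong)
    fix m assume m: "m \<in> keys f"
    have "Poly_Mapping.map ((*) ?q) (dv m) = m"
      by (rule poly_mapping_eqI) (use div[OF m] in \<open>simp add: map.rep_eq when_def dv dvd_div_eq_0_iff\<close>)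
    then show "single (dv m) (rt (lookup f m)) ^ ?q =
        single m (lookup f m)" by (simp add: single_power rt)
  qed simp
  finally have hq: "h ^ ?q = f" by (simp flip: mpoly_sum_monomials)
  have keys: "\<exists>m\<in>keys f. m' = dv m" if "m' \<in> keys h" for m'
    using that keys_sum[of "\<lambda>m. single (dv m) (rt (lookup f m))" "keys f"]
    unfolding h_def by (fastforce split: if_splits)
  have kdv: "keys (dv m) \<subseteq> keys m" for m
    by (auto simp: in_keys_iff dv intro: ccontr)
  have "h \<in> mpolys J" using keys kdv f(1) unfolding mpolys_def by blast
  moreover have "tdeg_le (t - 1) h"
    unfolding tdeg_le_def
  proof
    fix m' assume "m' \<in> keys h"
    then obtain m where m: "m \<in> keys f" "m' = dv m" using keys by blast
    have "mdeg m' = (\<Sum>i\<in>keys m. lookup m i div ?q)"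
      using mdeg_superset[OF _ kdv, of m] m(2) by (simp add: dv)
    then have "2 * mdeg m' \<le> mdeg m"
      unfolding mdeg_def[of m] sum_distrib_left
    proof (simp add: sum_distrib_left, intro sum_mono)
      fix i
      have "2 * (lookup m i div ?q) \<le> ?q * (lookup m i div ?q)"
        using q2 by (rule mult_le_mono1)
      also have "\<dots> \<le> lookup m i" by simp
      finally show "2 * (lookup m i div ?q) \<le> lookup m i" .
    qed
    moreover have "mdeg m \<le> t" using f(2) m(1) by (simp add: tdeg_le_def)
    ultimately show "mdeg m' \<le> t - 1" using f(3) by linarith
  qed
  ultimately show ?thesis using hq by blast
qed

context ac_prime
begin

text \<open>A nonzero relation of least total degree works. Its partial derivatives have smaller degree, so if they all were relations
they would all vanish. Then the relation is a constant in characteristic \<open>0\<close>, and a \<open>p\<close>-th power in characteristic \<open>p\<close>,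
whose \<open>p\<close>-th root is a relation of smaller degree.\<close>

lemma separable_relation:
  assumes "\<not> indep_mod P J"
  shows "\<exists>f\<in>mpolys J. f \<in> P \<and> (\<exists>l\<in>J. partial l f \<notin> P)"
proof -
  define W where "W t \<longleftrightarrow> (\<exists>f\<in>mpolys J. f \<in> P \<and> f \<noteq> 0 \<and> tdeg_le t f)" for t
  obtain f where "f \<in> mpolys J" "f \<in> P" "f \<noteq> 0" using assms unfolding indep_mod_def by blast
  moreover have "tdeg_le (Max (mdeg ` keys f)) f" unfolding tdeg_le_def by simp
  ultimately have "\<exists>t. W t" unfolding W_def by blast
  then obtain t where t: "W t" "\<And>s. W s \<Longrightarrow> t \<le> s" using exists_least_iff[of W] not_less by metis
  then obtain f where f: "f \<in> mpolys J" "f \<in> P" "f \<noteq> 0" "tdeg_le t f" unfolding W_def by blast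
  have t0: "t > 0"
  proof (rule ccontr)
    assume "\<not> t > 0"
    then have "\<forall>m\<in>keys f. mdeg m = 0" using f(4) unfolding tdeg_le_def by simp
    then have "\<forall>m\<in>keys f. keys m = {}"
      unfolding mdeg_def by (auto simp: in_keys_iff intro: poly_mapping_eqI)
    then obtain c where "f = mconst c" using mpolys_empty[of f] unfolding mpolys_def by auto
    then show False using const_notin[OF prime_ideal_axioms, of c] f(2,3) by (cases "c = 0") auto
  qed
  have smaller: "h = 0" if "h \<in> mpolys J" "h \<in> P" "tdeg_le (t - 1) h" for h
    using t(2)[of "t - 1"] t0 that unfolding W_def by force
  show ?thesis
  proof (rule ccontr)
    assume neg: "\<not> ?thesis"
    have partial0: "partial l f = 0" for l
    proof (cases "l \<in> J")
      case True
      then show ?thesis using neg f smaller[OF partial_mpolys[OF f(1)] _ tdeg_le_partial[OF f(4)]] by blast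
    next
      case False
      then show ?thesis using partial_free[OF f(1)] by blast
    qed
    have dvd: "CHAR('a) dvd lookup m i" if m: "m \<in> keys f" for m i
    proof (cases "lookup m i = 0")
      case False
      then have "of_nat (lookup m i) * lookup f m = 0"
        using lookup_partial[of m i f] partial0 by simp
      then show ?thesis using m by (simp add: in_keys_iff of_nat_eq_0_iff_char_dvd)
    qed simp
    show False
    proof (cases "CHAR('a) = 0")
      case True
      then have "keys m = {}" if "m \<in> keys f" for m
        using dvd[OF that] by (auto intro: poly_mapping_eqI)
      then have "tdeg_le 0 f" unfolding tdeg_le_def mdeg_def by fastforce
      then show False using t(2)[of 0] t0 f unfolding W_def by auto
    next
      case False
      then have "prime CHAR('a)" by (intro prime_CHAR_semidom) simp
      then obtain h where h: "h \<in> mpolys J" "h ^ CHAR('a) = f" "tdeg_le (t - 1) h"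
        using ex_pth_root[OF _ f(1,4) t0 dvd] by blast
      then have "h \<in> P" using power_notin[of h "CHAR('a)"] f(2) by blast
      then have "h = 0" using smaller h by blast
      then show False using h(2) f(3) False by (simp add: power_0_left)
    qed
  qed
qed

end

section \<open>Tangent vectors at a general point\<close>

text \<open>The derivative at \<open>a\<close> in the direction \<open>d\<close>; the vectors \<open>d\<close> with derivative \<open>0\<close> for all elements of \<open>P\<close> are the
tangent vectors at \<open>a\<close> of the variety of \<open>P\<close>.\<close>

definition dir_deriv :: "nat \<Rightarrow> (nat \<Rightarrow> 'a::idom) \<Rightarrow> (nat \<Rightarrow> 'a) \<Rightarrow> 'a mpoly \<Rightarrow> 'a" where
  "dir_deriv N a d f = (\<Sum>i<N. ev a (partial i f) * d i)"

lemma dir_deriv_add: "dir_deriv N a d (p + q) = dir_deriv N a d p + dir_deriv N a d q"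
  and dir_deriv_mult: "dir_deriv N a d (p * q) = ev a p * dir_deriv N a d q + ev a q * dir_deriv N a d p"
  and dir_deriv_const [simp]: "dir_deriv N a d (mconst c) = 0"
  and dir_deriv_zero [simp]: "dir_deriv N a d 0 = 0"
  by (simp_all add: dir_deriv_def partial_add partial_mult ev.eval_add ev.eval_mult sum.distrib sum_distrib_left
      algebra_simps)

lemma dir_deriv_var: "i < N \<Longrightarrow> dir_deriv N a d (mvar i) = d i"
  by (simp add: dir_deriv_def partial_var if_distrib[of "ev a"] if_distrib[of "\<lambda>x. x * _"] cong: if_cong)

lemma dir_deriv_diff: "dir_deriv N a d (p - q) = dir_deriv N a d p - dir_deriv N a d q"
  by (metis add_diff_cancel_right' diff_add_cancel dir_deriv_add)

lemma dir_deriv_poly: "dir_deriv N a d (poly q x) =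
    poly (map_poly (dir_deriv N a d) q) (ev a x) + ev a (poly (pderiv q) x) * dir_deriv N a d x"
proof (induction q)
  case (pCons c q)
  then show ?case
    by (simp add: dir_deriv_add dir_deriv_mult map_poly_pCons pderiv_pCons ev.eval_add ev.eval_mult algebra_simps)
qed simp

lemma dir_deriv_cong:
  assumes "p \<in> mpolys S" "\<And>i. i \<in> S \<Longrightarrow> d i = d' i"
  shows "dir_deriv N a d p = dir_deriv N a d' p"
  unfolding dir_deriv_def
proof (rule sum.cong)
  fix i
  show "ev a (partial i p) * d i = ev a (partial i p) * d' i"
    by (cases "i \<in> S") (use assms partial_free[OF assms(1)] in auto)
qed simp

context ac_prime
begin

text \<open>At a general point the tangent space projects onto the coordinate space of some transcendence basis \<open>J\<close>, so its dimension
is at least the dimension of the variety. The basis has to be separating: it is reached by removing one variable after the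
other, each separably algebraic over the remaining ones. In the converse direction a vector extends along
a removed variable \<open>l\<close> because the derivative of the minimal polynomial of \<open>l\<close> does not vanish at \<open>l\<close>; the value is
forced by this polynomial, and division by it shows that all other relations are then respected.\<close>

lemma tangent_extension:
  assumes "S \<subseteq> {..<N}"
  shows "\<exists>J\<subseteq>S. indep_mod P J \<and> (\<forall>J'\<subseteq>S. indep_mod P J' \<longrightarrow> card J' \<le> card J) \<and>
    (\<exists>g\<in>mpolys {..<N}. g \<notin> P \<and> (\<forall>a. vanishes P {..<N} a \<and> ev a g \<noteq> 0 \<longrightarrow>
      (\<forall>d'. \<exists>d. (\<forall>i\<in>J. d i = d' i) \<and> (\<forall>f\<in>mpolys S. f \<in> P \<longrightarrow> dir_deriv N a d f = 0))))"
  using assms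
proof (induction "card S" arbitrary: S)
  case 0
  then have "S = {}" using finite_subset[of S "{..<N}"] by simp
  moreover have dir_deriv0: "dir_deriv N a d p = 0" if "p \<in> mpolys {}" for a d p
    using mpolys_empty[OF that] by auto
  ultimately show ?case
    using indep_mod_empty[OF prime_ideal_axioms]
    by (intro exI[of _ "{}"] conjI) (auto intro!: bexI[of _ 1])
next
  case (Suc n)
  have finS: "finite S" using Suc.prems finite_subset by blast
  show ?case
  proof (cases "indep_mod P S")
    case True
    then have "dir_deriv N a d p = 0" if "p \<in> mpolys S" "p \<in> P" for a d p
      using that unfolding indep_mod_def by fastforce
    then show ?thesis using finS True
      by (intro exI[of _ S] conjI) (auto intro!: bexI[of _ 1] card_mono)
  next
    case False
    then obtain f l where f: "f \<in> mpolys S" "f \<in> P" "l \<in> S" "partial l f \<notin> P"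
      using separable_relation by blast
    define S' where "S' = S - {l}"
    have S': "S = insert l S'" "l \<notin> S'" "finite S'" "S' \<subseteq> {..<N}"
      using f(3) finS Suc.prems by (auto simp: S'_def)
    have "n = card S'" using Suc.hyps(2) S' by simp
    note IH = Suc.hyps(1)[OF this S'(4)]
    from IH obtain J where J: "J \<subseteq> S'" "indep_mod P J"
        "\<forall>J'\<subseteq>S'. indep_mod P J' \<longrightarrow> card J' \<le> card J"
      and ex: "\<exists>g\<in>mpolys {..<N}. g \<notin> P \<and> (\<forall>a. vanishes P {..<N} a \<and> ev a g \<noteq> 0 \<longrightarrow>
        (\<forall>d'. \<exists>d. (\<forall>i\<in>J. d i = d' i) \<and> (\<forall>f\<in>mpolys S'. f \<in> P \<longrightarrow> dir_deriv N a d f = 0)))"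
      by (elim exE conjE) (rule that)
    from ex obtain g0 where g0: "g0 \<in> mpolys {..<N}" "g0 \<notin> P"
        "\<forall>a. vanishes P {..<N} a \<and> ev a g0 \<noteq> 0 \<longrightarrow>
        (\<forall>d'. \<exists>d. (\<forall>i\<in>J. d i = d' i) \<and> (\<forall>f\<in>mpolys S'. f \<in> P \<longrightarrow> dir_deriv N a d f = 0))"
      by (elim bexE conjE) (rule that)
    have max: "card J' \<le> card J" if J': "J' \<subseteq> S" "indep_mod P J'" for J'
    proof (cases "l \<in> J'")
      case False
      then show ?thesis using J(3) J' S' by blast
    next
      case True
      define J0 where "J0 = J' - {l}"
      have J0: "J' = insert l J0" "l \<notin> J0" "J0 \<subseteq> S'" "finite J0"
        using True J' S' finite_subset[OF J'(1) finS] by (auto simp: J0_def)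
      have "\<exists>m\<in>S' - J0. indep_mod P (insert m J0)"
        using exchange_separable[of l J0 S' f] J' J0 S' f by metis
      then obtain m where m: "m \<in> S' - J0" "indep_mod P (insert m J0)" by blast
      then have "card (insert m J0) \<le> card J" using J(3) J0(3) by simp
      then show ?thesis using m J0 by simp
    qed
    let ?A = "mpolys S'"
    have F: "expand l f \<in> polys ?A" "poly (expand l f) (mvar l) \<in> P"
      using expand_polys[of f l S'] f S' by auto
    moreover have "expand l f \<notin> polys P" using partial_polys f(4) by blast
    ultimately have alg: "algebraic_mod P ?A (mvar l)" unfolding algebraic_mod_def by blast
    obtain h where h: "minpoly_mod P ?A (mvar l) h"
      using ex_minpoly[OF mpolys.ring_set_axioms alg] ..
    let ?c = "lead_coeff h" and ?X = "mvar l"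
    have hA: "h \<in> polys ?A" and c: "?c \<notin> P" "?c \<in> ?A" and hX: "poly h ?X \<in> P"
      using h unfolding minpoly_mod_def by (auto intro: polysD)
    \<comment> \<open>If \<open>h\<close> had a multiple root at \<open>x\<^sub>l\<close>, so would every relation, in contrast to \<open>f\<close>.\<close>
    have sep: "poly (pderiv h) ?X \<notin> P"
    proof
      assume hP: "poly (pderiv h) ?X \<in> P"
      obtain k q r where qr: "q \<in> polys ?A" "r \<in> polys ?A"
        "smult (?c ^ k) (expand l f) = q * h + r" "r \<in> polys P"
        using minpoly_division[OF mpolys.ring_set_axioms h F] by blast
      have "?c ^ k * partial l f = poly (pderiv (smult (?c ^ k) (expand l f))) ?X"
        by (simp add: partial_def pderiv_smult)
      also have "\<dots> = poly q ?X * poly (pderiv h) ?X + poly h ?X * poly (pderiv q) ?X + poly (pderiv r) ?X"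
        unfolding qr(3) by (simp add: pderiv_add pderiv_mult)
      also have "\<dots> \<in> P" using hP hX poly_polys[OF pderiv_polys_P[OF qr(4)]] by blast
      finally show False using mult_notin[OF power_notin[OF c(1)] f(4)] by blast
    qed
    define g where "g = g0 * (?c * poly (pderiv h) ?X)"
    have hS: "poly (pderiv h) ?X \<in> mpolys S"
      unfolding S'(1) by (rule poly_mpolys[OF pderiv_polys[OF mpolys.ring_set_axioms hA]])
    have gN: "g \<in> mpolys {..<N}"
      unfolding g_def using g0(1) mpolys_mono[OF c(2) S'(4)] mpolys_mono[OF hS Suc.prems] by blast
    have gP: "g \<notin> P"
      unfolding g_def by (intro mult_notin g0(2) c(1) sep)
    have ext: "\<exists>d. (\<forall>i\<in>J. d i = d' i) \<and> (\<forall>p\<in>mpolys S. p \<in> P \<longrightarrow> dir_deriv N a d p = 0)"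
      if a: "vanishes P {..<N} a" "ev a g \<noteq> 0" for a d'
    proof -
      have van: "ev a p = 0" if "p \<in> mpolys S" "p \<in> P" for p
        using a(1) that mpolys_mono[OF that(1) Suc.prems] unfolding vanishes_def by blast
      have nz: "ev a g0 \<noteq> 0" "ev a ?c \<noteq> 0" "ev a (poly (pderiv h) ?X) \<noteq> 0"
        using a(2) by (auto simp: g_def ev.eval_mult)
      obtain d0 where d0: "\<forall>i\<in>J. d0 i = d' i" "\<And>p. p \<in> ?A \<Longrightarrow> p \<in> P \<Longrightarrow> dir_deriv N a d0 p = 0"
        using g0(3)[rule_format, OF conjI[OF a(1) nz(1)], of d'] by (elim exE conjE) (rule that, auto)
      \<comment> \<open>The value at \<open>l\<close> is the solution of the differentiated equation \<open>h(x\<^sub>l) = 0\<close>.\<close>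
      define d where "d = d0(l := - poly (map_poly (dir_deriv N a d0) h) (ev a ?X) / ev a (poly (pderiv h) ?X))"
      have same: "dir_deriv N a d p = dir_deriv N a d0 p" if "p \<in> ?A" for p
        by (rule dir_deriv_cong[OF that]) (use S'(2) in \<open>auto simp: d_def\<close>)
      have map: "map_poly (dir_deriv N a d) q = map_poly (dir_deriv N a d0) q" if "q \<in> polys ?A" for q
        by (rule poly_eqI) (simp add: coeff_map_poly same polysD[OF that])
      have "l < N" using f(3) Suc.prems by auto
      then have dX: "dir_deriv N a d ?X = d l" by (rule dir_deriv_var)
      have h0: "dir_deriv N a d (poly h ?X) = 0"
        unfolding dir_deriv_poly map[OF hA] dX using nz(3) by (simp add: d_def)
      have "dir_deriv N a d p = 0" if p: "p \<in> mpolys S" "p \<in> P" for p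
      proof -
        have H: "expand l p \<in> polys ?A" "poly (expand l p) ?X \<in> P"
          using expand_polys[of p l S'] p S' by auto
        obtain k q r where qr: "q \<in> polys ?A" "r \<in> polys ?A"
          "smult (?c ^ k) (expand l p) = q * h + r" "r \<in> polys P"
          using minpoly_division[OF mpolys.ring_set_axioms h H] by blast
        have e: "?c ^ k * p = poly q ?X * poly h ?X + poly r ?X"
          using arg_cong[OF qr(3), of "\<lambda>p. poly p ?X"] by simp
        have "map_poly (dir_deriv N a d0) r = 0"
          by (rule poly_eqI) (simp add: coeff_map_poly d0(2) polysD[OF qr(2)] polysD[OF qr(4)])
        moreover have "ev a (poly (pderiv r) ?X) = 0"
        proof (rule van)
          show "poly (pderiv r) ?X \<in> mpolys S"
            unfolding S'(1) by (rule poly_mpolys[OF pderiv_polys[OF mpolys.ring_set_axioms qr(2)]])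
          show "poly (pderiv r) ?X \<in> P" by (rule poly_polys[OF pderiv_polys_P[OF qr(4)]])
        qed
        ultimately have r0: "dir_deriv N a d (poly r ?X) = 0" unfolding dir_deriv_poly map[OF qr(2)] by simp
        have "ev a (poly h ?X) = 0"
          by (rule van) (use hX poly_mpolys[OF hA, of l] S'(1) in simp_all)
        then have "dir_deriv N a d (?c ^ k * p) = 0" unfolding e by (simp add: dir_deriv_add dir_deriv_mult h0 r0)
        then have "ev a ?c ^ k * dir_deriv N a d p = 0" by (simp add: dir_deriv_mult van[OF p] ev.eval_power)
        then show ?thesis using nz(2) by simp
      qed
      moreover have "\<forall>i\<in>J. d i = d' i" using d0(1) J(1) S'(2) by (auto simp: d_def)
      ultimately show ?thesis by blast
    qed
    have "J \<subseteq> S" using J(1) S'(1) by blast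
    then show ?thesis
      by (intro exI[of _ J] conjI bexI[OF _ gN] J(2)) (use max gP ext in auto)
  qed
qed

end

section \<open>Chains of prime ideals\<close>

lemma ex_prime_ideal_disjoint:
  fixes I M :: "'r::comm_ring_1 set"
  assumes I: "0 \<in> I" "\<And>x y. x \<in> I \<Longrightarrow> y \<in> I \<Longrightarrow> x + y \<in> I" "\<And>x r. x \<in> I \<Longrightarrow> r * x \<in> I"
    and M: "1 \<in> M" "\<And>x y. x \<in> M \<Longrightarrow> y \<in> M \<Longrightarrow> x * y \<in> M" and disj: "I \<inter> M = {}"
  shows "\<exists>Q. prime_ideal Q \<and> I \<subseteq> Q \<and> Q \<inter> M = {}"
proof -
  define idl where "idl Q \<longleftrightarrow> 0 \<in> Q \<and> (\<forall>x\<in>Q. \<forall>y\<in>Q. x + y \<in> Q) \<and> (\<forall>x\<in>Q. \<forall>r. r * x \<in> Q)"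
    for Q :: "'r set"
  define Z where "Z = {Q. idl Q \<and> I \<subseteq> Q \<and> Q \<inter> M = {}}"
  have "\<exists>Q\<in>Z. \<forall>R\<in>Z. Q \<subseteq> R \<longrightarrow> R = Q"
  proof (rule subset_Zorn_nonempty)
    have "I \<in> Z" using I disj by (simp add: Z_def idl_def)
    then show "Z \<noteq> {}" by blast
    fix C assume C: "C \<noteq> {}" "subset.chain Z C"
    then have CZ: "\<And>Q. Q \<in> C \<Longrightarrow> Q \<in> Z" and lin: "\<And>Q R. Q \<in> C \<Longrightarrow> R \<in> C \<Longrightarrow> Q \<subseteq> R \<or> R \<subseteq> Q"
      unfolding subset.chain_def by blast+
    have "idl (\<Union>C)"
      unfolding idl_def
    proof (intro conjI ballI allI)
      show "0 \<in> \<Union>C" using C(1) CZ unfolding Z_def idl_def by blast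
      show "x + y \<in> \<Union>C" if xy: "x \<in> \<Union>C" "y \<in> \<Union>C" for x y
      proof -
        obtain Q R where QR: "Q \<in> C" "x \<in> Q" "R \<in> C" "y \<in> R" using xy by blast
        then obtain S where "S \<in> C" "x \<in> S" "y \<in> S" using lin[of Q R] by blast
        then show ?thesis using CZ[of S] unfolding Z_def idl_def by blast
      qed
      show "r * x \<in> \<Union>C" if "x \<in> \<Union>C" for x r
        using that CZ unfolding Z_def idl_def by blast
    qed
    moreover have "I \<subseteq> \<Union>C" using C(1) CZ unfolding Z_def by blast
    moreover have "\<Union>C \<inter> M = {}" using CZ unfolding Z_def by blast
    ultimately show "\<Union>C \<in> Z" unfolding Z_def by blast
  qed
  then obtain Q where QZ: "Q \<in> Z" and mx: "\<forall>R\<in>Z. Q \<subseteq> R \<longrightarrow> R = Q" by (elim bexE) (rule that)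
  have Q: "idl Q" "I \<subseteq> Q" "Q \<inter> M = {}" using QZ unfolding Z_def by auto
  have Q': "0 \<in> Q" "\<And>x y. x \<in> Q \<Longrightarrow> y \<in> Q \<Longrightarrow> x + y \<in> Q" "\<And>x r. x \<in> Q \<Longrightarrow> r * x \<in> Q"
    using Q(1) unfolding idl_def by blast+
  have meets: "\<exists>q\<in>Q. \<exists>r. q + r * x \<in> M" if x: "x \<notin> Q" for x
  proof (rule ccontr)
    assume neg: "\<not> ?thesis"
    define R where "R = {q + r * x | q r. q \<in> Q}"
    have idlR: "idl R"
      unfolding idl_def
    proof (intro conjI ballI allI)
      show "0 \<in> R" unfolding R_def using Q'(1) by (intro CollectI exI[of _ 0]) simp
      show "y + z \<in> R" if yz: "y \<in> R" "z \<in> R" for y z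
      proof -
        obtain q r q' r' where "y = q + r * x" "z = q' + r' * x" "q \<in> Q" "q' \<in> Q"
          using yz unfolding R_def by blast
        then show ?thesis unfolding R_def using Q'(2)
          by (intro CollectI exI[of _ "q + q'"] exI[of _ "r + r'"]) (simp add: algebra_simps)
      qed
      show "s * y \<in> R" if y: "y \<in> R" for y s
      proof -
        obtain q r where "y = q + r * x" "q \<in> Q" using y unfolding R_def by blast
        then show ?thesis unfolding R_def using Q'(3)
          by (intro CollectI exI[of _ "s * q"] exI[of _ "s * r"]) (simp add: algebra_simps)
      qed
    qed
    have QX: "Q \<subseteq> R"
    proof
      fix q assume "q \<in> Q"
      then show "q \<in> R" unfolding R_def by (intro CollectI exI[of _ q] exI[of _ 0]) simp
    qed
    have "R \<inter> M = {}" using neg unfolding R_def by blast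
    then have "R \<in> Z" using Q(2) QX idlR unfolding Z_def by blast
    then have "R = Q" using mx QX by blast
    moreover have "x \<in> R" unfolding R_def using Q'(1) by (intro CollectI exI[of _ 0] exI[of _ 1]) simp
    ultimately show False using x by blast
  qed
  have "prime_ideal Q"
  proof
    show "1 \<notin> Q" using M(1) Q(3) by blast
    fix x y assume xy: "x * y \<in> Q"
    show "x \<in> Q \<or> y \<in> Q"
    proof (rule ccontr)
      assume "\<not> (x \<in> Q \<or> y \<in> Q)"
      then obtain q r q' r' where qr: "q \<in> Q" "q + r * x \<in> M" "q' \<in> Q" "q' + r' * y \<in> M"
        using meets by meson
      have "(q + r * x) * (q' + r' * y) = (q' + r' * y) * q + ((r * x) * q' + (r * r') * (x * y))"
        by (simp add: algebra_simps)
      also have "\<dots> \<in> Q" by (rule Q'(2)[OF Q'(3)[OF qr(1)] Q'(2)[OF Q'(3)[OF qr(3)] Q'(3)[OF xy]]])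
      finally show False using M(2)[OF qr(2,4)] Q(3) by blast
    qed
  qed (use Q' in auto)
  then show ?thesis using Q by blast
qed

text \<open>The retraction of the polynomials in all variables to those in the first \<open>N\<close>. Taking preimages under it, a prime of the ring
in \<open>N\<close> variables becomes a prime of the whole polynomial type with the same elements in the first \<open>N\<close> variables.\<close>

definition retract :: "nat \<Rightarrow> 'a::comm_ring_1 mpoly \<Rightarrow> 'a mpoly" where
  "retract N = mpoly_subst (\<lambda>i. if i < N then mvar i else 0)"

lemma retract_add: "retract N (p + q) = retract N p + retract N q"
  and retract_mult: "retract N (p * q) = retract N p * retract N q"
  and retract_zero [simp]: "retract N 0 = 0"
  and retract_one [simp]: "retract N 1 = 1"
  by (simp_all add: retract_def mpoly_subst_eq msubst.eval_add msubst.eval_mult)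

lemma msubst_mvar: "mpoly_subst mvar p = p"
  using mpolys_UNIV[of p]
  by (induction rule: mpolys_induct) (simp_all add: mpoly_subst_eq msubst.eval_add msubst.eval_mult)

lemma retract_id:
  assumes "p \<in> mpolys {..<N}" shows "retract N p = p"
proof -
  have "mpoly_eval mconst (\<lambda>i. if i < N then mvar i else 0) p = mpoly_eval mconst mvar p"
    by (rule msubst.eval_cong[OF assms]) simp
  then show ?thesis using msubst_mvar[of p] unfolding retract_def mpoly_subst_eq by simp
qed

lemma retract_mpolys: "retract N p \<in> mpolys {..<N}"
  unfolding retract_def mpoly_subst_eq
  by (rule msubst.eval_ring_set[OF mpolys_UNIV[of p] mpolys.ring_set_axioms]) auto

lemma retract_retract: "retract N (retract N p) = retract N p"
  by (rule retract_id) (rule retract_mpolys)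

lemma prime_ideal_retract: "prime_ideal P \<Longrightarrow> prime_ideal {p. retract N p \<in> P}"
proof -
  assume "prime_ideal P"
  then interpret prime_ideal P .
  show ?thesis
    by standard (auto simp: retract_add retract_mult dest: prime)
qed

context ac_prime
begin

text \<open>Cutting with a hyperplane \<open>x\<^sub>j = c\<close> lowers the dimension by only one, for a suitable constant \<open>c\<close>. A prime above
\<open>P + (x\<^sub>j - c)\<close> is chosen maximal among the ideals that meet the polynomials in the variables \<open>J - {j}\<close> only in \<open>0\<close>. Such
ideals exist: a nonzero \<open>m\<close> in \<open>P + (x\<^sub>j - c)\<close> and in these variables would vanish on the points of the variety
with \<open>x\<^sub>j = c\<close>, but point lifting gives one where it does not.\<close>

lemma chain_step:
  assumes stable: "\<And>p. p \<in> P \<Longrightarrow> retract N p \<in> P"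
    and J: "J \<subseteq> {..<N}" "indep_mod P J" "j \<in> J"
  shows "\<exists>c Q. prime_ideal Q \<and> (\<forall>p\<in>Q. retract N p \<in> Q) \<and> P \<subseteq> Q \<and>
    mvar j - mconst c \<in> Q \<and> indep_mod Q (J - {j})"
proof -
  let ?J = "J - {j}"
  have Jj: "J = insert j ?J" "j \<notin> ?J" using J(3) by auto
  have finJ: "finite J" using J(1) finite_subset by blast
  obtain g where g: "g \<in> mpolys J" "g \<notin> P" "\<forall>a. vanishes P J a \<and> ev a g \<noteq> 0 \<longrightarrow>
      (\<exists>b. (\<forall>i\<in>J. b i = a i) \<and> vanishes P (J \<union> {..<N}) b \<and> ev b 1 \<noteq> 0)"
    using lift_point[of "{..<N}" 1 J] by auto
  have van: "vanishes P J a" for a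
    using J(2) unfolding vanishes_def indep_mod_def by auto
  define h where "h = expand j g"
  have h: "h \<in> polys (mpolys ?J)" unfolding h_def using expand_polys[of g j ?J] g(1) Jj by simp
  have gh: "poly h (mvar j) = g" by (simp add: h_def)
  obtain k where k: "coeff h k \<notin> P" using poly_polys[of h "mvar j"] gh g(2) unfolding polys_def by blast
  have "coeff h k \<in> mpolys J" using polysD[OF h, of k] by (rule mpolys_mono) auto
  then obtain a where a: "ev a (coeff h k) \<noteq> 0" using nullstellensatz[OF finJ _ k] by blast
  then have "coeff (map_poly (ev a) h) k \<noteq> 0" by (simp add: coeff_map_poly)
  then have "map_poly (ev a) h \<noteq> 0" by auto
  then obtain c where c: "poly (map_poly (ev a) h) c \<noteq> 0" using alg_closed_nonroot by blast
  have xN: "mvar j - mconst c \<in> mpolys {..<N}" by (rule mpolys.diff) (use J(1,3) in auto)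
  \<comment> \<open>\<open>g\<close> restricted to the hyperplane \<open>x\<^sub>j = c\<close>\<close>
  define e where "e = poly h (mconst c)"
  have eJ: "e \<in> mpolys ?J" unfolding e_def using h by (rule mpolys.poly) simp
  have eva: "ev x e = poly (map_poly (ev x) h) c" for x by (simp add: e_def ev.eval_poly)
  have "e \<noteq> 0" using c eva[of a] by auto
  then have eP: "e \<notin> P" using J(2) mpolys_mono[OF eJ, of J] unfolding indep_mod_def by blast
  define I where "I = {q + u * (mvar j - mconst c) | q u. q \<in> P}"
  define M where "M = mpolys ?J - {0 :: 'a mpoly}"
  have "m \<notin> M" if m: "m \<in> I" for m
  proof
    assume mM: "m \<in> M"
    obtain q0 u0 where qu0: "m = q0 + u0 * (mvar j - mconst c)" "q0 \<in> P" using m unfolding I_def by blast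
    have mJ: "m \<in> mpolys ?J" "m \<noteq> 0" using mM unfolding M_def by auto
    define q where "q = retract N q0"
    define u where "u = retract N u0"
    have mN: "m \<in> mpolys {..<N}" by (rule mpolys_mono[OF mJ(1)]) (use J(1) in auto)
    then have qu: "m = q + u * (mvar j - mconst c)"
      using arg_cong[OF qu0(1), of "retract N"] xN mN
      by (simp add: retract_id retract_add retract_mult q_def u_def)
    have q: "q \<in> P" "q \<in> mpolys {..<N}" using stable qu0(2) retract_mpolys by (auto simp: q_def)
    have mP: "m \<notin> P" using J(2) mpolys_mono[OF mJ(1), of J] mJ(2) unfolding indep_mod_def by blast
    have "e * m \<in> mpolys J" using mpolys_mono[OF eJ, of J] mpolys_mono[OF mJ(1), of J] by blast
    then obtain a1 where "ev a1 (e * m) \<noteq> 0" using nullstellensatz[OF finJ _ mult_notin[OF eP mP]] by blast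
    then have a1: "ev a1 e \<noteq> 0" "ev a1 m \<noteq> 0" by (auto simp: ev.eval_mult)
    have "ev (a1(j := c)) g \<noteq> 0"
      using ev_upd[OF h Jj(2), of a1 c] a1(1) by (simp add: gh eva)
    then obtain b where b: "\<forall>i\<in>J. b i = (a1(j := c)) i" "vanishes P (J \<union> {..<N}) b"
      using g(3) van by blast
    have "ev b m = ev a1 m" by (rule ev.eval_cong[OF mJ(1)]) (use b(1) in auto)
    moreover have "ev b q = 0" using b(2) q mpolys_mono[OF q(2), of "J \<union> {..<N}"] unfolding vanishes_def by blast
    moreover have "b j = c" using b(1) J(3) by auto
    ultimately show False using a1(2) unfolding qu by (simp add: ev.eval_add ev.eval_mult ev.eval_diff)
  qed
  then have disj: "I \<inter> M = {}" by blast
  obtain Q0 where Q0: "prime_ideal Q0" "I \<subseteq> Q0" "Q0 \<inter> M = {}"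
  proof -
    have "\<exists>Q. prime_ideal Q \<and> I \<subseteq> Q \<and> Q \<inter> M = {}"
    proof (rule ex_prime_ideal_disjoint[OF _ _ _ _ _ disj])
      show "0 \<in> I" unfolding I_def by (intro CollectI exI[of _ 0]) simp
      show "x + y \<in> I" if xy: "x \<in> I" "y \<in> I" for x y
      proof -
        obtain q u q' u' where e: "x = q + u * (mvar j - mconst c)" "y = q' + u' * (mvar j - mconst c)"
          "q \<in> P" "q' \<in> P" using xy unfolding I_def by blast
        have "x + y = (q + q') + (u + u') * (mvar j - mconst c)"
          unfolding e(1,2) by (simp only: algebra_simps)
        then show ?thesis unfolding I_def using add[OF e(3,4)] by blast
      qed
      show "r * x \<in> I" if x: "x \<in> I" for x r
      proof -
        obtain q u where e: "x = q + u * (mvar j - mconst c)" "q \<in> P" using x unfolding I_def by blast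
        have "r * x = r * q + (r * u) * (mvar j - mconst c)"
          unfolding e(1) by (simp only: algebra_simps)
        then show ?thesis unfolding I_def using absorb[OF e(2), of r] by blast
      qed
      show "1 \<in> M" unfolding M_def by simp
      show "x * y \<in> M" if "x \<in> M" "y \<in> M" for x y using that unfolding M_def by auto
    qed
    then show thesis using that by blast
  qed
  define Q where "Q = {p. retract N p \<in> Q0}"
  have PQ0: "P \<subseteq> Q0"
  proof
    fix p assume "p \<in> P"
    then have "p \<in> I" unfolding I_def by (intro CollectI exI[of _ p] exI[of _ 0]) simp
    then show "p \<in> Q0" using Q0(2) by blast
  qed
  have "mvar j - mconst c \<in> I" unfolding I_def by (intro CollectI exI[of _ 0] exI[of _ 1]) simp
  then have "mvar j - mconst c \<in> Q0" using Q0(2) by blast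
  then have "mvar j - mconst c \<in> Q" unfolding Q_def using xN by (simp add: retract_id)
  moreover have "prime_ideal Q" unfolding Q_def using Q0(1) by (rule prime_ideal_retract)
  moreover have "\<forall>p\<in>Q. retract N p \<in> Q" unfolding Q_def by (simp add: retract_retract)
  moreover have "P \<subseteq> Q" unfolding Q_def using stable PQ0 by blast
  moreover have "indep_mod Q ?J"
    unfolding indep_mod_def
  proof (intro ballI impI)
    fix p assume p: "p \<in> mpolys ?J" "p \<in> Q"
    have "p \<in> mpolys {..<N}" using J(1) by (auto intro: mpolys_mono[OF p(1)])
    then have "p \<in> Q0" using p(2) unfolding Q_def by (simp add: retract_id)
    then show "p = 0" using Q0(3) p(1) unfolding M_def by blast
  qed
  ultimately show ?thesis by blast
qed

end

lemma ex_prime_chain: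
  fixes P :: "'a::alg_closed_field mpoly set"
  assumes "prime_ideal P" "\<And>p. p \<in> P \<Longrightarrow> retract N p \<in> P" "J \<subseteq> {..<N}" "indep_mod P J"
  shows "\<exists>q. q 0 = P \<and> (\<forall>i\<le>card J. prime_ideal (q i)) \<and>
    (\<forall>i<card J. q i \<subseteq> q (Suc i) \<and> (\<exists>x\<in>mpolys {..<N}. x \<in> q (Suc i) \<and> x \<notin> q i))"
  using assms
proof (induction "card J" arbitrary: J P)
  case 0
  then show ?case by (intro exI[of _ "\<lambda>_. P"]) simp
next
  case (Suc n)
  interpret ac_prime P using Suc.prems(1) by (simp add: ac_prime_def mprime_def)
  obtain j where j: "j \<in> J" using Suc.hyps(2) by fastforce
  have fin: "finite J" using Suc.prems(3) finite_subset by blast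
  obtain c Q where Q: "prime_ideal Q" "\<forall>p\<in>Q. retract N p \<in> Q" "P \<subseteq> Q" "mvar j - mconst c \<in> Q"
    "indep_mod Q (J - {j})" using chain_step[OF Suc.prems(2-4) j] by blast
  have n: "n = card (J - {j})" using Suc.hyps(2) j fin by simp
  have sub: "J - {j} \<subseteq> {..<N}" using Suc.prems(3) by blast
  have "\<exists>q. q 0 = Q \<and> (\<forall>i\<le>n. prime_ideal (q i)) \<and>
    (\<forall>i<n. q i \<subseteq> q (Suc i) \<and> (\<exists>x\<in>mpolys {..<N}. x \<in> q (Suc i) \<and> x \<notin> q i))"
    using Suc.hyps(1)[OF n Q(1) Q(2)[rule_format] sub Q(5)] unfolding n .
  then obtain q where q: "q 0 = Q" "\<forall>i\<le>n. prime_ideal (q i)"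
    "\<forall>i<n. q i \<subseteq> q (Suc i) \<and> (\<exists>x\<in>mpolys {..<N}. x \<in> q (Suc i) \<and> x \<notin> q i)"
    by (elim exE conjE) (rule that)
  let ?x = "mvar j - mconst c :: 'a mpoly"
  have xN: "?x \<in> mpolys {..<N}" and xJ: "?x \<in> mpolys J"
    using j Suc.prems(3) by (auto intro!: mpolys.diff)
  have "partial j (?x + mconst c) = 1" by (simp add: partial_var)
  then have "?x \<noteq> 0" unfolding partial_add by auto
  then have xP: "?x \<notin> P" using Suc.prems(4) xJ unfolding indep_mod_def by blast
  define q' where "q' i = (case i of 0 \<Rightarrow> P | Suc k \<Rightarrow> q k)" for i
  have "q' i \<subseteq> q' (Suc i) \<and> (\<exists>x\<in>mpolys {..<N}. x \<in> q' (Suc i) \<and> x \<notin> q' i)" if "i < card J" for i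
  proof (cases i)
    case 0
    then show ?thesis using q(1) Q(3,4) xN xP by (auto simp: q'_def)
  next
    case (Suc k)
    then have "k < n" using that Suc.hyps(2) by simp
    then show ?thesis using q(3) Suc by (simp add: q'_def)
  qed
  moreover have "prime_ideal (q' i)" if "i \<le> card J" for i
    using that Suc.hyps(2) q(2) Suc.prems(1) by (cases i) (auto simp: q'_def)
  ultimately show ?case by (intro exI[of _ q']) (simp add: q'_def)
qed

text \<open>A proper subvariety has smaller dimension: were the variables \<open>J\<close> a transcendence basis modulo \<open>P\<close> as well, elimination
of \<open>f\<close> would produce a nonzero polynomial in these variables that lies in \<open>P1\<close>.\<close>

lemma indep_grows:
  fixes P P1 :: "'a::idom mpoly set"
  assumes "prime_ideal P" "prime_ideal P1" "P \<subseteq> P1"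
    and f: "f \<in> mpolys {..<N}" "f \<in> P1" "f \<notin> P" and J: "J \<subseteq> {..<N}" "indep_mod P1 J"
  shows "\<exists>l<N. l \<notin> J \<and> indep_mod P (insert l J)"
proof (rule ccontr)
  assume neg: "\<not> ?thesis"
  interpret mprime P using assms(1) by (simp add: mprime_def)
  interpret P1: prime_ideal P1 by fact
  have ind: "indep_mod P J" using J(2) assms(3) unfolding indep_mod_def by blast
  have "m \<in> J \<or> algebraic_mod P (mpolys J) (mvar m)" if "m \<in> {..<N}" for m
    using neg that algebraic_of_dependent[OF ind, of m] by blast
  moreover have "f \<in> mpolys (J \<union> {..<N})" using f(1) by (rule mpolys_mono) auto
  ultimately obtain g v where g: "g \<in> mpolys J" "g \<notin> P" "g - v * f \<in> P"
    using eliminate_many[of "{..<N}" J f] f(3) by blast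
  have "g \<in> P1" using P1.cong[of g "v * f"] g(3) assms(3) f(2) by blast
  then have "g = 0" using J(2) g(1) unfolding indep_mod_def by blast
  then show False using g(2) by blast
qed

lemma indep_of_chain:
  fixes q :: "nat \<Rightarrow> 'a::field mpoly set"
  assumes "\<And>i. i \<le> l \<Longrightarrow> prime_ideal (q i)"
    "\<And>i. i < l \<Longrightarrow> q i \<subseteq> q (Suc i) \<and> (\<exists>x\<in>mpolys {..<N}. x \<in> q (Suc i) \<and> x \<notin> q i)"
  shows "\<exists>J\<subseteq>{..<N}. indep_mod (q 0) J \<and> card J = l"
proof -
  have "\<exists>J\<subseteq>{..<N}. indep_mod (q (l - i)) J \<and> card J = i" if "i \<le> l" for i
    using that
  proof (induction i)
    case 0
    have "indep_mod (q l) {}" using assms(1) by (intro indep_mod_empty) simp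
    then show ?case by (intro exI[of _ "{}"]) simp
  next
    case (Suc i)
    then obtain J where J: "J \<subseteq> {..<N}" "indep_mod (q (l - i)) J" "card J = i" by auto
    let ?k = "l - Suc i"
    have k: "Suc ?k = l - i" "?k < l" using Suc.prems by auto
    obtain x where x: "x \<in> mpolys {..<N}" "x \<in> q (Suc ?k)" "x \<notin> q ?k" using assms(2)[OF k(2)] by blast
    obtain m where m: "m < N" "m \<notin> J" "indep_mod (q ?k) (insert m J)"
      using indep_grows[of "q ?k" "q (Suc ?k)" x N J] assms(1)[of ?k] assms(1)[of "Suc ?k"]
        assms(2)[OF k(2)] x J k by auto
    have "finite J" using J(1) finite_subset by blast
    then show ?case using m J by (intro exI[of _ "insert m J"]) auto
  qed
  from this[of l] show ?thesis by simp
qed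

section \<open>Krull dimension of irreducible closed subsets\<close>

text \<open>The primes above \<open>I\<close>. The closed subspace of the spectrum with these points is written \<open>sspec R I\<close>.\<close>

definition vset :: "('a, 'b) ring_scheme \<Rightarrow> 'a set \<Rightarrow> 'a set set" where
  "vset R I = {P. primeideal P R \<and> I \<subseteq> P}"

abbreviation sspec :: "('a, 'b) ring_scheme \<Rightarrow> 'a set \<Rightarrow> 'a set topology" where
  "sspec R I \<equiv> subtopology (Spec R) {P. I \<subseteq> P}"

lemma topspace_Spec: "topspace (Spec R) = {P. primeideal P R}"
proof
  show "topspace (Spec R) \<subseteq> {P. primeideal P R}"
    unfolding topspace_def openin_Spec zariski_open_def by blast
  have "\<not> carrier R \<subseteq> P" if "primeideal P R" for P
  proof -
    interpret primeideal P R by fact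
    show ?thesis using I_notcarr a_subset by blast
  qed
  then have "{P. primeideal P R} = {P. primeideal P R \<and> \<not> carrier R \<subseteq> P}" by blast
  then have "openin (Spec R) {P. primeideal P R}"
    unfolding openin_Spec zariski_open_def by blast
  then show "{P. primeideal P R} \<subseteq> topspace (Spec R)" by (rule openin_subset)
qed

lemma closedin_Spec: "closedin (Spec R) C \<longleftrightarrow> (\<exists>S\<subseteq>carrier R. C = vset R S)"
proof
  assume C: "closedin (Spec R) C"
  then obtain S where S: "S \<subseteq> carrier R" "{P. primeideal P R} - C = {P. primeideal P R \<and> \<not> S \<subseteq> P}"
    unfolding closedin_def topspace_Spec openin_Spec zariski_open_def by blast
  have "C \<subseteq> {P. primeideal P R}" using closedin_subset[OF C] topspace_Spec by blast
  then have "C = vset R S" unfolding vset_def using S(2) by blast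
  then show "\<exists>S\<subseteq>carrier R. C = vset R S" using S(1) by blast
next
  assume "\<exists>S\<subseteq>carrier R. C = vset R S"
  then obtain S where S: "S \<subseteq> carrier R" "C = vset R S" by blast
  have "{P. primeideal P R} - C = {P. primeideal P R \<and> \<not> S \<subseteq> P}" unfolding S(2) vset_def by blast
  then show "closedin (Spec R) C"
    unfolding closedin_def topspace_Spec openin_Spec zariski_open_def using S unfolding vset_def by blast
qed

lemma topspace_sspec: "topspace (sspec R I) = vset R I"
  by (auto simp: topspace_Spec vset_def)

lemma closedin_sspec: "closedin (sspec R I) C \<longleftrightarrow> (\<exists>S\<subseteq>carrier R. C = vset R (S \<union> I))"
proof -
  have "vset R S \<inter> {P. I \<subseteq> P} = vset R (S \<union> I)" for S by (auto simp: vset_def)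
  then show ?thesis unfolding closedin_subtopology closedin_Spec by metis
qed

lemma closedin_vset:
  assumes "primeideal P R" "I \<subseteq> P" shows "closedin (sspec R I) (vset R P)"
proof -
  interpret primeideal P R by fact
  have "vset R P = vset R (P \<union> I)" using assms(2) by (auto simp: vset_def)
  then show ?thesis unfolding closedin_sspec using a_subset by blast
qed

lemma subtopology_vset:
  assumes "I \<subseteq> P" shows "subtopology (sspec R I) (vset R P) = sspec R P"
proof -
  have "topspace (Spec R) \<inter> ({Q. I \<subseteq> Q} \<inter> vset R P) = topspace (Spec R) \<inter> {Q. P \<subseteq> Q}"
    using assms by (auto simp: topspace_Spec vset_def)
  then show ?thesis unfolding subtopology_subtopology by (metis subtopology_restrict)
qed

text \<open>The generic point is the intersection of all points, which is prime by irreducibility.\<close>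

lemma irreducible_closed_generic:
  assumes "cring R" and W: "closedin (sspec R I) W" "irreducible_space (subtopology (sspec R I) W)"
  shows "\<exists>P. primeideal P R \<and> I \<subseteq> P \<and> W = vset R P"
proof -
  interpret cring R by fact
  obtain S where S: "S \<subseteq> carrier R" "W = vset R (S \<union> I)" using W(1) unfolding closedin_sspec by blast
  have top: "topspace (subtopology (sspec R I) W) = W"
    using closedin_subset[OF W(1)] by (simp only: topspace_subtopology) blast
  define P where "P = \<Inter>W"
  have W0: "W \<noteq> {}" using W(2) unfolding irreducible_space_def top by blast
  have pr: "primeideal Q R" if "Q \<in> W" for Q using that S(2) unfolding vset_def by blast
  then have idl: "ideal Q R" if "Q \<in> W" for Q using that primeideal.axioms(1) by blast
  have "ideal P R" unfolding P_def using idl W0 by (rule i_Intersect)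
  then interpret P: ideal P R .
  have clo: "closedin (subtopology (sspec R I) W) {Q \<in> W. a \<in> Q}" if a: "a \<in> carrier R" for a
  proof (rule closedin_subset_topspace)
    have e: "{Q \<in> W. a \<in> Q} = vset R (insert a S \<union> I)" unfolding S(2) vset_def by auto
    show "closedin (sspec R I) {Q \<in> W. a \<in> Q}"
      unfolding closedin_sspec e by (rule exI[of _ "insert a S"]) (use S(1) a in simp)
  qed blast
  have "primeideal P R"
  proof (rule primeidealI[OF P.is_ideal is_cring])
    obtain Q where Q: "Q \<in> W" using W0 by blast
    interpret Q: primeideal Q R using pr[OF Q] .
    show "carrier R \<noteq> P"
    proof
      assume "carrier R = P"
      then have "carrier R \<subseteq> Q" unfolding P_def using Q by blast
      then show False using Q.I_notcarr Q.a_subset by blast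
    qed
    fix a b assume ab: "a \<in> carrier R" "b \<in> carrier R" "a \<otimes>\<^bsub>R\<^esub> b \<in> P"
    have "{Q \<in> W. a \<in> Q} \<union> {Q \<in> W. b \<in> Q} = W"
    proof -
      have "a \<in> Q \<or> b \<in> Q" if "Q \<in> W" for Q
        using primeideal.I_prime[OF pr[OF that] ab(1,2)] ab(3) that unfolding P_def by blast
      then show ?thesis by blast
    qed
    then have "{Q \<in> W. a \<in> Q} = W \<or> {Q \<in> W. b \<in> Q} = W"
      using W(2) clo[OF ab(1)] clo[OF ab(2)] unfolding irreducible_space_def top by blast
    then show "a \<in> P \<or> b \<in> P" unfolding P_def by blast
  qed
  moreover have SP: "S \<union> I \<subseteq> P" unfolding P_def S(2) vset_def by blast
  moreover have "W = vset R P"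
  proof
    show "W \<subseteq> vset R P" using pr unfolding vset_def P_def by blast
    show "vset R P \<subseteq> W" using SP unfolding S(2) vset_def by blast
  qed
  ultimately show ?thesis by blast
qed

lemma irreducible_vset:
  assumes P: "primeideal P R" shows "irreducible_space (sspec R P)"
  unfolding irreducible_space_def topspace_sspec
proof (intro conjI allI impI)
  have PV: "P \<in> vset R P" using P by (simp add: vset_def)
  then show "vset R P \<noteq> {}" by blast
  have full: "C = vset R P" if "closedin (sspec R P) C" "P \<in> C" for C
    using that unfolding closedin_sspec vset_def by auto
  fix A B assume "closedin (sspec R P) A \<and> closedin (sspec R P) B \<and> A \<union> B = vset R P"
  then show "A = vset R P \<or> B = vset R P" using full PV by blast
qed

lemma vset_subset_iff: "primeideal P R \<Longrightarrow> vset R P \<subseteq> vset R Q \<longleftrightarrow> Q \<subseteq> P"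
  unfolding vset_def by auto

lemma mpoly_ring_simps:
  "monoid.mult (mpoly_ring N) = (*)" "add (mpoly_ring N) = (+)" "one (mpoly_ring N) = 1"
  "zero (mpoly_ring N) = (0 :: 'a::comm_ring_1 mpoly)"
  by (simp_all add: mpoly_ring_def)

lemma prime_ideal_lift:
  fixes P :: "'a::comm_ring_1 mpoly set"
  assumes "primeideal P (mpoly_ring N)"
  shows "prime_ideal {p. retract N p \<in> P}"
proof -
  interpret P: primeideal P "mpoly_ring N" by fact
  have sub: "P \<subseteq> mpolys {..<N}" using P.a_subset by (simp add: carrier_mpoly_ring)
  show ?thesis
  proof
    show "0 \<in> {p. retract N p \<in> P}" using additive_subgroup.zero_closed[OF P.additive_subgroup_axioms] by (simp add: mpoly_ring_simps)
    show "x + y \<in> {p. retract N p \<in> P}" if "x \<in> {p. retract N p \<in> P}" "y \<in> {p. retract N p \<in> P}" for x y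
      using that additive_subgroup.a_closed[OF P.additive_subgroup_axioms] by (simp add: retract_add mpoly_ring_simps)
    show "r * x \<in> {p. retract N p \<in> P}" if "x \<in> {p. retract N p \<in> P}" for r x
      using that P.I_l_closed[of "retract N x" "retract N r"] retract_mpolys[of N r]
      by (simp add: retract_mult mpoly_ring_simps carrier_mpoly_ring)
    show "1 \<notin> {p. retract N p \<in> P}"
      using P.one_imp_carrier P.I_notcarr by (auto simp: mpoly_ring_simps)
    show "x \<in> {p. retract N p \<in> P} \<or> y \<in> {p. retract N p \<in> P}" if "x * y \<in> {p. retract N p \<in> P}" for x y
      using that P.I_prime[of "retract N x" "retract N y"] retract_mpolys[of N x] retract_mpolys[of N y]
      by (simp add: retract_mult mpoly_ring_simps carrier_mpoly_ring)
  qed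
qed

lemma ideal_mpoly_ringI:
  fixes I :: "'a::comm_ring_1 mpoly set"
  assumes "I \<subseteq> mpolys {..<N}" "0 \<in> I" "\<And>p q. p \<in> I \<Longrightarrow> q \<in> I \<Longrightarrow> p + q \<in> I"
    "\<And>p q. p \<in> I \<Longrightarrow> q \<in> mpolys {..<N} \<Longrightarrow> q * p \<in> I"
  shows "ideal I (mpoly_ring N)"
proof -
  interpret R: cring "mpoly_ring N :: 'a mpoly ring" by (rule cring_mpoly_ring)
  have neg: "- x \<in> I" "\<ominus>\<^bsub>mpoly_ring N\<^esub> x = - x" if x: "x \<in> I" for x
  proof -
    have "- 1 * x \<in> I" using assms(4)[OF x, of "- 1"] mpolys.uminus[OF mpolys.one] by blast
    then show "- x \<in> I" by simp
    then show "\<ominus>\<^bsub>mpoly_ring N\<^esub> x = - x"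
      using x assms(1) by (intro R.minus_equality) (auto simp: mpoly_ring_simps carrier_mpoly_ring)
  qed
  show ?thesis
  proof (rule idealI[OF R.ring_axioms])
    show "subgroup I (add_monoid (mpoly_ring N))"
      using assms(1-3) neg by (intro R.add.subgroupI) (auto simp: mpoly_ring_simps carrier_mpoly_ring)
  qed (use assms(4) in \<open>auto simp: mpoly_ring_simps carrier_mpoly_ring mult.commute\<close>)
qed

lemma primeideal_subset: "primeideal P (mpoly_ring N) \<Longrightarrow> P \<subseteq> mpolys {..<N}"
  and primeideal_zero: "primeideal P (mpoly_ring N) \<Longrightarrow> 0 \<in> P"
  for P :: "'a::comm_ring_1 mpoly set"
  using additive_subgroup.a_subset[OF ideal.axioms(1)[OF primeideal.axioms(1)], of P "mpoly_ring N"]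
    additive_subgroup.zero_closed[OF ideal.axioms(1)[OF primeideal.axioms(1)], of P "mpoly_ring N"]
  by (simp_all add: carrier_mpoly_ring mpoly_ring_simps)

lemma primeideal_contract:
  fixes Q :: "'a::comm_ring_1 mpoly set"
  assumes "prime_ideal Q" shows "primeideal (Q \<inter> mpolys {..<N}) (mpoly_ring N)"
proof -
  interpret Q: prime_ideal Q by fact
  interpret R: cring "mpoly_ring N :: 'a mpoly ring" by (rule cring_mpoly_ring)
  have "ideal (Q \<inter> mpolys {..<N}) (mpoly_ring N)" by (rule ideal_mpoly_ringI) auto
  then show ?thesis
  proof (rule primeidealI[OF _ R.is_cring])
    show "carrier (mpoly_ring N) \<noteq> Q \<inter> mpolys {..<N}"
    proof
      assume eq: "carrier (mpoly_ring N) = Q \<inter> mpolys {..<N}"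
      have "(1 :: 'a mpoly) \<in> carrier (mpoly_ring N)" by (simp add: carrier_mpoly_ring)
      then show False unfolding eq using Q.one by blast
    qed
    show "a \<in> Q \<inter> mpolys {..<N} \<or> b \<in> Q \<inter> mpolys {..<N}"
      if "a \<in> carrier (mpoly_ring N)" "b \<in> carrier (mpoly_ring N)"
        "a \<otimes>\<^bsub>mpoly_ring N\<^esub> b \<in> Q \<inter> mpolys {..<N}" for a b
      using that Q.prime[of a b] by (auto simp: mpoly_ring_simps carrier_mpoly_ring)
  qed
qed

text \<open>A chain of irreducible closed subsets is a chain of their generic points in the opposite order. With
\<open>indep_of_chain\<close> its length is at most the number of independent coordinates at the smallest of them.\<close>

lemma krull_dim_le:
  fixes P :: "'a::field mpoly set"
  assumes P: "primeideal P (mpoly_ring N)"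
    and max: "\<And>J. J \<subseteq> {..<N} \<Longrightarrow> indep_mod {p. retract N p \<in> P} J \<Longrightarrow> card J \<le> r"
  shows "krull_dim (sspec (mpoly_ring N) P) \<le> enat r"
  unfolding krull_dim_def
proof (rule Sup_least, clarify)
  fix l and W :: "nat \<Rightarrow> 'a mpoly set set"
  let ?R = "mpoly_ring N :: 'a mpoly ring"
  assume W: "\<forall>i\<le>l. closedin (sspec ?R P) (W i) \<and> irreducible_space (subtopology (sspec ?R P) (W i))"
    "\<forall>i<l. W i \<subset> W (Suc i)"
  have "\<exists>Q. primeideal Q ?R \<and> P \<subseteq> Q \<and> W i = vset ?R Q" if "i \<le> l" for i
    using irreducible_closed_generic[OF cring_mpoly_ring] W(1) that by blast
  then obtain G where G: "\<And>i. i \<le> l \<Longrightarrow> primeideal (G i) ?R \<and> P \<subseteq> G i \<and> W i = vset ?R (G i)" by metis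
  define q where "q i = {p. retract N p \<in> G (l - i)}" for i
  have "\<exists>J\<subseteq>{..<N}. indep_mod (q 0) J \<and> card J = l"
  proof (rule indep_of_chain)
    show "prime_ideal (q i)" for i unfolding q_def using G[of "l - i"] by (intro prime_ideal_lift) simp
    show "q i \<subseteq> q (Suc i) \<and> (\<exists>x\<in>mpolys {..<N}. x \<in> q (Suc i) \<and> x \<notin> q i)" if i: "i < l" for i
    proof -
      let ?k = "l - Suc i"
      have k: "Suc ?k = l - i" "?k < l" using i by auto
      have g: "primeideal (G ?k) ?R" "primeideal (G (Suc ?k)) ?R" using G[of ?k] G[of "Suc ?k"] k by auto
      have "?k \<le> l" "Suc ?k \<le> l" using k by auto
      then have "W ?k = vset ?R (G ?k)" "W (Suc ?k) = vset ?R (G (Suc ?k))"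
        using G[of ?k] G[of "Suc ?k"] by blast+
      then have "vset ?R (G ?k) \<subset> vset ?R (G (Suc ?k))" using W(2) k(2) by metis
      then have s: "G (Suc ?k) \<subset> G ?k"
        using vset_subset_iff[OF g(1), of "G (Suc ?k)"] vset_subset_iff[OF g(2), of "G ?k"] by blast
      then obtain x where x: "x \<in> G ?k" "x \<notin> G (Suc ?k)" by blast
      have "G ?k \<subseteq> mpolys {..<N}"
        using g(1) by (rule primeideal_subset)
      then have "x \<in> mpolys {..<N}" using x(1) by blast
      moreover from this have "x \<in> q (Suc i)" "x \<notin> q i"
        unfolding q_def k(1)[symmetric] using x retract_id[of x N] by auto
      moreover have "q i \<subseteq> q (Suc i)" unfolding q_def k(1)[symmetric] using s by blast
      ultimately show ?thesis by blast
    qed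
  qed
  then obtain J where J: "J \<subseteq> {..<N}" "indep_mod (q 0) J" "card J = l" by blast
  have "{p. retract N p \<in> P} \<subseteq> q 0" unfolding q_def using G[of l] by auto
  then have "indep_mod {p. retract N p \<in> P} J" using J(2) unfolding indep_mod_def by blast
  then show "enat l \<le> enat r" using max J by auto
qed

text \<open>The closure of \<open>A\<close> contains all primes above \<open>Q\<close>, so a chain of primes that starts at \<open>Q\<close> gives a chain of irreducible closed
subsets of this closure.\<close>

lemma krull_dim_ge:
  fixes Q :: "'a::alg_closed_field mpoly set"
  assumes Q: "primeideal Q (mpoly_ring N)" "I \<subseteq> Q" "Q \<in> A"
    and J: "J \<subseteq> {..<N}" "indep_mod {p. retract N p \<in> Q} J"
  shows "enat (card J) \<le> krull_dim (subtopology (sspec (mpoly_ring N) I) (sspec (mpoly_ring N) I closure_of A))"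
    (is "_ \<le> krull_dim (subtopology ?T ?C)")
proof -
  let ?R = "mpoly_ring N :: 'a mpoly ring" and ?l = "card J"
  have QN: "Q \<subseteq> mpolys {..<N}"
    using Q(1) by (rule primeideal_subset)
  obtain q where q: "q 0 = {p. retract N p \<in> Q}" "\<forall>i\<le>?l. prime_ideal (q i)"
    "\<forall>i<?l. q i \<subseteq> q (Suc i) \<and> (\<exists>x\<in>mpolys {..<N}. x \<in> q (Suc i) \<and> x \<notin> q i)"
    using ex_prime_chain[OF prime_ideal_lift[OF Q(1)] _ J] by (auto simp: retract_retract)
  define G where "G i = q i \<inter> mpolys {..<N}" for i
  have G: "primeideal (G i) ?R" if "i \<le> ?l" for i
    unfolding G_def using q(2) that by (intro primeideal_contract) simp
  have mono: "Q \<subseteq> G i" if "i \<le> ?l" for i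
    using that
  proof (induction i)
    case 0
    have "retract N x = x" if "x \<in> Q" for x using that QN by (intro retract_id) blast
    then show ?case unfolding G_def q(1) using QN by auto
  next
    case (Suc i)
    then have "i < ?l" by simp
    then show ?case using Suc.IH q(3) unfolding G_def by (meson Int_mono dual_order.trans less_imp_le_nat order_refl)
  qed
  have "Q \<in> topspace ?T" unfolding topspace_sspec vset_def using Q by blast
  then have QC: "Q \<in> ?C" using closure_of_subset_Int[of ?T A] Q(3) by blast
  obtain S where S: "?C = vset ?R (S \<union> I)" using closedin_closure_of[of ?T A] unfolding closedin_sspec by blast
  have CV: "vset ?R P \<subseteq> ?C" if "Q \<subseteq> P" for P
    using QC that unfolding S vset_def by auto
  define W where "W i = vset ?R (G (?l - i))" for i
  have "\<forall>i\<le>?l. closedin (subtopology ?T ?C) (W i) \<and> irreducible_space (subtopology (subtopology ?T ?C) (W i))"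
  proof (intro allI impI conjI)
    fix i assume "i \<le> ?l"
    let ?P = "G (?l - i)"
    have P: "primeideal ?P ?R" "Q \<subseteq> ?P" using G mono by auto
    have WC: "W i \<subseteq> ?C" unfolding W_def using CV[OF P(2)] .
    have IP: "I \<subseteq> ?P" using Q(2) P(2) by blast
    show "closedin (subtopology ?T ?C) (W i)"
      using closedin_vset[OF P(1) IP] WC unfolding W_def by (rule closedin_subset_topspace)
    have "subtopology (subtopology ?T ?C) (W i) = subtopology ?T (?C \<inter> W i)"
      by (rule subtopology_subtopology)
    also have "?C \<inter> W i = vset ?R ?P" using WC unfolding W_def by blast
    also have "subtopology ?T (vset ?R ?P) = sspec ?R ?P" using IP by (rule subtopology_vset)
    finally show "irreducible_space (subtopology (subtopology ?T ?C) (W i))"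
      using irreducible_vset[OF P(1)] by simp
  qed
  moreover have "\<forall>i<?l. W i \<subset> W (Suc i)"
  proof (intro allI impI)
    fix i assume i: "i < ?l"
    let ?k = "?l - Suc i"
    have k: "Suc ?k = ?l - i" "?k < ?l" using i by auto
    have "G ?k \<subset> G (Suc ?k)" using q(3) k(2) unfolding G_def by blast
    moreover have "primeideal (G ?k) ?R" "primeideal (G (Suc ?k)) ?R"
      using G[of ?k] G[of "Suc ?k"] k by auto
    ultimately have "vset ?R (G (Suc ?k)) \<subset> vset ?R (G ?k)"
      using vset_subset_iff[of "G ?k" ?R "G (Suc ?k)"] vset_subset_iff[of "G (Suc ?k)" ?R "G ?k"]
      by blast
    then show "W i \<subset> W (Suc i)" unfolding W_def k(1)[symmetric] .
  qed
  ultimately show ?thesis unfolding krull_dim_def by (intro Sup_upper) blast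
qed

section \<open>Ranks of skew-symmetric families of vectors\<close>

context vector_space
begin

lemma dim_mono_finite:
  assumes "V \<subseteq> span W" "finite W" shows "dim V \<le> dim W"
proof -
  obtain B where B: "B \<subseteq> W" "independent B" "W \<subseteq> span B" "card B = dim W" by (rule basis_exists)
  have "span W \<subseteq> span B" using span_minimal[OF B(3) subspace_span] .
  then have "V \<subseteq> span B" using assms(1) by blast
  moreover have "finite B" using B(1) assms(2) finite_subset by blast
  ultimately show ?thesis using dim_le_card B(4) by metis
qed

text \<open>Submodularity of dimension, in the form in which \<open>L\<close> lies in both spans.\<close>

lemma dim_Un_overlap:
  assumes fin: "finite W" "finite T" and L: "L \<subseteq> T" "L \<subseteq> span W"
  shows "dim (W \<union> T) + dim L \<le> dim W + dim T"
proof -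
  obtain A where A: "A \<subseteq> L" "independent A" "L \<subseteq> span A" "card A = dim L" by (rule basis_exists)
  obtain B where B: "A \<subseteq> B" "B \<subseteq> T" "independent B" "T \<subseteq> span B"
    using maximal_independent_subset_extend[of A T] A(1,2) L(1) by blast
  obtain D where D: "D \<subseteq> W" "independent D" "W \<subseteq> span D" "card D = dim W" by (rule basis_exists)
  have fins: "finite B" "finite D" "finite A"
    using finite_subset[OF B(2) fin(2)] finite_subset[OF D(1) fin(1)]
      finite_subset[OF B(1) finite_subset[OF B(2) fin(2)]] by simp_all
  have WD: "span W \<subseteq> span D" using span_minimal[OF D(3) subspace_span] .
  let ?S = "D \<union> (B - A)"
  have "D \<subseteq> span ?S" using span_superset[of ?S] by blast
  then have DS: "span D \<subseteq> span ?S" by (rule span_minimal) (rule subspace_span)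
  then have "A \<subseteq> span ?S" using A(1) L(2) WD by blast
  moreover have "B - A \<subseteq> span ?S" using span_superset[of ?S] by blast
  ultimately have "B \<subseteq> span ?S" by blast
  then have "span B \<subseteq> span ?S" by (rule span_minimal) (rule subspace_span)
  then have "W \<union> T \<subseteq> span ?S" using B(4) D(3) DS by blast
  then have "dim (W \<union> T) \<le> card ?S" using fins by (intro dim_le_card) auto
  also have "\<dots> \<le> card D + card (B - A)" by (rule card_Un_le)
  also have "card (B - A) = card B - card A" using B(1) fins(3) by (rule card_Diff_subset[rotated])
  finally have "dim (W \<union> T) \<le> dim W + (card B - dim L)" using D(4) A(4) by simp
  moreover have "card A \<le> card B" using B(1) fins(1) by (rule card_mono[rotated])
  moreover have "card B = dim T" using B(2,4,3) by (rule basis_card_eq_dim)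
  ultimately show ?thesis using A(4) by linarith
qed

lemma dim_Un_le:
  assumes "finite W" "finite T" shows "dim (W \<union> T) \<le> dim W + dim T"
  using dim_Un_overlap[OF assms, of "{}"] by simp

text \<open>Modulo \<open>span K\<close> the family \<open>\<theta>\<close> is a skew-symmetric matrix of vectors with zero diagonal, and the claim is Shearer's
inequality for the rank function: every entry occurs, up to sign, in two rows. Let \<open>L i\<close> be the part of row \<open>i\<close> to the left of the
diagonal. These parts span everything modulo \<open>K\<close>, so the dimension is at most \<open>dim K + (\<Sum>i. dim (L i))\<close>. Adding the
rows one by one, row \<open>i\<close> contributes at most \<open>dim (row i) - dim (L i)\<close>, since \<open>L i\<close> is already contained in the
span of the earlier rows. The sum of both bounds is the claim.\<close>

lemma skew_rank_bound:
  fixes \<theta> :: "nat \<Rightarrow> nat \<Rightarrow> 'b"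
  assumes fin: "finite K"
    and skew: "\<And>i j. i < n \<Longrightarrow> j < n \<Longrightarrow> \<theta> i j + \<theta> j i \<in> span K"
    and diag: "\<And>i. i < n \<Longrightarrow> \<theta> i i \<in> span K"
  shows "2 * dim (K \<union> (\<Union>i<n. \<theta> i ` {..<n})) \<le> 2 * dim K + (\<Sum>i<n. dim (\<theta> i ` {..<n}))"
proof -
  define L where "L i = \<theta> i ` {..<i}" for i
  define T where "T i = \<theta> i ` {..<n}" for i
  have flip: "\<theta> i j \<in> span W" if "i < n" "j < n" "K \<subseteq> W" "\<theta> j i \<in> W" for i j W
  proof -
    have "\<theta> i j + \<theta> j i \<in> span W" using skew[OF that(1,2)] span_mono[OF that(3)] by blast
    moreover have "\<theta> j i \<in> span W" using that(4) by (rule span_base)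
    ultimately show ?thesis by (metis add_diff_cancel_right' span_diff)
  qed
  have first: "dim (K \<union> (\<Union>i<m. L i)) \<le> dim K + (\<Sum>i<m. dim (L i))" for m
  proof (induction m)
    case (Suc m)
    have "K \<union> (\<Union>i<Suc m. L i) = (K \<union> (\<Union>i<m. L i)) \<union> L m" by (auto simp: less_Suc_eq)
    then have "dim (K \<union> (\<Union>i<Suc m. L i)) \<le> dim (K \<union> (\<Union>i<m. L i)) + dim (L m)"
      using fin by (simp add: dim_Un_le L_def)
    then show ?case using Suc.IH by simp
  qed simp
  have "dim (K \<union> (\<Union>i<n. T i)) \<le> dim (K \<union> (\<Union>i<n. L i))"
  proof (rule dim_mono_finite)
    let ?W = "K \<union> (\<Union>i<n. L i)"
    have "\<theta> i j \<in> span ?W" if ij: "i < n" "j < n" for i j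
    proof (cases i j rule: linorder_cases)
      case less
      then have "\<theta> j i \<in> ?W" using ij by (auto simp: L_def)
      then show ?thesis using flip[OF ij, of ?W] by blast
    next
      case equal
      then show ?thesis using diag[OF ij(1)] span_mono[of K ?W] by blast
    next
      case greater
      then have "\<theta> i j \<in> ?W" using ij by (auto simp: L_def)
      then show ?thesis by (rule span_base)
    qed
    moreover have "K \<subseteq> span ?W" using span_superset[of ?W] by blast
    ultimately show "K \<union> (\<Union>i<n. T i) \<subseteq> span ?W" unfolding T_def by blast
  qed (use fin in \<open>auto simp: L_def\<close>)
  moreover have second: "dim (K \<union> (\<Union>i<m. T i)) + (\<Sum>i<m. dim (L i)) \<le> dim K + (\<Sum>i<m. dim (T i))" if "m \<le> n" for m
    using that
  proof (induction m)
    case (Suc m)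
    let ?W = "K \<union> (\<Union>i<m. T i)"
    have "K \<union> (\<Union>i<Suc m. T i) = ?W \<union> T m" by (auto simp: less_Suc_eq)
    moreover have "dim (?W \<union> T m) + dim (L m) \<le> dim ?W + dim (T m)"
    proof (rule dim_Un_overlap)
      show "L m \<subseteq> T m" using Suc.prems by (auto simp: L_def T_def)
      have "\<theta> m j \<in> span ?W" if "j < m" for j
      proof (rule flip)
        have "\<theta> j m \<in> T j" using Suc.prems unfolding T_def by simp
        then show "\<theta> j m \<in> ?W" using that by blast
      qed (use that Suc.prems in auto)
      then show "L m \<subseteq> span ?W" unfolding L_def by blast
    qed (use fin in \<open>auto simp: T_def\<close>)
    ultimately show ?case using Suc by simp
  qed simp
  moreover have "dim (K \<union> (\<Union>i<n. T i)) + (\<Sum>i<n. dim (L i)) \<le> dim K + (\<Sum>i<n. dim (T i))"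
    using second[of n] by simp
  moreover have "dim (K \<union> (\<Union>i<n. L i)) \<le> dim K + (\<Sum>i<n. dim (L i))" using first[of n] .
  ultimately have "2 * dim (K \<union> (\<Union>i<n. T i)) \<le> 2 * dim K + (\<Sum>i<n. dim (T i))" by linarith
  then show ?thesis unfolding T_def .
qed

end

section \<open>Differentials of the coordinates\<close>

interpretation fs: vector_space "\<lambda>(c::'a::field) (f::'b \<Rightarrow> 'a) x. c * f x"
  by unfold_locales (auto simp: fun_eq_iff algebra_simps)

lemma sum_fun_apply: "(\<Sum>i\<in>I. f i) d = (\<Sum>i\<in>I. f i d)" for f :: "'i \<Rightarrow> 'b \<Rightarrow> 'a::comm_monoid_add"
  by (induction I rule: infinite_finite_induct) simp_all

text \<open>The differential of the coordinate \<open>i\<close> at the point \<open>a\<close>, as a linear form on the tangent space of the variety of \<open>P\<close>. It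
is extended by \<open>0\<close> to all vectors, so that all differentials live in one vector space of functions.\<close>

definition dcoord :: "'a::idom mpoly set \<Rightarrow> nat \<Rightarrow> (nat \<Rightarrow> 'a) \<Rightarrow> nat \<Rightarrow> (nat \<Rightarrow> 'a) \<Rightarrow> 'a" where
  "dcoord P N a i = (\<lambda>d. if \<forall>f\<in>mpolys {..<N}. f \<in> P \<longrightarrow> dir_deriv N a d f = 0 then d i else 0)"

context ac_prime
begin

text \<open>At a general point of the variety the linear matroid of the differentials of the coordinates has full rank, and
every linearly independent set of differentials comes from algebraically independent coordinates. The point has to avoid the zeros of
finitely many polynomials: the one from the extension of tangent vectors, and for every dependent set of coordinates a nonvanishing partial
derivative of one relation, which keeps the differentials of this set linearly dependent.\<close>

lemma cotangent_ranks:
  "\<exists>a. vanishes P {..<N} a \<and>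
    (\<forall>J\<subseteq>{..<N}. indep_mod P J \<longrightarrow> card J \<le> fs.dim (dcoord P N a ` {..<N})) \<and>
    (\<forall>A\<subseteq>{..<N}. \<exists>J\<subseteq>A. indep_mod P J \<and> card J = fs.dim (dcoord P N a ` A))"
proof -
  obtain J where J: "J \<subseteq> {..<N}" "\<forall>J'\<subseteq>{..<N}. indep_mod P J' \<longrightarrow> card J' \<le> card J"
    and ex: "\<exists>g\<in>mpolys {..<N}. g \<notin> P \<and> (\<forall>a. vanishes P {..<N} a \<and> ev a g \<noteq> 0 \<longrightarrow>
      (\<forall>d'. \<exists>d. (\<forall>i\<in>J. d i = d' i) \<and> (\<forall>f\<in>mpolys {..<N}. f \<in> P \<longrightarrow> dir_deriv N a d f = 0)))"
    using tangent_extension[OF order_refl, of N] by (elim exE conjE) (rule that)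
  obtain g1 where g1: "g1 \<in> mpolys {..<N}" "g1 \<notin> P"
    "\<forall>a. vanishes P {..<N} a \<and> ev a g1 \<noteq> 0 \<longrightarrow>
      (\<forall>d'. \<exists>d. (\<forall>i\<in>J. d i = d' i) \<and> (\<forall>f\<in>mpolys {..<N}. f \<in> P \<longrightarrow> dir_deriv N a d f = 0))"
    using ex by (elim bexE conjE) (rule that)
  define Dp where "Dp = {A. A \<subseteq> {..<N} \<and> \<not> indep_mod P A}"
  have "\<forall>A\<in>Dp. \<exists>f l. f \<in> mpolys A \<and> f \<in> P \<and> l \<in> A \<and> partial l f \<notin> P"
    using separable_relation unfolding Dp_def by blast
  then obtain F l where Fl: "\<And>A. A \<in> Dp \<Longrightarrow> F A \<in> mpolys A \<and> F A \<in> P \<and> l A \<in> A \<and> partial (l A) (F A) \<notin> P"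
    by metis
  \<comment> \<open>Where \<open>g2\<close> does not vanish, every dependent set of coordinates has dependent differentials.\<close>
  define g2 where "g2 = (\<Prod>A\<in>Dp. partial (l A) (F A))"
  have DpN: "A \<subseteq> {..<N}" if "A \<in> Dp" for A using that unfolding Dp_def by blast
  have finDp: "finite Dp" unfolding Dp_def by simp
  have "g2 \<in> mpolys {..<N}"
    unfolding g2_def by (intro mpolys.prod partial_mpolys) (use Fl DpN in \<open>blast intro: mpolys_mono\<close>)
  moreover have "g2 \<notin> P" unfolding g2_def by (rule prod_notin) (use Fl in blast)
  ultimately have "g1 * g2 \<in> mpolys {..<N}" "g1 * g2 \<notin> P" using g1 mult_notin by blast+
  then obtain a where a: "vanishes P {..<N} a" "ev a (g1 * g2) \<noteq> 0"
    using nullstellensatz[of "{..<N}"] by blast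
  have a1: "ev a g1 \<noteq> 0" and "ev a g2 \<noteq> 0" using a(2) by (auto simp: ev.eval_mult)
  have evprod: "ev a (prod f I) = (\<Prod>i\<in>I. ev a (f i))" for f :: "nat set \<Rightarrow> 'a mpoly" and I
    by (induction I rule: infinite_finite_induct) (simp_all add: ev.eval_mult)
  have a2: "ev a (partial (l A) (F A)) \<noteq> 0" if "A \<in> Dp" for A
    using \<open>ev a g2 \<noteq> 0\<close> that finDp unfolding g2_def evprod by simp
  let ?w = "dcoord P N a"
  have rel: "(\<Sum>i<N. ev a (partial i f) * ?w i d) = 0" if "f \<in> mpolys {..<N}" "f \<in> P" for f d
  proof (cases "\<forall>f\<in>mpolys {..<N}. f \<in> P \<longrightarrow> dir_deriv N a d f = 0")
    case True
    then show ?thesis using that by (simp add: dcoord_def dir_deriv_def)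
  next
    case False
    then have "?w i d = 0" for i unfolding dcoord_def by (rule if_not_P)
    then show ?thesis by simp
  qed
  have "card J' \<le> fs.dim (?w ` {..<N})" if J': "J' \<subseteq> {..<N}" "indep_mod P J'" for J'
  proof -
    have finJ: "finite J" using J(1) finite_subset by blast
    \<comment> \<open>Tangent vectors dual to the coordinates in \<open>J\<close> exist, so their differentials are linearly independent.\<close>
    have dual: "\<exists>d. \<forall>i\<in>J. ?w i d = (if i = k then 1 else 0)" for k
    proof -
      obtain d where d: "\<forall>i\<in>J. d i = (if i = k then 1 else 0)" "\<forall>f\<in>mpolys {..<N}. f \<in> P \<longrightarrow> dir_deriv N a d f = 0"
        using g1(3)[rule_format, OF conjI[OF a(1) a1], of "\<lambda>i. if i = k then 1 else 0"]
        by (elim exE conjE) (rule that)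
      have "?w i d = d i" for i unfolding dcoord_def using d(2) by (rule if_P)
      then have "\<forall>i\<in>J. ?w i d = (if i = k then 1 else 0)" using d(1) by simp
      then show ?thesis by blast
    qed
    have inj: "inj_on ?w J"
    proof (rule inj_onI)
      fix i k assume ik: "i \<in> J" "k \<in> J" "?w i = ?w k"
      obtain d where "\<forall>i\<in>J. ?w i d = (if i = k then 1 else 0)" using dual by blast
      then show "i = k" using ik by (metis zero_neq_one)
    qed
    have zero: "f x = 0" if z: "(\<Sum>x\<in>?w ` J. (\<lambda>d. f x * x d)) = 0" and x: "x \<in> ?w ` J" for f x
    proof -
      obtain k where k: "k \<in> J" "x = ?w k" using x by blast
      obtain d where d: "\<forall>i\<in>J. ?w i d = (if i = k then 1 else 0)" using dual by blast
      have "0 = (\<Sum>x\<in>?w ` J. (\<lambda>d. f x * x d)) d" using z by simp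
      also have "\<dots> = (\<Sum>x\<in>?w ` J. f x * x d)" by (simp add: sum_fun_apply)
      also have "\<dots> = (\<Sum>i\<in>J. f (?w i) * ?w i d)" by (simp add: sum.reindex[OF inj])
      also have "\<dots> = (\<Sum>i\<in>J. if i = k then f (?w k) else 0)" by (rule sum.cong) (use d in auto)
      also have "\<dots> = f x" using k finJ by simp
      finally show "f x = 0" by simp
    qed
    have "fs.independent (?w ` J)"
      apply (rule fs.independent_if_scalars_zero)
      subgoal using finJ by simp
      subgoal premises p for f x by (rule zero[of f x, OF p])
      done
    then have "card (?w ` J) = fs.dim (?w ` J)" by (simp add: fs.dim_eq_card_independent)
    also have "\<dots> \<le> fs.dim (?w ` {..<N})"
      by (rule fs.dim_mono_finite) (use J(1) fs.span_superset[of "?w ` {..<N}"] in blast)+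
    finally have "card J \<le> fs.dim (?w ` {..<N})" unfolding card_image[OF inj] .
    moreover have "card J' \<le> card J" using J(2) J' by blast
    ultimately show ?thesis by (rule order_trans[rotated])
  qed
  moreover have "\<exists>J\<subseteq>A. indep_mod P J \<and> card J = fs.dim (?w ` A)" if A: "A \<subseteq> {..<N}" for A
  proof -
    obtain B where B: "B \<subseteq> ?w ` A" "fs.independent B" "?w ` A \<subseteq> fs.span B" "card B = fs.dim (?w ` A)"
      by (rule fs.basis_exists)
    obtain J where J: "J \<subseteq> A" "inj_on ?w J" "B = ?w ` J" using B(1) subset_image_inj[of B ?w A] by metis
    have finJ: "finite J" using J(1) A finite_subset by (metis finite_lessThan)
    have "indep_mod P J"
    proof (rule ccontr)
      assume "\<not> indep_mod P J"
      then have JD: "J \<in> Dp" unfolding Dp_def using J(1) A by blast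
      note f = Fl[OF JD]
      define u where "u v = ev a (partial (the_inv_into J ?w v) (F J))" for v
      have "(\<Sum>v\<in>B. (\<lambda>d. u v * v d)) = 0"
      proof
        fix d
        have fN: "F J \<in> mpolys {..<N}" using f DpN[OF JD] by (blast intro: mpolys_mono)
        have "(\<Sum>v\<in>B. (\<lambda>d. u v * v d)) d = (\<Sum>v\<in>B. u v * v d)" by (simp add: sum_fun_apply)
        also have "\<dots> = (\<Sum>i\<in>J. ev a (partial i (F J)) * ?w i d)"
          unfolding J(3) by (simp add: sum.reindex[OF J(2)] u_def the_inv_into_f_f[OF J(2)])
        also have "\<dots> = (\<Sum>i<N. ev a (partial i (F J)) * ?w i d)"
        proof (rule sum.mono_neutral_left)
          show "\<forall>i\<in>{..<N} - J. ev a (partial i (F J)) * ?w i d = 0"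
          proof
            fix i assume "i \<in> {..<N} - J"
            then have "partial i (F J) = 0" using f partial_free[of "F J" J i] by blast
            then show "ev a (partial i (F J)) * ?w i d = 0" by simp
          qed
        qed (use DpN[OF JD] in auto)
        also have "\<dots> = 0" using rel[OF fN] f by blast
        finally show "(\<Sum>v\<in>B. (\<lambda>d. u v * v d)) d = 0 d" by simp
      qed
      moreover have "?w (l J) \<in> B" using J(3) f by blast
      ultimately have "u (?w (l J)) = 0"
        using fs.independentD[OF B(2) _ order_refl, of u "?w (l J)"] finJ J(3) by blast
      then show False using a2[OF JD] the_inv_into_f_f[OF J(2)] f unfolding u_def by metis
    qed
    then show ?thesis using J(1) card_image[OF J(2)] B(4) J(3) by auto
  qed
  ultimately show ?thesis using a(1) by blast
qed

end

section \<open>The Brascamp--Lieb condition for coordinate projections\<close>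

definition affine_space :: "nat \<Rightarrow> 'k::field affine_scheme" where
  "affine_space n = \<lparr>nvars = n, defideal = {0}\<rparr>"

lemma affine_space_simps [simp]: "nvars (affine_space n) = n" "defideal (affine_space n) = {0}"
  by (simp_all add: affine_space_def)

lemma affine_variety_affine_space: "affine_variety (affine_space n :: 'k::field affine_scheme)"
proof -
  interpret R: cring "mpoly_ring n :: 'k mpoly ring" by (rule cring_mpoly_ring)
  show ?thesis using R.zeroideal by (simp add: affine_variety_def mpoly_ring_simps)
qed

lemma rational_points_affine_space: "rational_points (affine_space n) = {..<n} \<rightarrow>\<^sub>E UNIV"
  by (simp add: rational_points_def)

lemma affine_morphism_coordinates:
  assumes "affine_variety \<X>" "\<And>i. i < n \<Longrightarrow> \<sigma> i < nvars \<X>"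
  shows "affine_morphism \<X> (affine_space n) (\<lambda>i. mvar (\<sigma> i))"
proof -
  interpret ideal "defideal \<X>" "mpoly_ring (nvars \<X>)" using assms(1) by (simp add: affine_variety_def)
  have "0 \<in> defideal \<X>"
    using additive_subgroup.zero_closed[OF additive_subgroup_axioms] by (simp add: mpoly_ring_simps)
  then show ?thesis
    using assms(2) by (simp add: affine_morphism_def carrier_mpoly_ring mpoly_subst_eq)
qed

lemma map_points_coordinates:
  "map_points (affine_space n) (\<lambda>i. mvar (\<sigma> i)) x = (\<lambda>i\<in>{..<n}. x (\<sigma> i))"
  by (simp add: map_points_def)

lemma map_to_ac_mvar: "Poly_Mapping.map to_ac (mvar i) = mvar i"
  by (simp add: mvar_def)

lemma space_of_sspec: "space_of \<X> = sspec (mpoly_ring (nvars \<X>)) (defideal \<X>)"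
  by (simp add: space_of_def)

lemma prime_ideal_preimage:
  assumes "prime_ideal P" shows "prime_ideal {q. mpoly_subst f q \<in> P}"
proof -
  interpret prime_ideal P by fact
  show ?thesis
    by standard (auto simp: mpoly_subst_eq msubst.eval_add msubst.eval_mult dest: prime)
qed

lemma msubst_rename_mpolys:
  assumes "p \<in> mpolys J" shows "mpoly_subst (\<lambda>i. mvar (\<sigma> i)) p \<in> mpolys (\<sigma> ` J)"
  unfolding mpoly_subst_eq
  by (rule msubst.eval_ring_set[OF assms mpolys.ring_set_axioms]) auto

lemma msubst_rename_inj:
  assumes "inj_on \<sigma> J" "p \<in> mpolys J" "mpoly_subst (\<lambda>i. mvar (\<sigma> i)) p = 0"
  shows "p = 0"
proof -
  let ?\<tau> = "the_inv_into J \<sigma>"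
  have "mpoly_subst (\<lambda>i. mvar (?\<tau> i)) (mpoly_subst (\<lambda>i. mvar (\<sigma> i)) p) = p"
    using assms(2)
    by (induction rule: mpolys_induct)
      (simp_all add: mpoly_subst_eq msubst.eval_add msubst.eval_mult the_inv_into_f_f[OF assms(1)])
  then show ?thesis using assms(3) by (simp add: mpoly_subst_eq)
qed

text \<open>For projections to sets of coordinates the Brascamp--Lieb condition compares numbers of algebraically independent
coordinates modulo a prime. The dimension of an irreducible closed set is bounded from above by such a number at its generic point, and the
dimensions of the closures of its images are bounded from below.\<close>

lemma brascamp_lieb_condition_coordinates:
  fixes \<X> :: "'k::field affine_scheme"
  assumes sig: "\<And>j. j < m \<Longrightarrow> inj_on (\<sigma> j) {..<n j}" "\<And>j i. j < m \<Longrightarrow> i < n j \<Longrightarrow> \<sigma> j i < nvars \<X>"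
    and p: "\<And>j. j < m \<Longrightarrow> 0 \<le> p j"
    and sub: "defideal \<X> \<subseteq> mpolys {..<nvars \<X>}"
    and key: "\<And>P J. ac_prime P \<Longrightarrow> Poly_Mapping.map to_ac ` defideal \<X> \<subseteq> P \<Longrightarrow>
      J \<subseteq> {..<nvars \<X>} \<Longrightarrow> indep_mod P J \<Longrightarrow>
      \<exists>Js. (\<forall>j<m. Js j \<subseteq> \<sigma> j ` {..<n j} \<and> indep_mod P (Js j)) \<and>
        real (card J) \<le> (\<Sum>j<m. p j * real (card (Js j)))"
  shows "brascamp_lieb_condition \<X> m (\<lambda>j. affine_space (n j)) (\<lambda>j i. mvar (\<sigma> j i)) p"
  unfolding brascamp_lieb_condition_def
proof (intro allI impI, elim conjE)
  let ?N = "nvars \<X>"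
  let ?R = "mpoly_ring ?N :: 'k alg_closure mpoly ring"
  let ?I = "defideal (base_change \<X>)"
  let ?gen = "Poly_Mapping.map to_ac ` defideal \<X> :: 'k alg_closure mpoly set"
  interpret R: cring ?R by (rule cring_mpoly_ring)
  have space: "space_of (base_change \<X>) = sspec ?R ?I"
    by (simp add: space_of_sspec base_change_def)
  fix Z assume Z: "closedin (space_of (base_change \<X>)) Z"
    "irreducible_space (subtopology (space_of (base_change \<X>)) Z)"
  obtain P0 where P0: "primeideal P0 ?R" "?I \<subseteq> P0" "Z = vset ?R P0"
    using irreducible_closed_generic[OF R.is_cring] Z unfolding space by blast
  define P where "P = {q. retract ?N q \<in> P0}"
  have primeP: "prime_ideal P" unfolding P_def using P0(1) by (rule prime_ideal_lift)
  have acP: "ac_prime P" using primeP by (simp add: ac_prime_def mprime_def)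
  have genC: "?gen \<subseteq> mpolys {..<?N}"
  proof -
    have "keys (Poly_Mapping.map to_ac f) \<subseteq> keys f" for f :: "'k mpoly"
      by (auto simp: in_keys_iff map.rep_eq when_def)
    then show ?thesis using sub unfolding mpolys_def by blast
  qed
  have "?gen \<subseteq> ?I" using R.genideal_self[of ?gen] genC
    by (simp add: base_change_def carrier_mpoly_ring)
  then have gen0: "?gen \<subseteq> P0" using P0(2) by blast
  have genP: "?gen \<subseteq> P"
  proof
    fix x assume x: "x \<in> ?gen"
    then have "retract ?N x = x" using genC by (intro retract_id) blast
    then show "x \<in> P" unfolding P_def using gen0 x by (simp only: mem_Collect_eq) blast
  qed
  obtain J where J: "J \<subseteq> {..<?N}" "indep_mod P J"
    "\<And>J'. J' \<subseteq> {..<?N} \<Longrightarrow> indep_mod P J' \<Longrightarrow> card J' \<le> card J"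
  proof -
    let ?Q = "\<lambda>J. J \<subseteq> {..<?N} \<and> indep_mod P J"
    have "?Q {}" using indep_mod_empty[OF primeP] by simp
    moreover have "\<forall>J. ?Q J \<longrightarrow> card J < Suc ?N"
      using card_mono[of "{..<?N}"] by (auto simp: less_Suc_eq_le)
    ultimately have "\<exists>J. ?Q J \<and> (\<forall>J'. ?Q J' \<longrightarrow> card J' \<le> card J)"
      by (rule ex_has_greatest_nat[of ?Q "{}" card "Suc ?N"])
    then show thesis using that by blast
  qed
  have "subtopology (space_of (base_change \<X>)) Z = sspec ?R P0"
    unfolding space P0(3) using P0(2) by (rule subtopology_vset)
  then have "krull_dim (subtopology (space_of (base_change \<X>)) Z) \<le> enat (card J)"
    using krull_dim_le[OF P0(1), of "card J"] J(3) unfolding P_def by simp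
  then have upper: "ereal_of_enat (krull_dim (subtopology (space_of (base_change \<X>)) Z)) \<le> ereal (real (card J))"
    by (metis ereal_of_enat_le_iff ereal_of_enat_simps(1))
  obtain Js where Js: "\<forall>j<m. Js j \<subseteq> \<sigma> j ` {..<n j} \<and> indep_mod P (Js j)"
    "real (card J) \<le> (\<Sum>j<m. p j * real (card (Js j)))"
    using key[OF acP genP J(1,2)] by blast
  let ?Y = "\<lambda>j. base_change (affine_space (n j) :: 'k affine_scheme)"
  let ?f = "\<lambda>j. base_change_morphism (\<lambda>i. mvar (\<sigma> j i) :: 'k mpoly)"
  let ?D = "\<lambda>j. krull_dim (subtopology (space_of (?Y j)) (space_of (?Y j) closure_of (map_space (?Y j) (?f j) ` Z)))"
  have lower: "enat (card (Js j)) \<le> ?D j" if j: "j < m" for j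
  proof -
    let ?S = "mpoly_ring (n j) :: 'k alg_closure mpoly ring"
    interpret S: cring ?S by (rule cring_mpoly_ring)
    have f: "?f j = (\<lambda>i. mvar (\<sigma> j i))" by (simp add: base_change_morphism_def map_to_ac_mvar fun_eq_iff)
    define Q where "Q = map_space (?Y j) (?f j) P0"
    have subN: "mpoly_subst (\<lambda>i. mvar (\<sigma> j i)) q \<in> mpolys {..<?N}" if "q \<in> mpolys {..<n j}"
      for q :: "'k alg_closure mpoly"
      using msubst_rename_mpolys[OF that, of "\<sigma> j"] sig(2)[OF j] by (auto intro: mpolys_mono)
    have Q: "Q = {q. mpoly_subst (\<lambda>i. mvar (\<sigma> j i)) q \<in> P} \<inter> mpolys {..<n j}"
      unfolding Q_def map_space_def f P_def using subN retract_id[OF subN]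
      by (auto simp: base_change_def carrier_mpoly_ring)
    have primeQ: "primeideal Q ?S"
      unfolding Q by (intro primeideal_contract prime_ideal_preimage primeP)
    then have "{0} \<subseteq> Q"
      using primeideal_zero by blast
    moreover have "Poly_Mapping.map to_ac (0 :: 'k mpoly) = 0" by (simp add: map_eq_zero_iff)
    ultimately have IQ: "defideal (?Y j) \<subseteq> Q"
      using S.genideal_minimal[OF primeideal.axioms(1)[OF primeQ]] by (simp add: base_change_def)
    have "P0 \<in> Z" unfolding P0(3) vset_def using P0(1) by simp
    then have QA: "Q \<in> map_space (?Y j) (?f j) ` Z" unfolding Q_def by blast
    define A where "A = {i \<in> {..<n j}. \<sigma> j i \<in> Js j}"
    have inj: "inj_on (\<sigma> j) A" using sig(1)[OF j] by (rule inj_on_subset) (auto simp: A_def)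
    have im: "\<sigma> j ` A = Js j" using Js(1) j unfolding A_def by blast
    have "indep_mod {q. retract (n j) q \<in> Q} A"
      unfolding indep_mod_def
    proof (intro ballI impI)
      fix q assume q: "q \<in> mpolys A" "q \<in> {q. retract (n j) q \<in> Q}"
      have "q \<in> mpolys {..<n j}" using q(1) by (rule mpolys_mono) (auto simp: A_def)
      then have "mpoly_subst (\<lambda>i. mvar (\<sigma> j i)) q \<in> P" using q(2) unfolding Q by (simp add: retract_id)
      moreover have "mpoly_subst (\<lambda>i. mvar (\<sigma> j i)) q \<in> mpolys (Js j)"
        using msubst_rename_mpolys[OF q(1), of "\<sigma> j"] im by simp
      ultimately have "mpoly_subst (\<lambda>i. mvar (\<sigma> j i)) q = 0" using Js(1) j unfolding indep_mod_def by blast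
      then show "q = 0" using msubst_rename_inj[OF inj q(1)] by blast
    qed
    then have "enat (card A) \<le> krull_dim (subtopology (sspec ?S (defideal (?Y j)))
        (sspec ?S (defideal (?Y j)) closure_of (map_space (?Y j) (?f j) ` Z)))"
      by (intro krull_dim_ge[OF primeQ IQ QA]) (auto simp: A_def)
    moreover have "space_of (?Y j) = sspec ?S (defideal (?Y j))"
      by (simp add: space_of_sspec base_change_def)
    moreover have "card A = card (Js j)" using card_image[OF inj] im by simp
    ultimately show ?thesis by simp
  qed
  have "ereal (real (card J)) \<le> ereal (\<Sum>j<m. p j * real (card (Js j)))" using Js(2) by simp
  also have "\<dots> = (\<Sum>j<m. ereal (p j) * ereal (real (card (Js j))))" by (simp flip: sum_ereal)
  also have "\<dots> \<le> (\<Sum>j<m. ereal (p j) * ereal_of_enat (?D j))"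
  proof (rule sum_mono)
    fix j assume "j \<in> {..<m}"
    then have j: "j < m" by simp
    have "ereal (real (card (Js j))) \<le> ereal_of_enat (?D j)"
      using lower[OF j] by (metis ereal_of_enat_le_iff ereal_of_enat_simps(1))
    then show "ereal (p j) * ereal (real (card (Js j))) \<le> ereal (p j) * ereal_of_enat (?D j)"
      using p[OF j] by (intro ereal_mult_left_mono) auto
  qed
  finally show "ereal_of_enat (krull_dim (subtopology (space_of (base_change \<X>)) Z)) \<le>
      (\<Sum>j<m. ereal (p j) * ereal_of_enat (?D j))"
    using upper by (rule order_trans[rotated])
qed

section \<open>Frames with prescribed Gram matrix\<close>

lemma coeff_hom_to_ac: "coeff_hom (\<lambda>c::'k::field. mconst (to_ac c))"
proof (rule coeff_hom.intro)
  fix a b :: 'k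
  show "mconst (to_ac (a + b)) = mconst (to_ac a) + mconst (to_ac b)" by (simp add: single_add)
  show "mconst (to_ac (a * b)) = mconst (to_ac a) * mconst (to_ac b)" by (simp add: mult_single)
  show "mconst (to_ac (1 :: 'k)) = 1" by simp
qed

interpretation ac_map: coeff_hom "\<lambda>c::'k::field. mconst (to_ac c)"
  by (rule coeff_hom_to_ac)

lemma map_to_ac_eq_eval: "Poly_Mapping.map to_ac p = mpoly_eval (\<lambda>c. mconst (to_ac c)) mvar p"
  for p :: "'k::field mpoly"
proof -
  have "mpoly_eval (\<lambda>c. mconst (to_ac c)) mvar p =
      (\<Sum>m\<in>keys p. single m (to_ac (lookup p m)))"
    unfolding mpoly_eval_def by (simp flip: single_eq_prod)
  also have "\<dots> = Poly_Mapping.map to_ac p"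
    by (rule poly_mapping_eqI) (simp add: lookup_sum lookup_single map.rep_eq when_def in_keys_iff)
  finally show ?thesis by simp
qed

text \<open>The coordinates are arranged in four blocks of \<open>n\<times>n\<close> matrices: block \<open>0\<close> holds \<open>n\<close> vectors \<open>v\<^sub>i\<close>, one in each row, block
\<open>1\<close> the matrix \<open>S\<close> of a bilinear form, block \<open>2\<close> a Gram matrix \<open>G\<close>, and block \<open>3\<close> a matrix \<open>R\<close> that stands for the inverse of \<open>G\<close>.\<close>

definition idx :: "nat \<Rightarrow> nat \<Rightarrow> nat \<Rightarrow> nat \<Rightarrow> nat" where
  "idx n b i k = b * (n * n) + (i * n + k)"

lemma cell_less: "i < n \<Longrightarrow> k < n \<Longrightarrow> i * n + k < n * (n :: nat)"
proof -
  assume "i < n" "k < n"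
  then have "i * n + k < i * n + n" "Suc i * n \<le> n * n" by (auto simp del: mult_Suc intro: mult_le_mono1)
  then show ?thesis by simp
qed

lemma idx_less:
  assumes "b < 4" "i < n" "k < n" shows "idx n b i k < 4 * (n * n)"
proof -
  have "idx n b i k < b * (n * n) + n * n" unfolding idx_def using cell_less[OF assms(2,3)] by simp
  also have "\<dots> = Suc b * (n * n)" by simp
  also have "\<dots> \<le> 4 * (n * n)" using assms(1) by (intro mult_le_mono1) simp
  finally show ?thesis .
qed

definition sym_eq :: "nat \<Rightarrow> nat \<Rightarrow> nat \<Rightarrow> 'a::comm_ring_1 mpoly" where
  "sym_eq n k l = mvar (idx n 1 k l) - mvar (idx n 1 l k)"

definition gram_eq :: "nat \<Rightarrow> nat \<Rightarrow> nat \<Rightarrow> 'a::comm_ring_1 mpoly" where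
  "gram_eq n i j = (\<Sum>k<n. \<Sum>l<n. mvar (idx n 1 k l) * (mvar (idx n 0 i k) * mvar (idx n 0 j l)))
     - mvar (idx n 2 i j)"

text \<open>The entry \<open>(k, l)\<close> of \<open>V R V\<^sup>T S = 1\<close>, where \<open>V\<close> has the columns \<open>v\<^sub>i\<close>. It makes \<open>V\<^sup>T S\<close> invertible on the
variety without a determinant.\<close>

definition inv_eq :: "nat \<Rightarrow> nat \<Rightarrow> nat \<Rightarrow> 'a::comm_ring_1 mpoly" where
  "inv_eq n k l = (\<Sum>j<n. (\<Sum>m<n. mvar (idx n 0 m k) * mvar (idx n 3 m j)) *
     (\<Sum>l'<n. mvar (idx n 0 j l') * mvar (idx n 1 l' l))) - mconst (if k = l then 1 else 0)"

definition frame_eqs :: "nat \<Rightarrow> 'a::comm_ring_1 mpoly set" where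
  "frame_eqs n = (\<Union>i<n. \<Union>j<n. {sym_eq n i j, gram_eq n i j, inv_eq n i j})"

lemma frame_eqs_mpolys: "(frame_eqs n :: 'a::comm_ring_1 mpoly set) \<subseteq> mpolys {..<4 * (n * n)}"
proof -
  have x: "(mvar (idx n b i k) :: 'a mpoly) \<in> mpolys {..<4 * (n * n)}" if "b < 4" "i < n" "k < n" for b i k
    using idx_less[OF that] by simp
  have "(sym_eq n i j :: 'a mpoly) \<in> mpolys {..<4 * (n * n)}"
    "(gram_eq n i j :: 'a mpoly) \<in> mpolys {..<4 * (n * n)}"
    "(inv_eq n i j :: 'a mpoly) \<in> mpolys {..<4 * (n * n)}" if "i < n" "j < n" for i j
    unfolding sym_eq_def gram_eq_def inv_eq_def using that
    by (intro mpolys.diff mpolys.sum mpolys.mult x mconst_mpolys; simp)+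
  then show ?thesis unfolding frame_eqs_def by blast
qed

lemma map_to_ac_frame_eqs: "Poly_Mapping.map to_ac ` frame_eqs n = frame_eqs n"
proof -
  have e: "Poly_Mapping.map to_ac (sym_eq n i j :: 'a mpoly) = sym_eq n i j"
    "Poly_Mapping.map to_ac (gram_eq n i j :: 'a mpoly) = gram_eq n i j"
    "Poly_Mapping.map to_ac (inv_eq n i j :: 'a mpoly) = inv_eq n i j" for i j
    unfolding map_to_ac_eq_eval sym_eq_def gram_eq_def inv_eq_def
    by (simp_all add: ac_map.eval_diff ac_map.eval_sum ac_map.eval_mult)
  show ?thesis unfolding frame_eqs_def by (simp add: image_UN e)
qed

text \<open>At the point \<open>a\<close> put \<open>\<theta> i j = (dv\<^sub>i)\<^sup>T S v\<^sub>j\<close>. Differentiating \<open>v\<^sub>i\<^sup>T S v\<^sub>j = G\<^sub>i\<^sub>j\<close> shows that \<open>\<theta> i j + \<theta> j i\<close> is a combination of the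
differentials of \<open>S\<close> and \<open>G\<close>; as \<open>2\<close> is invertible, so is \<open>\<theta> i i\<close>. Since \<open>V\<^sup>T S\<close> is invertible, row \<open>i\<close> of \<open>\<theta>\<close> spans the same space as
the differentials of the entries of \<open>v\<^sub>i\<close>, and the bound for skew-symmetric families applies. This is the
tangent space of the orthogonal group, in a form that works for all forms \<open>S\<close> at once.\<close>

lemma rank_bound:
  fixes P :: "'a::alg_closed_field mpoly set"
  assumes P: "ac_prime P" "frame_eqs n \<subseteq> P" and two: "(2 :: 'a) \<noteq> 0"
    and J: "J \<subseteq> {..<4 * (n * n)}" "indep_mod P J"
  shows "\<exists>J0 Jc. J0 \<subseteq> {n * n..<4 * (n * n)} \<and> indep_mod P J0 \<and>
    (\<forall>i<n. Jc i \<subseteq> (\<lambda>k. i * n + k) ` {..<n} \<and> indep_mod P (Jc i)) \<and>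
    2 * card J \<le> 2 * card J0 + (\<Sum>i<n. card (Jc i))"
proof -
  let ?N = "4 * (n * n)"
  interpret ac_prime P by fact
  obtain a where a: "vanishes P {..<?N} a"
    and up: "\<forall>J\<subseteq>{..<?N}. indep_mod P J \<longrightarrow> card J \<le> fs.dim (dcoord P ?N a ` {..<?N})"
    and low: "\<forall>A\<subseteq>{..<?N}. \<exists>J\<subseteq>A. indep_mod P J \<and> card J = fs.dim (dcoord P ?N a ` A)"
    using cotangent_ranks[of ?N] by (elim exE conjE) (rule that)
  let ?w = "dcoord P ?N a"
  define v where "v i k = a (idx n 0 i k)" for i k
  define S where "S k l = a (idx n 1 k l)" for k l
  define R where "R i j = a (idx n 3 i j)" for i j
  have eqP: "f \<in> P" "f \<in> mpolys {..<?N}" if "f \<in> frame_eqs n" for f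
    using that P(2) frame_eqs_mpolys by blast+
  have evz: "ev a f = 0" if "f \<in> frame_eqs n" for f
    using a eqP[OF that] unfolding vanishes_def by blast
  have mem: "sym_eq n i j \<in> frame_eqs n" "gram_eq n i j \<in> frame_eqs n" "inv_eq n i j \<in> frame_eqs n"
    if "i < n" "j < n" for i j using that unfolding frame_eqs_def by blast+
  have sym: "S k l = S l k" if "k < n" "l < n" for k l
    using evz[OF mem(1)[OF that]] by (simp add: sym_eq_def S_def ev.eval_diff)
  define T where "T j k = (\<Sum>l<n. S k l * v j l)" for j k
  define U where "U k j = (\<Sum>m<n. v m k * R m j)" for k j
  \<comment> \<open>\<open>T\<close> is \<open>V\<^sup>T S\<close> and \<open>U\<close> is \<open>V R\<close>, so \<open>T\<close> has the left inverse \<open>U\<close>.\<close>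
  have UT: "(\<Sum>j<n. U k j * T j l) = (if k = l then 1 else 0)" if "k < n" "l < n" for k l
  proof -
    have "(\<Sum>l'<n. v j l' * S l' l) = T j l" for j
      unfolding T_def by (rule sum.cong) (use sym that in \<open>auto simp: mult.commute\<close>)
    then have "ev a (inv_eq n k l) = (\<Sum>j<n. U k j * T j l) - (if k = l then 1 else 0)"
      by (simp add: inv_eq_def ev.eval_diff ev.eval_sum ev.eval_mult U_def v_def R_def S_def)
    then show ?thesis using evz[OF mem(3)[OF that]] by simp
  qed
  define \<theta> where "\<theta> i j = (\<Sum>k<n. (\<lambda>d. T j k * ?w (idx n 0 i k) d))" for i j
  let ?K = "?w ` {n * n..<?N}"
  have par: "?w (idx n b i k) \<in> ?K" if "b \<in> {1, 2, 3}" "i < n" "k < n" for b i k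
  proof (rule imageI)
    have "n * n \<le> idx n b i k" unfolding idx_def using that(1) by auto
    then show "idx n b i k \<in> {n * n..<?N}" using idx_less[of b i n k] that by auto
  qed
  have skew: "\<theta> i j + \<theta> j i \<in> fs.span ?K" if ij: "i < n" "j < n" for i j
  proof -
    let ?rhs = "?w (idx n 2 i j) - (\<Sum>k<n. \<Sum>l<n. (\<lambda>d. (v i k * v j l) * ?w (idx n 1 k l) d))"
    have "(\<theta> i j + \<theta> j i) d = ?rhs d" for d
    proof (cases "\<forall>f\<in>mpolys {..<?N}. f \<in> P \<longrightarrow> dir_deriv ?N a d f = 0")
      case False
      then have "?w i d = 0" for i unfolding dcoord_def by (rule if_not_P)
      then show ?thesis by (simp add: \<theta>_def sum_fun_apply)
    next
      case True
      have w: "?w i d = d i" for i unfolding dcoord_def using True by (rule if_P)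
      have dv: "dir_deriv ?N a d (mvar (idx n b i k)) = d (idx n b i k)" if "b < 4" "i < n" "k < n" for b i k
        using idx_less[OF that] by (rule dir_deriv_var)
      have dsum: "dir_deriv ?N a d (sum f I) = (\<Sum>i\<in>I. dir_deriv ?N a d (f i))" for f :: "nat \<Rightarrow> 'a mpoly" and I
        by (induction I rule: infinite_finite_induct) (simp_all add: dir_deriv_add)
      have "0 = dir_deriv ?N a d (gram_eq n i j)" using True eqP[OF mem(2)[OF ij]] by simp
      also have "\<dots> = (\<Sum>k<n. \<Sum>l<n. S k l * (v i k * d (idx n 0 j l) + v j l * d (idx n 0 i k))
            + (v i k * v j l) * d (idx n 1 k l)) - d (idx n 2 i j)"
        using ij by (simp add: gram_eq_def dir_deriv_diff dsum dir_deriv_mult dv ev.eval_mult v_def S_def)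
      also have "\<dots> = (\<Sum>k<n. \<Sum>l<n. S k l * v j l * d (idx n 0 i k)) +
          (\<Sum>k<n. \<Sum>l<n. S k l * v i k * d (idx n 0 j l)) +
          (\<Sum>k<n. \<Sum>l<n. (v i k * v j l) * d (idx n 1 k l)) - d (idx n 2 i j)"
        by (simp add: sum.distrib algebra_simps)
      also have "(\<Sum>k<n. \<Sum>l<n. S k l * v j l * d (idx n 0 i k)) = \<theta> i j d"
        by (simp add: \<theta>_def sum_fun_apply w T_def sum_distrib_right)
      also have "(\<Sum>k<n. \<Sum>l<n. S k l * v i k * d (idx n 0 j l)) =
          (\<Sum>l<n. \<Sum>k<n. S l k * v i k * d (idx n 0 j l))"
        by (subst sum.swap) (intro sum.cong refl, use sym in auto)
      also have "\<dots> = \<theta> j i d"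
        by (simp add: \<theta>_def sum_fun_apply w T_def sum_distrib_right)
      finally have z: "0 = \<theta> i j d + \<theta> j i d +
        (\<Sum>k<n. \<Sum>l<n. (v i k * v j l) * d (idx n 1 k l)) - d (idx n 2 i j)" .
      have "?rhs d = d (idx n 2 i j) - (\<Sum>k<n. \<Sum>l<n. (v i k * v j l) * d (idx n 1 k l))"
        by (simp only: minus_apply sum_fun_apply w)
      moreover have "x + y = t - s" if "0 = x + y + s - t" for x y s t :: 'a
      proof -
        have "t = x + y + s" using that by (metis eq_iff_diff_eq_0)
        then show ?thesis by simp
      qed
      ultimately show ?thesis using z by (simp only: plus_fun_apply)
    qed
    then have "\<theta> i j + \<theta> j i = ?rhs" by (rule ext)
    also have "\<dots> \<in> fs.span ?K"
      by (intro fs.span_diff fs.span_sum fs.span_scale fs.span_base par) (use ij in auto)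
    finally show ?thesis .
  qed
  have diag: "\<theta> i i \<in> fs.span ?K" if i: "i < n" for i
  proof -
    have "(\<lambda>d. inverse 2 * (\<theta> i i + \<theta> i i) d) \<in> fs.span ?K"
      using fs.span_scale[OF skew[OF i i], of "inverse 2"] .
    moreover have "(\<lambda>d. inverse 2 * (\<theta> i i + \<theta> i i) d) = \<theta> i i"
      using two by (simp add: fun_eq_iff field_simps)
    ultimately show ?thesis by simp
  qed
  have recover: "?w (idx n 0 i k) \<in> fs.span (\<theta> i ` {..<n})" if ik: "i < n" "k < n" for i k
  proof -
    have "?w (idx n 0 i k) = (\<Sum>j<n. (\<lambda>d. U k j * \<theta> i j d))"
    proof
      fix d
      have "(\<Sum>j<n. (\<lambda>d. U k j * \<theta> i j d)) d = (\<Sum>j<n. \<Sum>l<n. U k j * (T j l * ?w (idx n 0 i l) d))"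
        by (simp add: sum_fun_apply \<theta>_def sum_distrib_left)
      also have "\<dots> = (\<Sum>l<n. \<Sum>j<n. U k j * T j l * ?w (idx n 0 i l) d)"
        by (subst sum.swap) (simp add: mult.assoc)
      also have "\<dots> = (\<Sum>l<n. (if k = l then 1 else 0) * ?w (idx n 0 i l) d)"
        by (rule sum.cong) (use UT[OF ik(2)] in \<open>auto simp flip: sum_distrib_right\<close>)
      also have "\<dots> = ?w (idx n 0 i k) d" using ik by (simp add: if_distrib[of "\<lambda>x. x * _"] cong: if_cong)
      finally show "?w (idx n 0 i k) d = (\<Sum>j<n. (\<lambda>d. U k j * \<theta> i j d)) d" by simp
    qed
    also have "\<dots> \<in> fs.span (\<theta> i ` {..<n})"
      by (intro fs.span_sum fs.span_scale fs.span_base) auto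
    finally show ?thesis .
  qed
  let ?c = "\<lambda>i. (\<lambda>k. i * n + k) ` {..<n}"
  have "card J \<le> fs.dim (?w ` {..<?N})" using up J by blast
  also have "\<dots> \<le> fs.dim (?K \<union> (\<Union>i<n. \<theta> i ` {..<n}))"
  proof (rule fs.dim_mono_finite)
    let ?B = "?K \<union> (\<Union>i<n. \<theta> i ` {..<n})"
    show "?w ` {..<?N} \<subseteq> fs.span ?B"
    proof
      fix y assume "y \<in> ?w ` {..<?N}"
      then obtain z where z: "z < ?N" "y = ?w z" by auto
      show "y \<in> fs.span ?B"
      proof (cases "z < n * n")
        case True
        then have n0: "n > 0" by (cases n) auto
        have "z div n < n" using True by (simp add: less_mult_imp_div_less)
        moreover have "z mod n < n" using n0 by simp
        moreover have "z = idx n 0 (z div n) (z mod n)" by (simp add: idx_def)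
        ultimately have "y \<in> fs.span (\<theta> (z div n) ` {..<n})" using recover z(2) by metis
        moreover have "\<theta> (z div n) ` {..<n} \<subseteq> ?B" using \<open>z div n < n\<close> by blast
        ultimately show ?thesis using fs.span_mono by blast
      next
        case False
        then have "y \<in> ?B" using z by auto
        then show ?thesis by (rule fs.span_base)
      qed
    qed
  qed simp
  finally have "2 * card J \<le> 2 * fs.dim ?K + (\<Sum>i<n. fs.dim (\<theta> i ` {..<n}))"
    using fs.skew_rank_bound[of ?K n \<theta>, OF _ skew diag] by simp
  also have "\<dots> \<le> 2 * fs.dim ?K + (\<Sum>i<n. fs.dim (?w ` ?c i))"
  proof (intro add_left_mono sum_mono fs.dim_mono_finite)
    fix i
    have "\<theta> i j \<in> fs.span (?w ` ?c i)" for j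
      unfolding \<theta>_def by (intro fs.span_sum fs.span_scale fs.span_base) (auto simp: idx_def)
    then show "\<theta> i ` {..<n} \<subseteq> fs.span (?w ` ?c i)" by blast
  qed simp
  finally have bound: "2 * card J \<le> 2 * fs.dim ?K + (\<Sum>i<n. fs.dim (?w ` ?c i))" .
  obtain J0 where J0: "J0 \<subseteq> {n * n..<?N}" "indep_mod P J0" "card J0 = fs.dim ?K"
  proof -
    have "{n * n..<?N} \<subseteq> {..<?N}" by auto
    then show thesis using low that by blast
  qed
  have "\<forall>i\<in>{..<n}. \<exists>J. J \<subseteq> ?c i \<and> indep_mod P J \<and> card J = fs.dim (?w ` ?c i)"
  proof
    fix i assume i: "i \<in> {..<n}"
    have "i * n + k < ?N" if "k < n" for k using cell_less[of i n k] i that by simp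
    then have "?c i \<subseteq> {..<?N}" by auto
    then show "\<exists>J. J \<subseteq> ?c i \<and> indep_mod P J \<and> card J = fs.dim (?w ` ?c i)" using low by blast
  qed
  from bchoice[OF this] obtain Jc
    where Jc: "\<forall>i\<in>{..<n}. Jc i \<subseteq> ?c i \<and> indep_mod P (Jc i) \<and> card (Jc i) = fs.dim (?w ` ?c i)" ..
  have "2 * card J \<le> 2 * card J0 + (\<Sum>i<n. card (Jc i))" using bound J0(3) Jc by simp
  then show ?thesis using J0(1,2) Jc by (intro exI[of _ J0] exI[of _ Jc]) auto
qed

section \<open>Counting isometries\<close>

definition frame_points :: "nat \<Rightarrow> (nat \<Rightarrow> 'k::field) set" where
  "frame_points n = {x \<in> {..<4 * (n * n)} \<rightarrow>\<^sub>E UNIV. \<forall>q\<in>frame_eqs n. ev x q = 0}"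

text \<open>The ideal consists of all polynomials that vanish at the rational solutions of the equations. In this way the rational
points needed for counting belong to the scheme, and so do the equations to its ideal, by definition.\<close>

definition frame_scheme :: "nat \<Rightarrow> 'k::field affine_scheme" where
  "frame_scheme n = \<lparr>nvars = 4 * (n * n),
     defideal = {q \<in> mpolys {..<4 * (n * n)}. \<forall>x\<in>frame_points n. ev x q = 0}\<rparr>"

lemma affine_variety_frame_scheme: "affine_variety (frame_scheme n :: 'k::field affine_scheme)"
proof -
  have "ideal (defideal (frame_scheme n) :: 'k mpoly set) (mpoly_ring (4 * (n * n)))"
    by (rule ideal_mpoly_ringI) (auto simp: frame_scheme_def ev.eval_add ev.eval_mult)
  then show ?thesis by (simp add: affine_variety_def frame_scheme_def)
qed

text \<open>The maps to which the conjecture is applied: index \<open>0\<close> is the projection to the parameters \<open>S\<close>, \<open>G\<close>, \<open>R\<close>, with weight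
\<open>1\<close>, and index \<open>i + 1\<close> the projection to the vector \<open>v\<^sub>i\<close>, with weight \<open>1/2\<close>.\<close>

definition block_size :: "nat \<Rightarrow> nat \<Rightarrow> nat" where
  "block_size n j = (if j = 0 then 3 * (n * n) else n)"

definition block :: "nat \<Rightarrow> nat \<Rightarrow> nat \<Rightarrow> nat" where
  "block n j i = (if j = 0 then n * n + i else (j - 1) * n + i)"

definition weight :: "nat \<Rightarrow> real" where
  "weight j = (if j = 0 then 1 else 1 / 2)"

lemma block_less: "j < Suc n \<Longrightarrow> i < block_size n j \<Longrightarrow> block n j i < 4 * (n * n)"
proof (cases j)
  case (Suc j')
  then show "j < Suc n \<Longrightarrow> i < block_size n j \<Longrightarrow> block n j i < 4 * (n * n)"
    using cell_less[of j' n i] by (simp add: block_def block_size_def)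
qed (simp add: block_def block_size_def)

lemma inj_block: "inj_on (block n j) A"
  by (auto simp: block_def inj_on_def)

lemma frame_brascamp_lieb:
  assumes two: "(2 :: 'k::field) \<noteq> 0"
  shows "brascamp_lieb_condition (frame_scheme n :: 'k affine_scheme) (Suc n)
    (\<lambda>j. affine_space (block_size n j)) (\<lambda>j i. mvar (block n j i)) weight"
proof (rule brascamp_lieb_condition_coordinates)
  let ?X = "frame_scheme n :: 'k affine_scheme"
  have nv: "nvars ?X = 4 * (n * n)" by (simp add: frame_scheme_def)
  show "inj_on (block n j) {..<block_size n j}" for j by (rule inj_block)
  show "block n j i < nvars ?X" if "j < Suc n" "i < block_size n j" for j i
    using block_less[OF that] nv by simp
  show "0 \<le> weight j" for j by (simp add: weight_def)
  show "defideal ?X \<subseteq> mpolys {..<nvars ?X}" by (auto simp: frame_scheme_def)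
  fix P :: "'k alg_closure mpoly set" and J
  assume P: "ac_prime P" "Poly_Mapping.map to_ac ` defideal ?X \<subseteq> P"
    and J: "J \<subseteq> {..<nvars ?X}" "indep_mod P J"
  have "frame_eqs n \<subseteq> defideal ?X"
    using frame_eqs_mpolys by (auto simp: frame_scheme_def frame_points_def)
  then have "Poly_Mapping.map to_ac ` (frame_eqs n :: 'k mpoly set) \<subseteq> P" using P(2) by blast
  then have eqs: "frame_eqs n \<subseteq> P" unfolding map_to_ac_frame_eqs .
  have "to_ac (2 :: 'k) \<noteq> 0" using two by (simp only: to_ac_eq_0_iff simp_thms)
  then have two': "(2 :: 'k alg_closure) \<noteq> 0" by simp
  obtain J0 Jc where J0: "J0 \<subseteq> {n * n..<4 * (n * n)}" "indep_mod P J0"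
    and Jc: "\<forall>i<n. Jc i \<subseteq> (\<lambda>k. i * n + k) ` {..<n} \<and> indep_mod P (Jc i)"
    and le: "2 * card J \<le> 2 * card J0 + (\<Sum>i<n. card (Jc i))"
    using rank_bound[OF P(1) eqs two' J(1)[unfolded nv] J(2)] by (elim exE conjE) (rule that)
  define Js where "Js j = (case j of 0 \<Rightarrow> J0 | Suc i \<Rightarrow> Jc i)" for j
  have "Js j \<subseteq> block n j ` {..<block_size n j} \<and> indep_mod P (Js j)" if "j < Suc n" for j
  proof (cases j)
    case 0
    have "z \<in> block n 0 ` {..<3 * (n * n)}" if "z \<in> {n * n..<4 * (n * n)}" for z
    proof (rule image_eqI)
      show "z = block n 0 (z - n * n)" using that by (simp add: block_def)
      show "z - n * n \<in> {..<3 * (n * n)}" using that by auto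
    qed
    then show ?thesis using J0 0 by (auto simp: Js_def block_size_def)
  next
    case (Suc i)
    have "block n (Suc i) = (\<lambda>k. i * n + k)" by (simp add: block_def fun_eq_iff)
    then show ?thesis using Jc that Suc by (simp add: Js_def block_size_def)
  qed
  moreover have "real (card J) \<le> (\<Sum>j<Suc n. weight j * real (card (Js j)))"
  proof -
    have "2 * real (card J) \<le> 2 * real (card J0) + (\<Sum>i<n. real (card (Jc i)))"
      using le by (metis of_nat_le_iff of_nat_add of_nat_mult of_nat_numeral of_nat_sum)
    then show ?thesis
      unfolding sum.lessThan_Suc_shift by (simp add: weight_def Js_def flip: sum_divide_distrib)
  qed
  ultimately show "\<exists>Js. (\<forall>j<Suc n. Js j \<subseteq> block n j ` {..<block_size n j} \<and> indep_mod P (Js j)) \<and>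
      real (card J) \<le> (\<Sum>j<Suc n. weight j * real (card (Js j)))" by blast
qed

text \<open>The inverse of \<open>idx\<close> is used to read off block, row and column from the number of a coordinate.\<close>

definition frame_pt :: "nat \<Rightarrow> (nat \<Rightarrow> nat \<Rightarrow> nat \<Rightarrow> 'k) \<Rightarrow> nat \<Rightarrow> 'k" where
  "frame_pt n f = (\<lambda>z\<in>{..<4 * (n * n)}. f (z div (n * n)) (z mod (n * n) div n) (z mod (n * n) mod n))"

lemma frame_pt_idx:
  assumes "b < 4" "i < n" "k < n" shows "frame_pt n f (idx n b i k) = f b i k"
proof -
  have r: "i * n + k < n * n" by (rule cell_less[OF assms(2,3)])
  have "(b * q + s) div q = b" "(b * q + s) mod q = s" if "s < q" for q s :: nat
    using that by simp_all
  from this[OF r] have "idx n b i k div (n * n) = b" "idx n b i k mod (n * n) = i * n + k"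
    unfolding idx_def by simp_all
  moreover have "(i * n + k) div n = i" "(i * n + k) mod n = k" using assms(3) by simp_all
  ultimately show ?thesis using idx_less[OF assms] by (simp add: frame_pt_def)
qed

lemma frame_pt_frame_points:
  assumes "\<And>k l. k < n \<Longrightarrow> l < n \<Longrightarrow> f 1 k l = f 1 l k"
    and "\<And>i j. i < n \<Longrightarrow> j < n \<Longrightarrow> (\<Sum>k<n. \<Sum>l<n. f 1 k l * (f 0 i k * f 0 j l)) = f 2 i j"
    and "\<And>k l. k < n \<Longrightarrow> l < n \<Longrightarrow> (\<Sum>j<n. (\<Sum>m<n. f 0 m k * f 3 m j) * (\<Sum>l'<n. f 0 j l' * f 1 l' l))
      = (if k = l then 1 else 0)"
  shows "frame_pt n f \<in> frame_points n"
proof -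
  let ?x = "frame_pt n f"
  have x: "ev ?x (mvar (idx n b i k)) = f b i k" if "b < 4" "i < n" "k < n" for b i k
    using frame_pt_idx[OF that] by simp
  have "ev ?x (sym_eq n i j) = 0" "ev ?x (gram_eq n i j) = 0" "ev ?x (inv_eq n i j) = 0"
    if "i < n" "j < n" for i j
    using that assms(1)[OF that] assms(2)[OF that] assms(3)[OF that]
    by (simp_all add: sym_eq_def gram_eq_def inv_eq_def ev.eval_diff ev.eval_sum ev.eval_mult frame_pt_idx
        del: ev.eval_var add: x)
  then show ?thesis unfolding frame_points_def frame_eqs_def by (auto simp: frame_pt_def)
qed

lemma linear_form_sum:
  fixes f :: "'k::field ^ 'n \<Rightarrow> 'k"
  assumes "Vector_Spaces.linear (*s) (*) f"
  shows "f (\<Sum>i\<in>I. c i *s v i) = (\<Sum>i\<in>I. c i * f (v i))"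
proof -
  have l: "f (x + y) = f x + f y" "f (r *s x) = r * f x" for x y r
    using assms unfolding Vector_Spaces.linear_iff by blast+
  have "f 0 = 0" using l(2)[of 0 0] by simp
  then show ?thesis by (induction I rule: infinite_finite_induct) (simp_all add: l)
qed

lemma bilinear_expansion:
  assumes "bilinear_form B"
  shows "B (\<Sum>i\<in>I. c i *s v i) (\<Sum>j\<in>J. d j *s w j) = (\<Sum>i\<in>I. \<Sum>j\<in>J. B (v i) (w j) * (c i * d j))"
proof -
  have "B (\<Sum>i\<in>I. c i *s v i) y = (\<Sum>i\<in>I. c i * B (v i) y)" for y
    by (rule linear_form_sum) (use assms in \<open>simp add: bilinear_form_def\<close>)
  moreover have "B x (\<Sum>j\<in>J. d j *s w j) = (\<Sum>j\<in>J. d j * B x (w j))" for x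
    by (rule linear_form_sum) (use assms in \<open>simp add: bilinear_form_def\<close>)
  ultimately show ?thesis by (simp add: sum_distrib_left mult_ac) (rule sum.swap)
qed

lemma bilinear_coordinates:
  assumes "bilinear_form B"
  shows "B x y = (\<Sum>k\<in>UNIV. \<Sum>l\<in>UNIV. B (axis k 1) (axis l 1) * (x $ k * y $ l))"
  using bilinear_expansion[OF assms, of "\<lambda>k. x $ k" "\<lambda>k. axis k 1" UNIV "\<lambda>l. y $ l" "\<lambda>l. axis l 1" UNIV]
  unfolding basis_expansion .

lemma gram_left_inverse:
  fixes B :: "'k::field ^ 'n \<Rightarrow> 'k ^ 'n \<Rightarrow> 'k" and u :: "'n::finite \<Rightarrow> 'k ^ 'n"
  assumes B: "bilinear_form B" "symmetric_form B" "nondegenerate_form B" and u: "ordered_basis u"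
  shows "\<exists>R :: 'k ^ 'n ^ 'n. R ** (\<chi> i j. B (u i) (u j)) = mat 1"
  unfolding matrix_left_invertible_ker
proof (intro allI impI)
  fix c :: "'k ^ 'n" assume c: "(\<chi> i j. B (u i) (u j)) *v c = 0"
  define y where "y = (\<Sum>j\<in>UNIV. c $ j *s u j)"
  have base: "B (u i) y = 0" for i
  proof -
    have "B (u i) y = (\<Sum>j\<in>UNIV. c $ j * B (u i) (u j))"
      unfolding y_def by (rule linear_form_sum) (use B(1) in \<open>simp add: bilinear_form_def\<close>)
    also have "\<dots> = ((\<chi> i j. B (u i) (u j)) *v c) $ i" by (simp add: matrix_vector_mult_def mult.commute)
    finally show ?thesis using c by simp
  qed
  have "B x y = 0" for x
  proof -
    have l: "B (p + q) y = B p y + B q y" "B (r *s p) y = r * B p y" for p q r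
      using B(1) unfolding bilinear_form_def Vector_Spaces.linear_iff by blast+
    have "x \<in> vec.span (range u)" using u unfolding ordered_basis_def by blast
    then show ?thesis
    proof (induction rule: vec.span_induct_alt)
      case base
      then show ?case using l(2)[of 0 0] by simp
    next
      case (step r p q)
      then show ?case using base by (auto simp: l)
    qed
  qed
  then have "y = 0" using B(2,3) unfolding symmetric_form_def nondegenerate_form_def by metis
  have inj: "inj u" and ind: "vec.independent (range u)" using u unfolding ordered_basis_def by auto
  have "(\<Sum>v\<in>range u. c $ (the_inv u v) *s v) = y"
    unfolding y_def by (simp add: sum.reindex[OF inj] the_inv_f_f[OF inj])
  then have "c $ (the_inv u (u j)) = 0" for j
    using vec.independentD[OF ind, of "range u" "\<lambda>v. c $ (the_inv u v)" "u j"] \<open>y = 0\<close> by simp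
  then show "c = 0" by (simp add: vec_eq_iff the_inv_f_f[OF inj])
qed

text \<open>An isometry \<open>g\<close> in the transporter is encoded by the point with \<open>v\<^sub>i = g u\<^sub>i\<close>, whose parameters are the matrix of \<open>B\<close>, the Gram matrix
of \<open>u\<close> and the inverse of the latter. The parameters are the same for all \<open>g\<close>, so the finite set for the first map is a singleton
and contributes the factor \<open>1\<close>; each of the other \<open>n\<close> maps contributes at most \<open>|E|\<^bsup>1/2\<^esup>\<close>.\<close>

lemma transporter_finite_card:
  fixes B :: "'k::field ^ 'n \<Rightarrow> 'k ^ 'n \<Rightarrow> 'k" and u :: "'n::finite \<Rightarrow> 'k ^ 'n" and C :: real
  assumes C: "C > 0" "\<And>A. (\<forall>j<Suc n. finite (A j) \<and> A j \<subseteq> rational_points (affine_space (block_size n j))) \<Longrightarrow>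
      finite {x \<in> rational_points (frame_scheme n :: 'k affine_scheme). \<forall>j<Suc n.
        map_points (affine_space (block_size n j)) (\<lambda>i. mvar (block n j i)) x \<in> A j} \<and>
      real (card {x \<in> rational_points (frame_scheme n :: 'k affine_scheme). \<forall>j<Suc n.
        map_points (affine_space (block_size n j)) (\<lambda>i. mvar (block n j i)) x \<in> A j})
      \<le> C * (\<Prod>j<Suc n. real (card (A j)) powr weight j)"
    and n: "n = CARD('n)"
    and B: "bilinear_form B" "symmetric_form B" "nondegenerate_form B"
    and u: "ordered_basis u" and E: "finite E"
  shows "finite (transporter (orthogonal_group B) E u) \<and>
    real (card (transporter (orthogonal_group B) E u)) \<le> C * real (card E) powr (real n / 2)"
proof -
  let ?T = "transporter (orthogonal_group B) E u"
  obtain dec where "bij_betw dec {0..<CARD('n)} (UNIV :: 'n set)"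
    using ex_bij_betw_nat_finite[OF finite] by blast
  then have dec: "bij_betw dec {..<n} UNIV" unfolding n by (simp add: lessThan_atLeast0)
  have sumdec: "(\<Sum>k<n. h (dec k)) = (\<Sum>k\<in>UNIV. h k)" for h :: "'n \<Rightarrow> 'k"
    by (rule sum.reindex_bij_betw[OF dec])
  have decsurj: "\<exists>k<n. dec k = q" for q using dec unfolding bij_betw_def by (metis UNIV_I imageE lessThan_iff)
  have decinj: "dec k = dec l \<longleftrightarrow> k = l" if "k < n" "l < n" for k l
    using dec that unfolding bij_betw_def inj_on_def by auto
  obtain R :: "'k ^ 'n ^ 'n" where R: "R ** (\<chi> i j. B (u i) (u j)) = mat 1"
    using gram_left_inverse[OF B u] by blast
  define par where "par b i k = (if b = Suc 0 then B (axis (dec i) 1) (axis (dec k) 1)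
    else if b = 2 then B (u (dec i)) (u (dec k)) else R $ dec i $ dec k)" for b i k :: nat
  define cod where "cod g b i k = (if b = 0 then g (u (dec i)) $ dec k else par b i k)"
    for g :: "'k ^ 'n \<Rightarrow> 'k ^ 'n" and b i k :: nat
  define enc where "enc g = frame_pt n (cod g)" for g
  define A where "A j = (if j = 0 then {\<lambda>i\<in>{..<3 * (n * n)}. frame_pt n par (n * n + i)}
    else (\<lambda>w. \<lambda>k\<in>{..<n}. w $ dec k) ` E)" for j :: nat
  have g_lin: "Vector_Spaces.linear (*s) (*s) g" "\<And>x y. B (g x) (g y) = B x y"
    "\<And>i. g (u i) \<in> E" if "g \<in> ?T" for g
    using that unfolding transporter_def orthogonal_group_def by auto
  have enc_point: "enc g \<in> frame_points n" if g: "g \<in> ?T" for g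
    unfolding enc_def
  proof (rule frame_pt_frame_points)
    show "cod g 1 k l = cod g 1 l k" for k l
      using B(2) by (simp add: cod_def par_def symmetric_form_def)
    show "(\<Sum>k<n. \<Sum>l<n. cod g 1 k l * (cod g 0 i k * cod g 0 j l)) = cod g 2 i j" for i j
    proof -
      have "(\<Sum>k<n. \<Sum>l<n. cod g 1 k l * (cod g 0 i k * cod g 0 j l)) =
        (\<Sum>k<n. \<Sum>l\<in>UNIV. B (axis (dec k) 1) (axis l 1) * (g (u (dec i)) $ dec k * g (u (dec j)) $ l))"
        by (simp add: cod_def par_def
            sumdec[of "\<lambda>l. B (axis (dec k) 1) (axis l 1) * (g (u (dec i)) $ dec k * g (u (dec j)) $ l)" for k])
      also have "\<dots> = B (g (u (dec i))) (g (u (dec j)))"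
        unfolding bilinear_coordinates[OF B(1), of "g (u (dec i))"]
        by (rule sumdec[of "\<lambda>k. \<Sum>l\<in>UNIV. B (axis k 1) (axis l 1) * (g (u (dec i)) $ k * g (u (dec j)) $ l)"])
      finally show ?thesis using g_lin(2)[OF g] by (simp add: cod_def par_def)
    qed
    show "(\<Sum>j<n. (\<Sum>m<n. cod g 0 m k * cod g 3 m j) * (\<Sum>l'<n. cod g 0 j l' * cod g 1 l' l))
      = (if k = l then 1 else 0)" if kl: "k < n" "l < n" for k l
    proof -
      define V :: "'k ^ 'n ^ 'n" where "V = (\<chi> p i. g (u i) $ p)"
      define S :: "'k ^ 'n ^ 'n" where "S = (\<chi> p q. B (axis p 1) (axis q 1))"
      have "(\<chi> i j. B (u i) (u j)) = transpose V ** S ** V"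
      proof -
        have "B (u i) (u j) = (\<Sum>q\<in>UNIV. (\<Sum>p\<in>UNIV. g (u i) $ p * B (axis p 1) (axis q 1)) * g (u j) $ q)" for i j
        proof -
          have "B (u i) (u j) = B (g (u i)) (g (u j))" using g_lin(2)[OF g] by simp
          also have "\<dots> = (\<Sum>p\<in>UNIV. \<Sum>q\<in>UNIV. B (axis p 1) (axis q 1) * (g (u i) $ p * g (u j) $ q))"
            by (rule bilinear_coordinates[OF B(1)])
          also have "\<dots> = (\<Sum>q\<in>UNIV. (\<Sum>p\<in>UNIV. g (u i) $ p * B (axis p 1) (axis q 1)) * g (u j) $ q)"
            by (subst sum.swap) (simp add: sum_distrib_left sum_distrib_right mult_ac)
          finally show ?thesis .
        qed
        then show ?thesis by (simp add: matrix_matrix_mult_def transpose_def V_def S_def vec_eq_iff)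
      qed
      then have "(R ** transpose V ** S) ** V = mat 1" using R by (simp add: matrix_mul_assoc)
      \<comment> \<open>The equation \<open>R G = 1\<close> with \<open>G = V\<^sup>T S V\<close> says that \<open>R V\<^sup>T S\<close> is a left inverse of \<open>V\<close>.\<close>
      then have inv: "V ** R ** (transpose V ** S) = mat 1"
        using matrix_left_right_inverse[of V "R ** transpose V ** S"] by (simp add: matrix_mul_assoc)
      have 1: "(\<Sum>m<n. cod g 0 m k * cod g 3 m j) = (V ** R) $ dec k $ dec j" for j
        using sumdec[of "\<lambda>m. g (u m) $ dec k * R $ m $ dec j"]
        by (simp add: cod_def par_def matrix_matrix_mult_def V_def)
      have 2: "(\<Sum>l'<n. cod g 0 j l' * cod g 1 l' l) = (transpose V ** S) $ dec j $ dec l" for j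
        using sumdec[of "\<lambda>p. g (u (dec j)) $ p * B (axis p 1) (axis (dec l) 1)"]
        by (simp add: cod_def par_def matrix_matrix_mult_def transpose_def V_def S_def)
      have "(\<Sum>j<n. (V ** R) $ dec k $ dec j * (transpose V ** S) $ dec j $ dec l) =
          (V ** R ** (transpose V ** S)) $ dec k $ dec l"
        using sumdec[of "\<lambda>j. (V ** R) $ dec k $ j * (transpose V ** S) $ j $ dec l"]
        unfolding matrix_matrix_mult_def[of "V ** R"] by simp
      also have "\<dots> = (if k = l then 1 else 0)" unfolding inv using decinj[OF kl] by (simp add: mat_def)
      finally show ?thesis unfolding 1 2 .
    qed
  qed
  let ?X = "frame_scheme n :: 'k affine_scheme"
  let ?M = "{x \<in> rational_points ?X. \<forall>j<Suc n.
        map_points (affine_space (block_size n j)) (\<lambda>i. mvar (block n j i)) x \<in> A j}"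
  have coord: "enc g (i * n + k) = g (u (dec i)) $ dec k" if "i < n" "k < n" for g i k
    using frame_pt_idx[of 0 i n k "cod g"] that by (simp add: idx_def enc_def cod_def)
  have enc_M: "enc g \<in> ?M" if g: "g \<in> ?T" for g
  proof (intro CollectI conjI allI impI)
    show "enc g \<in> rational_points ?X"
      using enc_point[OF g] by (auto simp: rational_points_def frame_scheme_def frame_points_def)
    fix j assume j: "j < Suc n"
    show "map_points (affine_space (block_size n j)) (\<lambda>i. mvar (block n j i)) (enc g) \<in> A j"
    proof (cases j)
      case 0
      have "enc g (n * n + i) = frame_pt n par (n * n + i)" if "i < 3 * (n * n)" for i
      proof -
        have "n * n > 0" using that by (cases n) auto
        then have "(n * n + i) div (n * n) \<noteq> 0" by (simp add: div_eq_0_iff)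
        then show ?thesis by (simp add: enc_def frame_pt_def cod_def)
      qed
      then show ?thesis unfolding map_points_coordinates 0
        by (auto simp: A_def block_def block_size_def intro!: restrict_ext)
    next
      case (Suc i)
      then have i: "i < n" using j by simp
      have "(\<lambda>k\<in>{..<n}. enc g (i * n + k)) = (\<lambda>k\<in>{..<n}. g (u (dec i)) $ dec k)"
        by (rule restrict_ext) (use coord[OF i] in auto)
      then show ?thesis unfolding map_points_coordinates Suc
        using g_lin(3)[OF g] by (auto simp: A_def block_def block_size_def)
    qed
  qed
  have inj: "inj_on enc ?T"
  proof (rule inj_onI)
    fix g h assume gh: "g \<in> ?T" "h \<in> ?T" "enc g = enc h"
    have "g (u i) = h (u i)" for i
    proof -
      obtain i' where i': "i' < n" "dec i' = i" using decsurj by blast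
      have "g (u i) $ q = h (u i) $ q" for q
      proof -
        obtain k where "k < n" "dec k = q" using decsurj by blast
        then show ?thesis using coord[OF i'(1), of k g] coord[OF i'(1), of k h] gh(3) i'(2) by simp
      qed
      then show ?thesis by (simp add: vec_eq_iff)
    qed
    moreover have "x \<in> vec.span (range u)" for x using u unfolding ordered_basis_def by blast
    ultimately have "g x = h x" for x
      using vec.linear_eq_on[OF g_lin(1)[OF gh(1)] g_lin(1)[OF gh(2)], of x "range u"] by blast
    then show "g = h" by (rule ext)
  qed
  have "\<forall>j<Suc n. finite (A j) \<and> A j \<subseteq> rational_points (affine_space (block_size n j))"
    using E by (auto simp: A_def rational_points_affine_space block_size_def split: if_split_asm)
  then have M: "finite ?M" "real (card ?M) \<le> C * (\<Prod>j<Suc n. real (card (A j)) powr weight j)"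
    using C(2)[of A] by blast+
  have fin: "finite ?T" using inj_on_finite[OF inj _ M(1)] enc_M by blast
  have "card ?T \<le> card ?M" by (rule card_inj_on_le[OF inj _ M(1)]) (use enc_M in blast)
  then have "real (card ?T) \<le> C * (\<Prod>j<Suc n. real (card (A j)) powr weight j)" using M(2) by linarith
  also have "(\<Prod>j<Suc n. real (card (A j)) powr weight j) \<le> real (card E) powr (real n / 2)"
  proof -
    have "n > 0" unfolding n by simp
    have "real (card (A (Suc j))) powr weight (Suc j) \<le> real (card E) powr (1 / 2)" for j
      using card_image_le[OF E, of "\<lambda>w. \<lambda>k\<in>{..<n}. w $ dec k"]
      by (auto simp: A_def weight_def intro!: powr_mono2)
    then have "(\<Prod>j<n. real (card (A (Suc j))) powr weight (Suc j)) \<le> (\<Prod>j<n. real (card E) powr (1 / 2))"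
      by (intro prod_mono) auto
    also have "\<dots> = (real (card E) powr (1 / 2)) ^ n" by simp
    also have "\<dots> = real (card E) powr (real n / 2)"
    proof (cases "card E = 0")
      case True
      then show ?thesis using \<open>n > 0\<close> by simp
    next
      case False
      then have "real (card E) powr (1 / 2) > 0" by simp
      then show ?thesis by (simp add: powr_powr flip: powr_realpow)
    qed
    finally show ?thesis unfolding prod.lessThan_Suc_shift by (simp add: A_def)
  qed
  finally show ?thesis using fin C(1) by simp
qed

theorem corollary11:
  assumes "brascamp_lieb_conjecture TYPE('k::field)"
    and "CHAR('k) \<noteq> 2"
  shows "\<exists>C::real. C > 0 \<and>
    (\<forall>(B :: 'k ^ 'n \<Rightarrow> 'k ^ 'n \<Rightarrow> 'k) G (E :: ('k ^ 'n) set) (u :: 'n::finite \<Rightarrow> 'k ^ 'n).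
       bilinear_form B \<longrightarrow> symmetric_form B \<longrightarrow> nondegenerate_form B \<longrightarrow>
       G \<in> {orthogonal_group B, special_orthogonal_group B} \<longrightarrow>
       finite E \<longrightarrow> ordered_basis u \<longrightarrow>
       finite (transporter G E u) \<and>
       real (card (transporter G E u)) \<le> C * real (card E) powr (real CARD('n) / 2))"
proof -
  define n where "n = CARD('n)"
  have two: "(2 :: 'k) \<noteq> 0"
  proof
    assume "(2 :: 'k) = 0"
    then have "of_nat 2 = (0 :: 'k)" by simp
    then have "CHAR('k) dvd 2" by (simp only: of_nat_eq_0_iff_char_dvd)
    then have "CHAR('k) = 1 \<or> CHAR('k) = 2" using primes_dvd_imp_eq two_is_prime_nat prime_nat_iff by blast
    then show False using assms(2) CHAR_not_1 by simp
  qed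
  let ?X = "frame_scheme n :: 'k affine_scheme"
  let ?Y = "\<lambda>j. affine_space (block_size n j) :: 'k affine_scheme"
  let ?f = "\<lambda>j i. mvar (block n j i) :: 'k mpoly"
  have ok: "\<forall>j<Suc n. affine_variety (?Y j) \<and> affine_morphism ?X (?Y j) (?f j) \<and> 0 < weight j \<and> weight j \<le> 1"
  proof (intro allI impI conjI)
    fix j assume j: "j < Suc n"
    show "affine_variety (?Y j)" by (rule affine_variety_affine_space)
    show "affine_morphism ?X (?Y j) (?f j)"
      using block_less[OF j] by (intro affine_morphism_coordinates affine_variety_frame_scheme) (simp add: frame_scheme_def)
  qed (simp_all add: weight_def)
  obtain C where C: "C > 0" "\<forall>A. (\<forall>j<Suc n. finite (A j) \<and> A j \<subseteq> rational_points (?Y j)) \<longrightarrow>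
      finite {x \<in> rational_points ?X. \<forall>j<Suc n. map_points (?Y j) (?f j) x \<in> A j} \<and>
      real (card {x \<in> rational_points ?X. \<forall>j<Suc n. map_points (?Y j) (?f j) x \<in> A j})
      \<le> C * (\<Prod>j<Suc n. real (card (A j)) powr weight j)"
    using assms(1)[unfolded brascamp_lieb_conjecture_def, THEN spec[of _ ?X], THEN spec[of _ "Suc n"],
        THEN spec[of _ ?Y], THEN spec[of _ ?f], THEN spec[of _ weight], THEN mp,
        OF affine_variety_frame_scheme, THEN mp, OF ok, THEN mp, OF frame_brascamp_lieb[OF two]]
    by (elim exE conjE) (rule that)
  show ?thesis
  proof (intro exI[of _ C] conjI allI impI C(1))
    fix B :: "'k ^ 'n \<Rightarrow> 'k ^ 'n \<Rightarrow> 'k" and G and E :: "('k ^ 'n) set"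
      and u :: "'n \<Rightarrow> 'k ^ 'n"
    assume B: "bilinear_form B" "symmetric_form B" "nondegenerate_form B"
      and G: "G \<in> {orthogonal_group B, special_orthogonal_group B}"
      and E: "finite E" and u: "ordered_basis u"
    have sub: "transporter G E u \<subseteq> transporter (orthogonal_group B) E u"
      using G by (auto simp: transporter_def special_orthogonal_group_def)
    have T: "finite (transporter (orthogonal_group B) E u)"
      "real (card (transporter (orthogonal_group B) E u)) \<le> C * real (card E) powr (real n / 2)"
      using transporter_finite_card[OF C(1) C(2)[rule_format] n_def B u E] by auto
    show "finite (transporter G E u)" using sub T(1) by (rule finite_subset)
    have "card (transporter G E u) \<le> card (transporter (orthogonal_group B) E u)"
      using T(1) sub by (rule card_mono)
    then show "real (card (transporter G E u)) \<le> C * real (card E) powr (real CARD('n) / 2)"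
      using T(2) unfolding n_def by linarith
  qed
qed

end
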